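(* Let $K$ be an infinite field and let $n,r$ be positive integers with $n\geq r$. Then the affine Schur algebra $\widetilde{S}(n+1,r)$ over $K$ is Morita equivalent to the affine Schur algebra $\widetilde{S}(n,r)$ over $K$.
   Context: Fix an infinite field $K$ and positive integers $n,r$. $\Sigma_r$ is the symmetric group on $r$ letters and $\widehat{\Sigma}_r=\Sigma_r\ltimes\mathbb{Z}^r$ is the extended affine Weyl group of type $A_{r-1}$. $I(\mathbb{Z},r)$ denotes the set of $r$-tuples $\underline{i}=(i_1,\dots,i_r)$ of integers. $\widehat{\Sigma}_r$ acts on the right on $I(\mathbb{Z},r)$: $\Sigma_r$ acts by place permutation and $\varepsilon\in\mathbb{Z}^r$ acts by the shift $\underline{i}\varepsilon=\underline{i}+n\varepsilon$ (so the action depends on $n$). It acts diagonally on $I(\mathbb{Z},r)\times I(\mathbb{Z},r)$; write $\sim$ for lying in the same $\widehat{\Sigma}_r$-orbit. To each pair $(\underline{i},\underline{j})$ associate a symbol $\xi_{\underline{i},\underline{j}}$, where $\xi_{\underline{i},\underline{j}}=\xi_{\underline{k},\underline{l}}$ if and only if $(\underline{i},\underline{j})\sim(\underline{k},\underline{l})$. The affine Schur algebra $\widetilde{S}(n,r)$ is the $K$-algebra with basis the set of these symbols and multiplication $\xi_{\underline{i},\underline{j}}\,\xi_{\underline{k},\underline{l}}=\sum_{(\underline{p},\underline{q})} Z(\underline{i},\underline{j},\underline{k},\underline{l},\underline{p},\underline{q})\,\xi_{\underline{p},\underline{q}}$, the sum over representatives of $\widehat{\Sigma}_r$-orbits on $I(\mathbb{Z},r)\times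 I(\mathbb{Z},r)$, where $Z(\underline{i},\underline{j},\underline{k},\underline{l},\underline{p},\underline{q})=\#\{\underline{s}\in I(\mathbb{Z},r)\mid (\underline{i},\underline{j})\sim(\underline{p},\underline{s}),\ (\underline{s},\underline{q})\sim(\underline{k},\underline{l})\}$. ($\widetilde{S}(n+1,r)$ is defined in the same way with $n$ replaced by $n+1$.) *)

theory Defs
  imports
    "HOL-Algebra.Module"
    "HOL-Combinatorics.Permutations"
    "HOL-Library.FuncSet"
    "HOL-Library.Poly_Mapping"
begin

section \<open>The affine Schur algebra\<close>

type_synonym tuple = "nat \<Rightarrow> int"

definition tuples :: "nat \<Rightarrow> tuple set" where
  "tuples r = {1..r} \<rightarrow>\<^sub>E UNIV"

text \<open>
  The extended affine Weyl group is the semidirect product of the symmetric group and the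
  lattice; every element is uniquely a product \<open>\<sigma>\<epsilon>\<close>, encoded as the pair \<open>(\<sigma>, \<epsilon>)\<close>.
  Hence \<open>\<ii>(\<sigma>\<epsilon>) = (\<ii>\<sigma>)\<epsilon>\<close> is first a place permutation and then a shift.
  The orbits need only the underlying set and its action.
\<close>

definition affine_weyl :: "nat \<Rightarrow> ((nat \<Rightarrow> nat) \<times> tuple) set" where
  "affine_weyl r = {\<sigma>. \<sigma> permutes {1..r}} \<times> tuples r"

definition weyl_act :: "nat \<Rightarrow> nat \<Rightarrow> tuple \<Rightarrow> (nat \<Rightarrow> nat) \<times> tuple \<Rightarrow> tuple" where
  "weyl_act n r i w = (\<lambda>a\<in>{1..r}. i (fst w a) + int n * snd w a)"

definition orbit_rel :: "nat \<Rightarrow> nat \<Rightarrow> ((tuple \<times> tuple) \<times> (tuple \<times> tuple)) set" where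
  "orbit_rel n r = {((i, j), (k, l)). i \<in> tuples r \<and> j \<in> tuples r \<and>
     (\<exists>w\<in>affine_weyl r. k = weyl_act n r i w \<and> l = weyl_act n r j w)}"

definition pair_orbits :: "nat \<Rightarrow> nat \<Rightarrow> (tuple \<times> tuple) set set" where
  "pair_orbits n r = (tuples r \<times> tuples r) // orbit_rel n r"

definition Z :: "nat \<Rightarrow> nat \<Rightarrow> tuple \<times> tuple \<Rightarrow> tuple \<times> tuple \<Rightarrow> tuple \<times> tuple \<Rightarrow> nat" where
  "Z n r = (\<lambda>(i, j) (k, l) (p, q).
     card {s \<in> tuples r. ((i, j), (p, s)) \<in> orbit_rel n r \<and> ((s, q), (k, l)) \<in> orbit_rel n r})"

text \<open>
  Elements of the algebra are finitely supported functions on orbits of pairs;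
  the symbol \<open>\<xi>\<^sub>i\<^sub>,\<^sub>j\<close> is the indicator function of the orbit of \<open>(i, j)\<close>.
\<close>

type_synonym 'k schur_elem = "(tuple \<times> tuple) set \<Rightarrow>\<^sub>0 'k"

definition xi :: "nat \<Rightarrow> nat \<Rightarrow> tuple \<Rightarrow> tuple \<Rightarrow> ('k::field) schur_elem" where
  "xi n r i j = Poly_Mapping.single (orbit_rel n r `` {(i, j)}) 1"

definition rep :: "(tuple \<times> tuple) set \<Rightarrow> tuple \<times> tuple" where
  "rep C = (SOME x. x \<in> C)"

text \<open>
  Only finitely many orbits \<open>C\<close> have a nonzero structure constant (see \<open>Z_finite\<close> below), so the
  inner sum is finite; the index set is cut down because a sum over an infinite set is \<open>0\<close> in HOL.
\<close>

definition schur_mult :: "nat \<Rightarrow> nat \<Rightarrow> ('k::field) schur_elem \<Rightarrow> 'k schur_elem \<Rightarrow> 'k schur_elem" where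
  "schur_mult n r f g =
     (\<Sum>A\<in>Poly_Mapping.keys f. \<Sum>B\<in>Poly_Mapping.keys g.
        \<Sum>C | C \<in> pair_orbits n r \<and> Z n r (rep A) (rep B) (rep C) \<noteq> 0.
          Poly_Mapping.single C
            (Poly_Mapping.lookup f A * Poly_Mapping.lookup g B * of_nat (Z n r (rep A) (rep B) (rep C))))"

text \<open>
  The identity is the sum of the distinct symbols \<open>\<xi>\<^sub>i\<^sub>,\<^sub>i\<close>; there are finitely many of them, since
  every tuple is in the orbit of one with entries in \<open>{1..n}\<close>.
\<close>

definition affine_schur :: "nat \<Rightarrow> nat \<Rightarrow> ('k::field, 'k schur_elem) module" where
  "affine_schur n r =
     \<lparr>carrier = {f. Poly_Mapping.keys f \<subseteq> pair_orbits n r},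
      monoid.mult = schur_mult n r,
      one = (\<Sum>C\<in>(\<lambda>i. orbit_rel n r `` {(i, i)}) ` tuples r. Poly_Mapping.single C 1),
      zero = 0,
      add = (+),
      smult = (\<lambda>c. Poly_Mapping.map ((*) c))\<rparr>"

subsection \<open>Well-definedness\<close>

lemma weyl_act_tuples: "weyl_act n r i w \<in> tuples r"
  by (auto simp: weyl_act_def tuples_def)

lemma weyl_act_id: "i \<in> tuples r \<Longrightarrow> weyl_act n r i (id, \<lambda>a\<in>{1..r}. 0) = i"
  by (rule ext) (auto simp: weyl_act_def tuples_def PiE_def extensional_def)

lemma weyl_id: "(id, \<lambda>a\<in>{1..r}. 0) \<in> affine_weyl r"
  by (auto simp: affine_weyl_def tuples_def permutes_id)

definition weyl_inv :: "nat \<Rightarrow> (nat \<Rightarrow> nat) \<times> tuple \<Rightarrow> (nat \<Rightarrow> nat) \<times> tuple" where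
  "weyl_inv r w = (inv_into UNIV (fst w), \<lambda>a\<in>{1..r}. - snd w (inv_into UNIV (fst w) a))"

lemma weyl_inv:
  assumes "w \<in> affine_weyl r"
  shows "weyl_inv r w \<in> affine_weyl r"
    and "i \<in> tuples r \<Longrightarrow> weyl_act n r (weyl_act n r i w) (weyl_inv r w) = i"
    and "i \<in> tuples r \<Longrightarrow> weyl_act n r (weyl_act n r i (weyl_inv r w)) w = i"
proof -
  have p: "fst w permutes {1..r}"
    using assms by (auto simp: affine_weyl_def)
  have p': "inv_into UNIV (fst w) permutes {1..r}"
    using p by (rule permutes_inv)
  have in1: "a \<in> {1..r} \<Longrightarrow> fst w a \<in> {1..r}" and in2: "a \<in> {1..r} \<Longrightarrow> inv_into UNIV (fst w) a \<in> {1..r}" for a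
    using permutes_in_image[OF p] permutes_in_image[OF p'] by blast+
  show "weyl_inv r w \<in> affine_weyl r"
    using p' by (auto simp: affine_weyl_def weyl_inv_def tuples_def)
  show "weyl_act n r (weyl_act n r i w) (weyl_inv r w) = i" if "i \<in> tuples r"
  proof
    fix a show "weyl_act n r (weyl_act n r i w) (weyl_inv r w) a = i a"
      using that in2[of a] permutes_inverses[OF p]
      by (cases "a \<in> {1..r}") (auto simp: weyl_act_def weyl_inv_def tuples_def PiE_def extensional_def)
  qed
  show "weyl_act n r (weyl_act n r i (weyl_inv r w)) w = i" if "i \<in> tuples r"
  proof
    fix a show "weyl_act n r (weyl_act n r i (weyl_inv r w)) w a = i a"
      using that in1[of a] permutes_inverses[OF p]
      by (cases "a \<in> {1..r}") (auto simp: weyl_act_def weyl_inv_def tuples_def PiE_def extensional_def)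
  qed
qed

lemma weyl_comp:
  assumes "v \<in> affine_weyl r" "w \<in> affine_weyl r"
  obtains u where "u \<in> affine_weyl r" "\<And>i. weyl_act n r (weyl_act n r i v) w = weyl_act n r i u"
proof
  let ?u = "(fst v \<circ> fst w, \<lambda>a\<in>{1..r}. snd v (fst w a) + snd w a)"
  have p: "fst w permutes {1..r}" "fst v permutes {1..r}"
    using assms by (auto simp: affine_weyl_def)
  show "?u \<in> affine_weyl r"
    using permutes_compose[OF p] by (auto simp: affine_weyl_def tuples_def)
  show "weyl_act n r (weyl_act n r i v) w = weyl_act n r i ?u" for i
  proof
    fix a show "weyl_act n r (weyl_act n r i v) w a = weyl_act n r i ?u a"
      using permutes_in_image[OF p(1), of a]
      by (cases "a \<in> {1..r}") (auto simp: weyl_act_def algebra_simps)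
  qed
qed

lemma orbit_rel_equiv: "equiv (tuples r \<times> tuples r) (orbit_rel n r)"
proof (rule equivI)
  show "orbit_rel n r \<subseteq> (tuples r \<times> tuples r) \<times> (tuples r \<times> tuples r)"
    by (auto simp: orbit_rel_def weyl_act_tuples)
  show "refl_on (tuples r \<times> tuples r) (orbit_rel n r)"
    by (auto simp: refl_on_def orbit_rel_def simp del: restrict_apply
        intro!: bexI[OF _ weyl_id] weyl_act_id[symmetric])
  show "sym (orbit_rel n r)"
  proof (rule symI)
    fix x y assume "(x, y) \<in> orbit_rel n r"
    then obtain w where w: "w \<in> affine_weyl r" and x: "fst x \<in> tuples r" "snd x \<in> tuples r"
      and y: "y = (weyl_act n r (fst x) w, weyl_act n r (snd x) w)"
      by (auto simp: orbit_rel_def)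
    show "(y, x) \<in> orbit_rel n r"
      using weyl_inv(1)[OF w] x unfolding y
      by (cases x) (auto simp: orbit_rel_def weyl_act_tuples weyl_inv(2)[OF w] intro!: bexI[of _ "weyl_inv r w"])
  qed
  show "trans (orbit_rel n r)"
  proof (rule transI)
    fix x y z assume "(x, y) \<in> orbit_rel n r" "(y, z) \<in> orbit_rel n r"
    then obtain v w where vw: "v \<in> affine_weyl r" "w \<in> affine_weyl r"
      and x: "fst x \<in> tuples r" "snd x \<in> tuples r"
      and z: "fst z = weyl_act n r (weyl_act n r (fst x) v) w"
        "snd z = weyl_act n r (weyl_act n r (snd x) v) w"
      by (auto simp: orbit_rel_def)
    obtain u where "u \<in> affine_weyl r"
      "\<And>i. weyl_act n r (weyl_act n r i v) w = weyl_act n r i u"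
      using weyl_comp[OF vw] by blast
    with x z show "(x, z) \<in> orbit_rel n r"
      by (cases x, cases z) (auto simp: orbit_rel_def)
  qed
qed

lemma xi_eq_iff:
  assumes "i \<in> tuples r" "j \<in> tuples r" "k \<in> tuples r" "l \<in> tuples r"
  shows "(xi n r i j :: 'k::field schur_elem) = xi n r k l \<longleftrightarrow> ((i, j), (k, l)) \<in> orbit_rel n r"
proof -
  have "(xi n r i j :: 'k schur_elem) = xi n r k l \<longleftrightarrow>
      orbit_rel n r `` {(i, j)} = orbit_rel n r `` {(k, l)}"
    unfolding xi_def by (metis keys_single one_neq_zero singleton_inject)
  also have "\<dots> \<longleftrightarrow> ((i, j), (k, l)) \<in> orbit_rel n r"
    using assms by (intro eq_equiv_class_iff[OF orbit_rel_equiv]) auto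
  finally show ?thesis .
qed

lemma orbit_rel_act:
  assumes "i \<in> tuples r" "j \<in> tuples r" "w \<in> affine_weyl r"
  shows "((i, j), (weyl_act n r i w, weyl_act n r j w)) \<in> orbit_rel n r"
  using assms by (auto simp: orbit_rel_def)

lemma finite_weyl_transporter:
  assumes "n \<ge> 1"
  shows "finite {w \<in> affine_weyl r. weyl_act n r i w = j}"
proof (rule finite_subset)
  show "{w \<in> affine_weyl r. weyl_act n r i w = j} \<subseteq>
      (\<lambda>\<sigma>. (\<sigma>, \<lambda>a\<in>{1..r}. (j a - i (\<sigma> a)) div int n)) ` {\<sigma>. \<sigma> permutes {1..r}}"
  proof
    fix w assume "w \<in> {w \<in> affine_weyl r. weyl_act n r i w = j}"
    then have w: "fst w permutes {1..r}" "snd w \<in> tuples r" and j: "j = weyl_act n r i w"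
      by (auto simp: affine_weyl_def)
    have "snd w = (\<lambda>a\<in>{1..r}. (j a - i (fst w a)) div int n)"
    proof
      fix a show "snd w a = (\<lambda>a\<in>{1..r}. (j a - i (fst w a)) div int n) a"
        using assms w(2)
        by (cases "a \<in> {1..r}") (auto simp: j weyl_act_def tuples_def PiE_def extensional_def)
    qed
    then have "w = (\<lambda>\<sigma>. (\<sigma>, \<lambda>a\<in>{1..r}. (j a - i (\<sigma> a)) div int n)) (fst w)"
      by (metis prod.collapse)
    with w(1) show "w \<in> (\<lambda>\<sigma>. (\<sigma>, \<lambda>a\<in>{1..r}. (j a - i (\<sigma> a)) div int n)) ` {\<sigma>. \<sigma> permutes {1..r}}"
      by blast
  qed
  show "finite ((\<lambda>\<sigma>. (\<sigma>, \<lambda>a\<in>{1..r}. (j a - i (\<sigma> a)) div int n)) ` {\<sigma>. \<sigma> permutes {1..r}})"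
    by (intro finite_imageI finite_permutations) auto
qed

lemma Z_set_finite:
  assumes "n \<ge> 1"
  shows "finite {s \<in> tuples r. ((i, j), (p, s)) \<in> orbit_rel n r \<and> ((s, q), (k, l)) \<in> orbit_rel n r}"
  by (rule finite_subset[OF _ finite_imageI[OF finite_weyl_transporter[OF assms, of r i p],
        of "weyl_act n r j"]]) (auto simp: orbit_rel_def)

lemma Z_cong:
  assumes "(x, x') \<in> orbit_rel n r" "(y, y') \<in> orbit_rel n r" "(c, c') \<in> orbit_rel n r"
  shows "Z n r x y c = Z n r x' y' c'"
proof -
  note e = orbit_rel_equiv[of r n]
  have sy: "\<And>a b. (a, b) \<in> orbit_rel n r \<Longrightarrow> (b, a) \<in> orbit_rel n r"
    using e by (meson equivE symE)
  have tr: "\<And>a b c. (a, b) \<in> orbit_rel n r \<Longrightarrow> (b, c) \<in> orbit_rel n r \<Longrightarrow> (a, c) \<in> orbit_rel n r"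
    using e by (meson equivE transE)
  obtain p q w where c: "c = (p, q)" "p \<in> tuples r" "q \<in> tuples r" and w: "w \<in> affine_weyl r"
    and c': "c' = (weyl_act n r p w, weyl_act n r q w)"
    using assms(3) by (auto simp: orbit_rel_def)
  define S where "S x y c = {s \<in> tuples r. (x, (fst c, s)) \<in> orbit_rel n r \<and> ((s, snd c), y) \<in> orbit_rel n r}"
    for x y c
  have Z: "Z n r x y c = card (S x y c)" for x y c
    by (simp add: Z_def S_def case_prod_beta)
  have "bij_betw (\<lambda>s. weyl_act n r s w) (S x y c) (S x' y' c')"
  proof (rule bij_betw_byWitness[where f' = "\<lambda>s. weyl_act n r s (weyl_inv r w)"])
    show "\<forall>a\<in>S x y c. weyl_act n r (weyl_act n r a w) (weyl_inv r w) = a"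
      by (simp add: S_def weyl_inv[OF w])
    show "\<forall>a\<in>S x' y' c'. weyl_act n r (weyl_act n r a (weyl_inv r w)) w = a"
      by (simp add: S_def weyl_inv[OF w])
    show "(\<lambda>s. weyl_act n r s w) ` S x y c \<subseteq> S x' y' c'"
    proof
      fix t assume "t \<in> (\<lambda>s. weyl_act n r s w) ` S x y c"
      then obtain s where t: "t = weyl_act n r s w" and s: "s \<in> tuples r"
        "(x, (p, s)) \<in> orbit_rel n r" "((s, q), y) \<in> orbit_rel n r"
        by (auto simp: S_def c)
      have "(x', (weyl_act n r p w, t)) \<in> orbit_rel n r"
        unfolding t by (rule tr[OF tr[OF sy[OF assms(1)] s(2)] orbit_rel_act[OF c(2) s(1) w]])
      moreover have "((t, weyl_act n r q w), y') \<in> orbit_rel n r"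
        unfolding t by (rule tr[OF sy[OF orbit_rel_act[OF s(1) c(3) w]] tr[OF s(3) assms(2)]])
      ultimately
      show "t \<in> S x' y' c'"
        by (auto simp: S_def c' t weyl_act_tuples)
    qed
    show "(\<lambda>s. weyl_act n r s (weyl_inv r w)) ` S x' y' c' \<subseteq> S x y c"
    proof
      fix t assume "t \<in> (\<lambda>s. weyl_act n r s (weyl_inv r w)) ` S x' y' c'"
      then obtain s where t: "t = weyl_act n r s (weyl_inv r w)" and s: "s \<in> tuples r"
        "(x', (weyl_act n r p w, s)) \<in> orbit_rel n r" "((s, weyl_act n r q w), y') \<in> orbit_rel n r"
        by (auto simp: S_def c')
      have t': "t \<in> tuples r" "s = weyl_act n r t w"
        using s(1) by (auto simp: t weyl_act_tuples weyl_inv[OF w])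
      have "(x, (p, t)) \<in> orbit_rel n r"
        by (rule tr[OF assms(1) tr[OF s(2)[unfolded t'(2)] sy[OF orbit_rel_act[OF c(2) t'(1) w]]]])
      moreover have "((t, q), y) \<in> orbit_rel n r"
        by (rule tr[OF tr[OF orbit_rel_act[OF t'(1) c(3) w] s(3)[unfolded t'(2)]] sy[OF assms(2)]])
      ultimately show "t \<in> S x y c"
        by (auto simp: S_def c t')
    qed
  qed
  then show ?thesis
    unfolding Z by (rule bij_betw_same_card)
qed

lemma Z_finite:
  assumes "n \<ge> 1" "x \<in> tuples r \<times> tuples r"
  shows "finite {C \<in> pair_orbits n r. Z n r x y (rep C) \<noteq> 0}"
proof -
  note e = orbit_rel_equiv[of r n]
  obtain i j k l where xy: "x = (i, j)" "y = (k, l)" and ij: "i \<in> tuples r" "j \<in> tuples r"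
    using assms(2) by (cases x, cases y) auto
  let ?W = "{v \<in> affine_weyl r. weyl_act n r k v = j}"
  let ?h = "\<lambda>v. orbit_rel n r `` {(i, weyl_act n r l v)}"
  have "C \<in> ?h ` ?W" if C: "C \<in> pair_orbits n r" and nz: "Z n r x y (rep C) \<noteq> 0" for C
  proof -
    obtain p q where pq: "rep C = (p, q)" by force
    obtain x0 where x0: "C = orbit_rel n r `` {x0}" "x0 \<in> tuples r \<times> tuples r"
      using C unfolding pair_orbits_def by (rule quotientE)
    have "x0 \<in> C" unfolding x0(1) using e x0(2) by (rule equiv_class_self)
    then have "rep C \<in> C" unfolding rep_def by (rule someI)
    then have "(x0, (p, q)) \<in> orbit_rel n r" unfolding pq by (simp add: x0(1))
    then have Cpq: "C = orbit_rel n r `` {(p, q)}"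
      unfolding x0(1) by (rule equiv_class_eq[OF e])
    obtain s where s: "((i, j), (p, s)) \<in> orbit_rel n r" "((s, q), (k, l)) \<in> orbit_rel n r"
      using nz unfolding Z_def xy pq by (auto simp: card_eq_0_iff)
    obtain w where w: "w \<in> affine_weyl r" "p = weyl_act n r i w" "s = weyl_act n r j w"
      using s(1) by (auto simp: orbit_rel_def)
    define q' where "q' = weyl_act n r q (weyl_inv r w)"
    have q: "q \<in> tuples r" "s \<in> tuples r" using s by (auto simp: orbit_rel_def)
    have a1: "((s, q), (j, q')) \<in> orbit_rel n r"
      using orbit_rel_act[OF q(2,1) weyl_inv(1)[OF w(1)], of n]
      by (simp add: q'_def w weyl_inv(2)[OF w(1)] ij)
    have "((k, l), (j, q')) \<in> orbit_rel n r"
      using a1 s(2) e by (meson equivE symE transE)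
    then obtain v where v: "v \<in> affine_weyl r" "j = weyl_act n r k v" "q' = weyl_act n r l v"
      by (auto simp: orbit_rel_def)
    have "((p, q), (i, q')) \<in> orbit_rel n r"
      using orbit_rel_act[OF _ q(1) weyl_inv(1)[OF w(1)], of p n]
      by (simp add: q'_def w weyl_inv(2)[OF w(1)] ij weyl_act_tuples)
    then have "C = ?h v"
      unfolding Cpq v(3) by (rule equiv_class_eq[OF e])
    then show ?thesis using v by blast
  qed
  then have "{C \<in> pair_orbits n r. Z n r x y (rep C) \<noteq> 0} \<subseteq> ?h ` ?W" by blast
  then show ?thesis
    using finite_weyl_transporter[OF assms(1)] by (meson finite_imageI finite_subset)
qed

text \<open>The product of two symbols, with respect to an arbitrary system \<open>R\<close> of representatives.\<close>

lemma xi_mult: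
  assumes "n \<ge> 1" and t: "i \<in> tuples r" "j \<in> tuples r" "k \<in> tuples r" "l \<in> tuples r"
    and R: "R \<subseteq> tuples r \<times> tuples r" "bij_betw (\<lambda>x. orbit_rel n r `` {x}) R (pair_orbits n r)"
  shows "finite {(p, q) \<in> R. Z n r (i, j) (k, l) (p, q) \<noteq> 0}"
    and "schur_mult n r (xi n r i j) (xi n r k l) =
      (\<Sum>(p, q) | (p, q) \<in> R \<and> Z n r (i, j) (k, l) (p, q) \<noteq> 0.
        Poly_Mapping.map ((*) (of_nat (Z n r (i, j) (k, l) (p, q)) :: 'k::field)) (xi n r p q))"
proof -
  note e = orbit_rel_equiv[of r n]
  let ?cl = "\<lambda>x. orbit_rel n r `` {x}"
  have rep: "(x, rep (?cl x)) \<in> orbit_rel n r" if "x \<in> tuples r \<times> tuples r" for x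
  proof -
    have "x \<in> ?cl x" using e that by (rule equiv_class_self)
    then have "rep (?cl x) \<in> ?cl x" unfolding rep_def by (rule someI)
    then show ?thesis by simp
  qed
  have Zrep: "Z n r (rep (?cl (i, j))) (rep (?cl (k, l))) (rep (?cl x)) = Z n r (i, j) (k, l) x"
    if "x \<in> R" for x
    using Z_cong[OF rep rep rep, of "(i, j)" "(k, l)" x] t R(1) that by auto
  let ?P = "{x \<in> R. Z n r (i, j) (k, l) x \<noteq> 0}"
  let ?Q = "{C \<in> pair_orbits n r. Z n r (rep (?cl (i, j))) (rep (?cl (k, l))) (rep C) \<noteq> 0}"
  have bij: "bij_betw ?cl ?P ?Q"
  proof (rule bij_betw_imageI)
    show "inj_on ?cl ?P" using R(2) by (auto simp: bij_betw_def inj_on_def)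
    have "pair_orbits n r = ?cl ` R" using R(2) by (simp add: bij_betw_def)
    then show "?cl ` ?P = ?Q" using Zrep by auto
  qed
  have "rep (?cl (i, j)) \<in> tuples r \<times> tuples r"
    using rep[of "(i, j)"] t equiv_type[OF e] by auto
  then have "finite ?Q" by (rule Z_finite[OF assms(1)])
  then have fin: "finite ?P" using bij_betw_finite[OF bij] by simp
  have P: "{(p, q) \<in> R. Z n r (i, j) (k, l) (p, q) \<noteq> 0} = ?P" by auto
  show "finite {(p, q) \<in> R. Z n r (i, j) (k, l) (p, q) \<noteq> 0}" using fin unfolding P .
  have "schur_mult n r (xi n r i j) (xi n r k l) =
      (\<Sum>C\<in>?Q. Poly_Mapping.single C (of_nat (Z n r (rep (?cl (i, j))) (rep (?cl (k, l))) (rep C)) :: 'k))"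
    by (simp add: schur_mult_def xi_def)
  also have "\<dots> = (\<Sum>x\<in>?P. Poly_Mapping.single (?cl x) (of_nat (Z n r (i, j) (k, l) x)))"
    by (subst sum.reindex_bij_betw[OF bij, symmetric]) (auto intro!: sum.cong simp: Zrep)
  also have "\<dots> = (\<Sum>(p, q)\<in>?P.
      Poly_Mapping.map ((*) (of_nat (Z n r (i, j) (k, l) (p, q)) :: 'k)) (xi n r p q))"
    by (auto intro!: sum.cong poly_mapping_eqI simp: xi_def map.rep_eq lookup_single when_def)
  finally show "schur_mult n r (xi n r i j) (xi n r k l) =
      (\<Sum>(p, q) | (p, q) \<in> R \<and> Z n r (i, j) (k, l) (p, q) \<noteq> 0.
        Poly_Mapping.map ((*) (of_nat (Z n r (i, j) (k, l) (p, q)) :: 'k)) (xi n r p q))"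
    unfolding P[symmetric] by simp
qed


section \<open>Modules over a noncommutative algebra and Morita equivalence\<close>

locale field_algebra = ring A for A :: "('k::field, 'a) module" (structure) +
  assumes scale_closed: "x \<in> carrier A \<Longrightarrow> c \<odot> x \<in> carrier A"
    and scale_add_left: "x \<in> carrier A \<Longrightarrow> (c + d) \<odot> x = c \<odot> x \<oplus> d \<odot> x"
    and scale_add_right: "x \<in> carrier A \<Longrightarrow> y \<in> carrier A \<Longrightarrow> c \<odot> (x \<oplus> y) = c \<odot> x \<oplus> c \<odot> y"
    and scale_assoc: "x \<in> carrier A \<Longrightarrow> (c * d) \<odot> x = c \<odot> (d \<odot> x)"
    and scale_one: "x \<in> carrier A \<Longrightarrow> 1 \<odot> x = x"
    and scale_mult_left: "x \<in> carrier A \<Longrightarrow> y \<in> carrier A \<Longrightarrow> (c \<odot> x) \<otimes> y = c \<odot> (x \<otimes> y)"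
    and scale_mult_right: "x \<in> carrier A \<Longrightarrow> y \<in> carrier A \<Longrightarrow> x \<otimes> (c \<odot> y) = c \<odot> (x \<otimes> y)"

text \<open>The library locale \<open>module\<close> requires a commutative base ring.\<close>

locale left_module = R?: ring R + M?: abelian_group M
  for R :: "('a, 'b) ring_scheme" (structure) and M :: "('a, 'u) module" (structure) +
  assumes smult_closed: "a \<in> carrier R \<Longrightarrow> x \<in> carrier M \<Longrightarrow> a \<odot>\<^bsub>M\<^esub> x \<in> carrier M"
    and smult_l_distr: "a \<in> carrier R \<Longrightarrow> b \<in> carrier R \<Longrightarrow> x \<in> carrier M \<Longrightarrow>
      (a \<oplus> b) \<odot>\<^bsub>M\<^esub> x = a \<odot>\<^bsub>M\<^esub> x \<oplus>\<^bsub>M\<^esub> b \<odot>\<^bsub>M\<^esub> x"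
    and smult_r_distr: "a \<in> carrier R \<Longrightarrow> x \<in> carrier M \<Longrightarrow> y \<in> carrier M \<Longrightarrow>
      a \<odot>\<^bsub>M\<^esub> (x \<oplus>\<^bsub>M\<^esub> y) = a \<odot>\<^bsub>M\<^esub> x \<oplus>\<^bsub>M\<^esub> a \<odot>\<^bsub>M\<^esub> y"
    and smult_assoc: "a \<in> carrier R \<Longrightarrow> b \<in> carrier R \<Longrightarrow> x \<in> carrier M \<Longrightarrow>
      (a \<otimes> b) \<odot>\<^bsub>M\<^esub> x = a \<odot>\<^bsub>M\<^esub> (b \<odot>\<^bsub>M\<^esub> x)"
    and smult_one: "x \<in> carrier M \<Longrightarrow> \<one> \<odot>\<^bsub>M\<^esub> x = x"

text \<open>
  The category of left \<open>A\<close>-modules with carrier inside a universe \<open>'u\<close>. Homomorphisms are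
  extensional functions, so that equality of morphisms is equality of functions on the carrier.
\<close>

definition Mod :: "('k::field, 'a) module \<Rightarrow> ('a, 'u) module set" where
  "Mod A = {M. left_module A M}"

definition mod_hom ::
  "('k::field, 'a) module \<Rightarrow> ('a, 'u) module \<Rightarrow> ('a, 'u) module \<Rightarrow> ('u \<Rightarrow> 'u) set" where
  "mod_hom A M N = {f \<in> carrier M \<rightarrow>\<^sub>E carrier N.
     (\<forall>x\<in>carrier M. \<forall>y\<in>carrier M. f (x \<oplus>\<^bsub>M\<^esub> y) = f x \<oplus>\<^bsub>N\<^esub> f y) \<and>
     (\<forall>a\<in>carrier A. \<forall>x\<in>carrier M. f (a \<odot>\<^bsub>M\<^esub> x) = a \<odot>\<^bsub>N\<^esub> f x)}"

definition mod_id :: "('a, 'u) module \<Rightarrow> 'u \<Rightarrow> 'u" where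
  "mod_id M = (\<lambda>x\<in>carrier M. x)"

definition mod_comp :: "('a, 'u) module \<Rightarrow> ('u \<Rightarrow> 'u) \<Rightarrow> ('u \<Rightarrow> 'u) \<Rightarrow> 'u \<Rightarrow> 'u" where
  "mod_comp M g f = compose (carrier M) g f"

definition hom_add ::
  "('a, 'u) module \<Rightarrow> ('a, 'u) module \<Rightarrow> ('u \<Rightarrow> 'u) \<Rightarrow> ('u \<Rightarrow> 'u) \<Rightarrow> 'u \<Rightarrow> 'u" where
  "hom_add M N f g = (\<lambda>x\<in>carrier M. f x \<oplus>\<^bsub>N\<^esub> g x)"

text \<open>The ground field acts on a module through the multiples of the identity of the algebra.\<close>

definition hom_scale ::
  "('k::field, 'a) module \<Rightarrow> ('a, 'u) module \<Rightarrow> ('a, 'u) module \<Rightarrow> 'k \<Rightarrow> ('u \<Rightarrow> 'u) \<Rightarrow> 'u \<Rightarrow> 'u" where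
  "hom_scale A M N c f = (\<lambda>x\<in>carrier M. (c \<odot>\<^bsub>A\<^esub> \<one>\<^bsub>A\<^esub>) \<odot>\<^bsub>N\<^esub> f x)"

text \<open>
  A functor is given by its action \<open>Fo\<close> on objects and its action \<open>Fm M N\<close> on morphisms
  from \<open>M\<close> to \<open>N\<close>.
\<close>

type_synonym ('a, 'b, 'u) obj_map = "('a, 'u) module \<Rightarrow> ('b, 'u) module"
type_synonym ('a, 'u) mor_map = "('a, 'u) module \<Rightarrow> ('a, 'u) module \<Rightarrow> ('u \<Rightarrow> 'u) \<Rightarrow> 'u \<Rightarrow> 'u"

locale linear_functor =
  fixes A :: "('k::field, 'a) module" and B :: "('k, 'b) module"
    and Fo :: "('a, 'b, 'u) obj_map" and Fm :: "('a, 'u) mor_map"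
  assumes obj: "M \<in> Mod A \<Longrightarrow> Fo M \<in> Mod B"
    and mor: "M \<in> Mod A \<Longrightarrow> N \<in> Mod A \<Longrightarrow> f \<in> mod_hom A M N \<Longrightarrow>
      Fm M N f \<in> mod_hom B (Fo M) (Fo N)"
    and ident: "M \<in> Mod A \<Longrightarrow> Fm M M (mod_id M) = mod_id (Fo M)"
    and comp: "L \<in> Mod A \<Longrightarrow> M \<in> Mod A \<Longrightarrow> N \<in> Mod A \<Longrightarrow>
      f \<in> mod_hom A L M \<Longrightarrow> g \<in> mod_hom A M N \<Longrightarrow>
      Fm L N (mod_comp L g f) = mod_comp (Fo L) (Fm M N g) (Fm L M f)"
    and mor_add: "M \<in> Mod A \<Longrightarrow> N \<in> Mod A \<Longrightarrow> f \<in> mod_hom A M N \<Longrightarrow> g \<in> mod_hom A M N \<Longrightarrow>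
      Fm M N (hom_add M N f g) = hom_add (Fo M) (Fo N) (Fm M N f) (Fm M N g)"
    and mor_scale: "M \<in> Mod A \<Longrightarrow> N \<in> Mod A \<Longrightarrow> f \<in> mod_hom A M N \<Longrightarrow>
      Fm M N (hom_scale A M N c f) = hom_scale B (Fo M) (Fo N) c (Fm M N f)"

definition mod_iso ::
  "('k::field, 'a) module \<Rightarrow> ('a, 'u) module \<Rightarrow> ('a, 'u) module \<Rightarrow> ('u \<Rightarrow> 'u) set" where
  "mod_iso A M N = {f \<in> mod_hom A M N.
     \<exists>g\<in>mod_hom A N M. mod_comp M g f = mod_id M \<and> mod_comp N f g = mod_id N}"

definition natural_iso_to_id ::
  "('k::field, 'a) module \<Rightarrow> ('a, 'a, 'u) obj_map \<Rightarrow> ('a, 'u) mor_map \<Rightarrow>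
    (('a, 'u) module \<Rightarrow> 'u \<Rightarrow> 'u) \<Rightarrow> bool" where
  "natural_iso_to_id A To Tm \<eta> \<longleftrightarrow>
     (\<forall>M\<in>Mod A. \<eta> M \<in> mod_iso A (To M) M) \<and>
     (\<forall>M\<in>Mod A. \<forall>N\<in>Mod A. \<forall>f\<in>mod_hom A M N.
        mod_comp (To M) (\<eta> N) (Tm M N f) = mod_comp (To M) f (\<eta> M))"

text \<open>
  Morita equivalence of algebras over a field: there are linear functors between the module
  categories whose two composites are naturally isomorphic to the identity functors.
  HOL cannot quantify over types inside a formula, so the universe of the module categories is
  the explicit type parameter \<open>'u\<close>. A theorem in which \<open>'u\<close> is a free type variable asserts the
  equivalence for every universe, and thus for arbitrarily large ones.
\<close>

definition morita_equivalent ::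
  "'u itself \<Rightarrow> ('k::field, 'a) module \<Rightarrow> ('k, 'b) module \<Rightarrow> bool" where
  "morita_equivalent (_ :: 'u itself) A B \<longleftrightarrow>
     field_algebra A \<and> field_algebra B \<and>
     (\<exists>(Fo :: ('a, 'b, 'u) obj_map) Fm (Go :: ('b, 'a, 'u) obj_map) Gm \<eta> \<theta>.
        linear_functor A B Fo Fm \<and> linear_functor B A Go Gm \<and>
        natural_iso_to_id A (\<lambda>M. Go (Fo M)) (\<lambda>M N f. Gm (Fo M) (Fo N) (Fm M N f)) \<eta> \<and>
        natural_iso_to_id B (\<lambda>M. Fo (Go M)) (\<lambda>M N f. Fm (Go M) (Go N) (Gm M N f)) \<theta>)"

end

theory Submission
  imports Defs
begin

text \<open>
  Let \<open>G\<close> be the extended affine Weyl group and \<open>X\<^sub>n\<close> the \<open>G\<close>-set of \<open>r\<close>-tuples of integers in which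
  the lattice acts through multiples of \<open>n\<close>. The structure constants \<open>Z\<close> say that the affine Schur
  algebra is the algebra of \<open>G\<close>-invariant matrices over \<open>K\<close> indexed by \<open>X\<^sub>n\<close> whose rows have finite
  support, with the ordinary matrix product; an element is recovered from its matrix entries
  (\<open>schur_elem_eqI\<close>, \<open>of_entries\<close>, \<open>entry_schur_mult\<close>). In particular the multiplication is
  associative and unital (\<open>field_algebra_affine_schur\<close>).

  A \<open>G\<close>-equivariant injection \<open>X \<rightarrow> Y \<times> I\<close>, where \<open>I\<close> is a finite set with trivial action, cuts every
  invariant matrix over \<open>X\<close> into an \<open>I \<times> I\<close> block matrix of invariant matrices over \<open>Y\<close>, and this
  is multiplicative (\<open>matrix_hom_block\<close>). It does not preserve the identity: the image of \<open>1\<close> is an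
  idempotent matrix. There are such injections in both directions between \<open>X\<^sub>n\<close> and \<open>X\<^sub>n\<^sub>+\<^sub>1\<close>. From
  \<open>X\<^sub>n\<close> to \<open>X\<^sub>n\<^sub>+\<^sub>1\<close> one skips one residue class modulo \<open>n + 1\<close> (\<open>stretch_embedding\<close>). In the other
  direction a tuple meets at most \<open>r \<le> n\<close> of the \<open>n + 1\<close> residue classes, so it misses a class; its
  entries then live in only \<open>n\<close> classes, and remembering the smallest missed class makes the map
  to \<open>X\<^sub>n \<times> {0..n}\<close> injective (\<open>squeeze_embedding\<close>).

  A multiplicative map \<open>\<omega>\<close> from \<open>A\<close> to the \<open>I \<times> I\<close> matrices over \<open>B\<close> turns a \<open>B\<close>-module \<open>N\<close> into the
  \<open>A\<close>-module of those \<open>I\<close>-tuples over \<open>N\<close> that are fixed by \<open>\<omega> 1\<close>. This functor plays the role of a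
  tensor product with a bimodule, but needs no quotient. The functors of the two injections above
  compose to the functor of an equivariant injection \<open>X \<rightarrow> X \<times> L\<close> (\<open>matrix_functor_comp\<close>, \<open>block_comp\<close>),
  and for such a self-embedding the matrix is inner, \<open>\<omega> a p q = v p a u q\<close> with
  \<open>\<Sum>\<^sub>p u p v p = 1\<close> (\<open>block_self_embedding\<close>). Then \<open>x \<mapsto> \<Sum>\<^sub>p u p x\<^sub>p\<close> is an isomorphism from
  the module of fixed tuples to the original module (\<open>matrix_functor_iso_id\<close>), so the two functors are inverse
  equivalences.

  The infinite field enters only through the universe of the module categories: tuples over \<open>N\<close>
  have to be encoded as elements of the type that contains \<open>N\<close>. A nonzero module over an infinite
  field is infinite, and the finite powers of an infinite set inject into it.
\<close>

section \<open>Finite sums and homomorphisms of modules\<close>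

lemma (in abelian_monoid) finsum_swap:
  assumes "finite I" "finite J" "\<And>i j. i \<in> I \<Longrightarrow> j \<in> J \<Longrightarrow> f i j \<in> carrier G"
  shows "(\<Oplus>i\<in>I. \<Oplus>j\<in>J. f i j) = (\<Oplus>j\<in>J. \<Oplus>i\<in>I. f i j)"
  using assms(1,3)
proof (induction I rule: finite_induct)
  case (insert i I)
  then have "(\<Oplus>i\<in>insert i I. \<Oplus>j\<in>J. f i j) = (\<Oplus>j\<in>J. f i j) \<oplus> (\<Oplus>j\<in>J. \<Oplus>i\<in>I. f i j)"
    by (subst finsum_insert) (auto intro!: finsum_closed)
  also have "\<dots> = (\<Oplus>j\<in>J. f i j \<oplus> (\<Oplus>i\<in>I. f i j))"
    using insert.prems by (intro finsum_addf[symmetric]) (auto intro!: finsum_closed)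
  also have "\<dots> = (\<Oplus>j\<in>J. \<Oplus>i\<in>insert i I. f i j)"
    using insert by (intro finsum_cong') (auto intro!: finsum_closed finsum_insert[symmetric])
  finally show ?case .
qed (simp add: finsum_zero)

lemma (in abelian_monoid) finsum_Times:
  assumes "finite I" "finite J" "\<And>i j. i \<in> I \<Longrightarrow> j \<in> J \<Longrightarrow> f i j \<in> carrier G"
  shows "(\<Oplus>p\<in>I \<times> J. f (fst p) (snd p)) = (\<Oplus>i\<in>I. \<Oplus>j\<in>J. f i j)"
  using assms(1,3)
proof (induction I rule: finite_induct)
  case (insert i I)
  have "(\<Oplus>p\<in>insert i I \<times> J. f (fst p) (snd p)) =
      (\<Oplus>p\<in>Pair i ` J \<union> I \<times> J. f (fst p) (snd p))"
    by (rule arg_cong[where f = "\<lambda>S. finsum G _ S"]) auto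
  also have "\<dots> = (\<Oplus>p\<in>Pair i ` J. f (fst p) (snd p)) \<oplus> (\<Oplus>p\<in>I \<times> J. f (fst p) (snd p))"
    using insert assms(2) by (intro finsum_Un_disjoint) auto
  also have "(\<Oplus>p\<in>Pair i ` J. f (fst p) (snd p)) = (\<Oplus>j\<in>J. f i j)"
    using insert.prems by (subst finsum_reindex) (auto simp: inj_on_def)
  also have "(\<Oplus>p\<in>I \<times> J. f (fst p) (snd p)) = (\<Oplus>i\<in>I. \<Oplus>j\<in>J. f i j)"
    using insert by auto
  also have "(\<Oplus>j\<in>J. f i j) \<oplus> (\<Oplus>i\<in>I. \<Oplus>j\<in>J. f i j) = (\<Oplus>i\<in>insert i I. \<Oplus>j\<in>J. f i j)"
    using insert by (subst finsum_insert) (auto intro!: finsum_closed)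
  finally show ?case .
qed simp

context left_module
begin

lemma smult_zero_left:
  assumes "x \<in> carrier M"
  shows "\<zero> \<odot>\<^bsub>M\<^esub> x = \<zero>\<^bsub>M\<^esub>"
proof -
  have "\<zero> \<odot>\<^bsub>M\<^esub> x \<oplus>\<^bsub>M\<^esub> \<zero> \<odot>\<^bsub>M\<^esub> x = \<zero> \<odot>\<^bsub>M\<^esub> x"
    using smult_l_distr[of \<zero> \<zero> x] assms by simp
  then show ?thesis
    using M.add.r_cancel_one[of "\<zero> \<odot>\<^bsub>M\<^esub> x" "\<zero> \<odot>\<^bsub>M\<^esub> x"] smult_closed assms by auto
qed

lemma smult_zero_right:
  assumes "a \<in> carrier R"
  shows "a \<odot>\<^bsub>M\<^esub> \<zero>\<^bsub>M\<^esub> = \<zero>\<^bsub>M\<^esub>"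
proof -
  have "a \<odot>\<^bsub>M\<^esub> \<zero>\<^bsub>M\<^esub> \<oplus>\<^bsub>M\<^esub> a \<odot>\<^bsub>M\<^esub> \<zero>\<^bsub>M\<^esub> = a \<odot>\<^bsub>M\<^esub> \<zero>\<^bsub>M\<^esub>"
    using smult_r_distr[of a "\<zero>\<^bsub>M\<^esub>" "\<zero>\<^bsub>M\<^esub>"] assms by simp
  then show ?thesis
    using M.add.r_cancel_one[of "a \<odot>\<^bsub>M\<^esub> \<zero>\<^bsub>M\<^esub>" "a \<odot>\<^bsub>M\<^esub> \<zero>\<^bsub>M\<^esub>"] smult_closed assms by auto
qed

lemma smult_finsum_right:
  assumes "finite I" "a \<in> carrier R" "\<And>i. i \<in> I \<Longrightarrow> x i \<in> carrier M"
  shows "a \<odot>\<^bsub>M\<^esub> (\<Oplus>\<^bsub>M\<^esub>i\<in>I. x i) = (\<Oplus>\<^bsub>M\<^esub>i\<in>I. a \<odot>\<^bsub>M\<^esub> x i)"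
  using assms(1,3)
proof (induction I rule: finite_induct)
  case (insert i I)
  then show ?case
    using assms(2) by (simp add: M.finsum_insert Pi_def M.finsum_closed smult_closed smult_r_distr)
qed (simp add: smult_zero_right assms)

lemma smult_finsum_left:
  assumes "finite I" "x \<in> carrier M" "\<And>i. i \<in> I \<Longrightarrow> a i \<in> carrier R"
  shows "(\<Oplus>i\<in>I. a i) \<odot>\<^bsub>M\<^esub> x = (\<Oplus>\<^bsub>M\<^esub>i\<in>I. a i \<odot>\<^bsub>M\<^esub> x)"
  using assms(1,3)
proof (induction I rule: finite_induct)
  case (insert i I)
  then show ?case
    using assms(2)
    by (simp add: R.finsum_insert M.finsum_insert Pi_def R.finsum_closed smult_closed smult_l_distr)
qed (simp add: smult_zero_left assms)

end

lemma mod_homD: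
  assumes "f \<in> mod_hom A M N"
  shows "x \<in> carrier M \<Longrightarrow> f x \<in> carrier N"
    and "x \<in> carrier M \<Longrightarrow> y \<in> carrier M \<Longrightarrow> f (x \<oplus>\<^bsub>M\<^esub> y) = f x \<oplus>\<^bsub>N\<^esub> f y"
    and "a \<in> carrier A \<Longrightarrow> x \<in> carrier M \<Longrightarrow> f (a \<odot>\<^bsub>M\<^esub> x) = a \<odot>\<^bsub>N\<^esub> f x"
  using assms unfolding mod_hom_def by blast+

lemma mod_homI:
  assumes "f \<in> carrier M \<rightarrow>\<^sub>E carrier N"
    and "\<And>x y. x \<in> carrier M \<Longrightarrow> y \<in> carrier M \<Longrightarrow> f (x \<oplus>\<^bsub>M\<^esub> y) = f x \<oplus>\<^bsub>N\<^esub> f y"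
    and "\<And>a x. a \<in> carrier A \<Longrightarrow> x \<in> carrier M \<Longrightarrow> f (a \<odot>\<^bsub>M\<^esub> x) = a \<odot>\<^bsub>N\<^esub> f x"
  shows "f \<in> mod_hom A M N"
  using assms unfolding mod_hom_def by blast

lemma mod_id_hom:
  assumes "left_module A M"
  shows "mod_id M \<in> mod_hom A M M"
proof -
  interpret M: left_module A M by fact
  show ?thesis by (rule mod_homI) (auto simp: mod_id_def M.smult_closed)
qed

lemma mod_comp_hom:
  assumes "left_module A L" "f \<in> mod_hom A L M" "g \<in> mod_hom A M N"
  shows "mod_comp L g f \<in> mod_hom A L N"
proof -
  interpret L: left_module A L by fact
  show ?thesis
    by (rule mod_homI)
      (simp_all add: mod_comp_def compose_def L.smult_closed mod_homD[OF assms(2)] mod_homD[OF assms(3)])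
qed

lemma mod_hom_zero:
  assumes "left_module A M" "left_module A N" "f \<in> mod_hom A M N"
  shows "f \<zero>\<^bsub>M\<^esub> = \<zero>\<^bsub>N\<^esub>"
proof -
  interpret M: left_module A M by fact
  interpret N: left_module A N by fact
  have "f \<zero>\<^bsub>M\<^esub> \<in> carrier N" "f (\<zero>\<^bsub>M\<^esub> \<oplus>\<^bsub>M\<^esub> \<zero>\<^bsub>M\<^esub>) = f \<zero>\<^bsub>M\<^esub> \<oplus>\<^bsub>N\<^esub> f \<zero>\<^bsub>M\<^esub>"
    using assms(3) M.zero_closed unfolding mod_hom_def by (blast, blast)
  then show ?thesis
    using N.add.r_cancel_one[of "f \<zero>\<^bsub>M\<^esub>" "f \<zero>\<^bsub>M\<^esub>"] by simp
qed

lemma mod_hom_finsum: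
  assumes "left_module A M" "left_module A N" "f \<in> mod_hom A M N"
    and "finite I" "\<And>i. i \<in> I \<Longrightarrow> x i \<in> carrier M"
  shows "f (\<Oplus>\<^bsub>M\<^esub>i\<in>I. x i) = (\<Oplus>\<^bsub>N\<^esub>i\<in>I. f (x i))"
proof -
  interpret M: left_module A M by fact
  interpret N: left_module A N by fact
  have f: "x \<in> carrier M \<Longrightarrow> f x \<in> carrier N"
      "x \<in> carrier M \<Longrightarrow> y \<in> carrier M \<Longrightarrow> f (x \<oplus>\<^bsub>M\<^esub> y) = f x \<oplus>\<^bsub>N\<^esub> f y" for x y
    using assms(3) by (auto simp: mod_hom_def)
  show ?thesis
    using assms(4,5)
  proof (induction I rule: finite_induct)
    case (insert i I)
    then show ?case
      by (simp add: M.M.finsum_insert N.M.finsum_insert Pi_def M.M.finsum_closed f)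
  qed (simp add: mod_hom_zero[OF assms(1-3)])
qed

section \<open>Matrices over an algebra acting on tuples\<close>

definition mat_act ::
  "('b, 'u) module \<Rightarrow> 'i set \<Rightarrow> ('i \<Rightarrow> 'i \<Rightarrow> 'b) \<Rightarrow> ('i \<Rightarrow> 'u) \<Rightarrow> 'i \<Rightarrow> 'u" where
  "mat_act N I m t = (\<lambda>i\<in>I. \<Oplus>\<^bsub>N\<^esub>j\<in>I. m i j \<odot>\<^bsub>N\<^esub> t j)"

text \<open>
  A multiplicative linear map from \<open>A\<close> to the \<open>I \<times> I\<close> matrices over \<open>B\<close>. The image of \<open>1\<close> may be any
  idempotent matrix, as for the inclusion of a corner \<open>e B e\<close>.
\<close>

locale matrix_hom = A: field_algebra A + B: field_algebra B
  for A :: "('k::field, 'a) module" and B :: "('k, 'b) module" +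
  fixes I :: "'i set" and \<omega> :: "'a \<Rightarrow> 'i \<Rightarrow> 'i \<Rightarrow> 'b"
  assumes finite_index: "finite I"
    and closed: "a \<in> carrier A \<Longrightarrow> i \<in> I \<Longrightarrow> j \<in> I \<Longrightarrow> \<omega> a i j \<in> carrier B"
    and add: "a \<in> carrier A \<Longrightarrow> b \<in> carrier A \<Longrightarrow> i \<in> I \<Longrightarrow> j \<in> I \<Longrightarrow>
      \<omega> (a \<oplus>\<^bsub>A\<^esub> b) i j = \<omega> a i j \<oplus>\<^bsub>B\<^esub> \<omega> b i j"
    and mult: "a \<in> carrier A \<Longrightarrow> b \<in> carrier A \<Longrightarrow> i \<in> I \<Longrightarrow> j \<in> I \<Longrightarrow>
      \<omega> (a \<otimes>\<^bsub>A\<^esub> b) i j = (\<Oplus>\<^bsub>B\<^esub>k\<in>I. \<omega> a i k \<otimes>\<^bsub>B\<^esub> \<omega> b k j)"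
    and scale: "a \<in> carrier A \<Longrightarrow> i \<in> I \<Longrightarrow> j \<in> I \<Longrightarrow> \<omega> (c \<odot>\<^bsub>A\<^esub> a) i j = c \<odot>\<^bsub>B\<^esub> \<omega> a i j"

context matrix_hom
begin

abbreviation fixed_tuples :: "('b, 'u) module \<Rightarrow> ('i \<Rightarrow> 'u) set" where
  "fixed_tuples N \<equiv> {t \<in> I \<rightarrow>\<^sub>E carrier N. mat_act N I (\<omega> \<one>\<^bsub>A\<^esub>) t = t}"

text \<open>
  Since \<open>\<omega> 1\<close> acts as an idempotent on all tuples, its fixed tuples form a module on which \<open>\<omega> 1\<close>
  acts as the identity. The multiplicative fields of the record carry no meaning in a module.
\<close>

definition tuple_module :: "('b, 'u) module \<Rightarrow> ('a, 'i \<Rightarrow> 'u) module" where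
  "tuple_module N = \<lparr>carrier = fixed_tuples N, monoid.mult = undefined, one = undefined,
     zero = (\<lambda>i\<in>I. \<zero>\<^bsub>N\<^esub>), add = (\<lambda>s t. \<lambda>i\<in>I. s i \<oplus>\<^bsub>N\<^esub> t i),
     smult = (\<lambda>a. mat_act N I (\<omega> a))\<rparr>"

lemma zero_entry:
  assumes "i \<in> I" "j \<in> I"
  shows "\<omega> \<zero>\<^bsub>A\<^esub> i j = \<zero>\<^bsub>B\<^esub>"
proof -
  have "\<omega> \<zero>\<^bsub>A\<^esub> i j \<oplus>\<^bsub>B\<^esub> \<omega> \<zero>\<^bsub>A\<^esub> i j = \<omega> \<zero>\<^bsub>A\<^esub> i j"
    using add[of "\<zero>\<^bsub>A\<^esub>" "\<zero>\<^bsub>A\<^esub>" i j] assms by simp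
  then show ?thesis
    using B.add.r_cancel_one[of "\<omega> \<zero>\<^bsub>A\<^esub> i j" "\<omega> \<zero>\<^bsub>A\<^esub> i j"] closed assms by auto
qed

lemma mat_act_closed:
  assumes "left_module B N" "a \<in> carrier A" "t \<in> I \<rightarrow>\<^sub>E carrier N"
  shows "mat_act N I (\<omega> a) t \<in> I \<rightarrow>\<^sub>E carrier N"
proof -
  interpret N: left_module B N by fact
  show ?thesis
    using assms(2,3) unfolding mat_act_def
    by (auto intro!: N.M.finsum_closed N.smult_closed closed)
qed

lemma mat_act_mult:
  assumes "left_module B N" "a \<in> carrier A" "b \<in> carrier A" "t \<in> I \<rightarrow>\<^sub>E carrier N"
  shows "mat_act N I (\<omega> (a \<otimes>\<^bsub>A\<^esub> b)) t = mat_act N I (\<omega> a) (mat_act N I (\<omega> b) t)"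
proof
  interpret N: left_module B N by fact
  fix i show "mat_act N I (\<omega> (a \<otimes>\<^bsub>A\<^esub> b)) t i = mat_act N I (\<omega> a) (mat_act N I (\<omega> b) t) i"
  proof (cases "i \<in> I")
    case i: True
    have t: "j \<in> I \<Longrightarrow> t j \<in> carrier N" for j using assms(4) by auto
    have "(\<Oplus>\<^bsub>N\<^esub>k\<in>I. \<omega> (a \<otimes>\<^bsub>A\<^esub> b) i k \<odot>\<^bsub>N\<^esub> t k) =
        (\<Oplus>\<^bsub>N\<^esub>k\<in>I. \<Oplus>\<^bsub>N\<^esub>j\<in>I. \<omega> a i j \<odot>\<^bsub>N\<^esub> (\<omega> b j k \<odot>\<^bsub>N\<^esub> t k))"
    proof (intro N.M.finsum_cong' refl)
      fix k assume k: "k \<in> I"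
      have "\<omega> (a \<otimes>\<^bsub>A\<^esub> b) i k \<odot>\<^bsub>N\<^esub> t k = (\<Oplus>\<^bsub>N\<^esub>j\<in>I. (\<omega> a i j \<otimes>\<^bsub>B\<^esub> \<omega> b j k) \<odot>\<^bsub>N\<^esub> t k)"
        using i k assms t
        by (simp add: mult, intro N.smult_finsum_left) (auto intro!: closed finite_index)
      also have "\<dots> = (\<Oplus>\<^bsub>N\<^esub>j\<in>I. \<omega> a i j \<odot>\<^bsub>N\<^esub> (\<omega> b j k \<odot>\<^bsub>N\<^esub> t k))"
        using i k assms t
        by (intro N.M.finsum_cong') (auto intro!: closed N.smult_closed N.smult_assoc)
      finally show "\<omega> (a \<otimes>\<^bsub>A\<^esub> b) i k \<odot>\<^bsub>N\<^esub> t k = \<dots>" .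
    qed (use assms i t in \<open>auto intro!: N.M.finsum_closed N.smult_closed closed\<close>)
    also have "\<dots> = (\<Oplus>\<^bsub>N\<^esub>j\<in>I. \<Oplus>\<^bsub>N\<^esub>k\<in>I. \<omega> a i j \<odot>\<^bsub>N\<^esub> (\<omega> b j k \<odot>\<^bsub>N\<^esub> t k))"
      using i assms t by (intro N.M.finsum_swap) (auto intro!: N.smult_closed closed finite_index)
    also have "\<dots> = (\<Oplus>\<^bsub>N\<^esub>j\<in>I. \<omega> a i j \<odot>\<^bsub>N\<^esub> (\<Oplus>\<^bsub>N\<^esub>k\<in>I. \<omega> b j k \<odot>\<^bsub>N\<^esub> t k))"
      using i assms t
      by (intro N.M.finsum_cong')
        (auto intro!: N.smult_closed closed finite_index N.M.finsum_closed
          N.smult_finsum_right[symmetric])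
    also have "\<dots> = (\<Oplus>\<^bsub>N\<^esub>j\<in>I. \<omega> a i j \<odot>\<^bsub>N\<^esub> mat_act N I (\<omega> b) t j)"
      using i assms t unfolding mat_act_def
      by (intro N.M.finsum_cong') (auto intro!: N.smult_closed closed finite_index N.M.finsum_closed)
    finally show ?thesis using i by (simp add: mat_act_def)
  qed (simp add: mat_act_def)
qed

lemma mat_act_add_left:
  assumes "left_module B N" "a \<in> carrier A" "b \<in> carrier A" "t \<in> I \<rightarrow>\<^sub>E carrier N"
  shows "mat_act N I (\<omega> (a \<oplus>\<^bsub>A\<^esub> b)) t =
    (\<lambda>i\<in>I. mat_act N I (\<omega> a) t i \<oplus>\<^bsub>N\<^esub> mat_act N I (\<omega> b) t i)"
proof
  interpret N: left_module B N by fact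
  have t: "j \<in> I \<Longrightarrow> t j \<in> carrier N" for j using assms(4) by auto
  fix i show "mat_act N I (\<omega> (a \<oplus>\<^bsub>A\<^esub> b)) t i =
    (\<lambda>i\<in>I. mat_act N I (\<omega> a) t i \<oplus>\<^bsub>N\<^esub> mat_act N I (\<omega> b) t i) i"
  proof (cases "i \<in> I")
    case i: True
    have "(\<Oplus>\<^bsub>N\<^esub>j\<in>I. \<omega> (a \<oplus>\<^bsub>A\<^esub> b) i j \<odot>\<^bsub>N\<^esub> t j) =
        (\<Oplus>\<^bsub>N\<^esub>j\<in>I. \<omega> a i j \<odot>\<^bsub>N\<^esub> t j \<oplus>\<^bsub>N\<^esub> \<omega> b i j \<odot>\<^bsub>N\<^esub> t j)"
      using i assms(2,3) t
      by (intro N.M.finsum_cong') (auto simp: add intro!: N.smult_l_distr N.smult_closed closed)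
    also have "\<dots> = (\<Oplus>\<^bsub>N\<^esub>j\<in>I. \<omega> a i j \<odot>\<^bsub>N\<^esub> t j) \<oplus>\<^bsub>N\<^esub> (\<Oplus>\<^bsub>N\<^esub>j\<in>I. \<omega> b i j \<odot>\<^bsub>N\<^esub> t j)"
      using i assms(2,3) t by (intro N.M.finsum_addf) (auto intro!: N.smult_closed closed)
    finally show ?thesis using i by (simp add: mat_act_def)
  qed (simp add: mat_act_def)
qed

lemma mat_act_add_right:
  assumes "left_module B N" "a \<in> carrier A" "s \<in> I \<rightarrow>\<^sub>E carrier N" "t \<in> I \<rightarrow>\<^sub>E carrier N"
  shows "mat_act N I (\<omega> a) (\<lambda>i\<in>I. s i \<oplus>\<^bsub>N\<^esub> t i) =
    (\<lambda>i\<in>I. mat_act N I (\<omega> a) s i \<oplus>\<^bsub>N\<^esub> mat_act N I (\<omega> a) t i)"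
proof
  interpret N: left_module B N by fact
  have t: "j \<in> I \<Longrightarrow> t j \<in> carrier N" "j \<in> I \<Longrightarrow> s j \<in> carrier N" for j using assms(3,4) by auto
  fix i show "mat_act N I (\<omega> a) (\<lambda>i\<in>I. s i \<oplus>\<^bsub>N\<^esub> t i) i =
    (\<lambda>i\<in>I. mat_act N I (\<omega> a) s i \<oplus>\<^bsub>N\<^esub> mat_act N I (\<omega> a) t i) i"
  proof (cases "i \<in> I")
    case i: True
    have "(\<Oplus>\<^bsub>N\<^esub>j\<in>I. \<omega> a i j \<odot>\<^bsub>N\<^esub> (\<lambda>i\<in>I. s i \<oplus>\<^bsub>N\<^esub> t i) j) =
        (\<Oplus>\<^bsub>N\<^esub>j\<in>I. \<omega> a i j \<odot>\<^bsub>N\<^esub> s j \<oplus>\<^bsub>N\<^esub> \<omega> a i j \<odot>\<^bsub>N\<^esub> t j)"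
      using i assms(2) t
      by (intro N.M.finsum_cong') (auto intro!: N.smult_r_distr N.smult_closed closed)
    also have "\<dots> = (\<Oplus>\<^bsub>N\<^esub>j\<in>I. \<omega> a i j \<odot>\<^bsub>N\<^esub> s j) \<oplus>\<^bsub>N\<^esub> (\<Oplus>\<^bsub>N\<^esub>j\<in>I. \<omega> a i j \<odot>\<^bsub>N\<^esub> t j)"
      using i assms(2) t by (intro N.M.finsum_addf) (auto intro!: N.smult_closed closed)
    finally show ?thesis using i by (simp add: mat_act_def)
  qed (simp add: mat_act_def)
qed

lemma mat_act_zero:
  assumes "left_module B N" "t \<in> I \<rightarrow>\<^sub>E carrier N"
  shows "mat_act N I (\<omega> \<zero>\<^bsub>A\<^esub>) t = (\<lambda>i\<in>I. \<zero>\<^bsub>N\<^esub>)"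
proof
  interpret N: left_module B N by fact
  have t: "j \<in> I \<Longrightarrow> t j \<in> carrier N" for j using assms(2) by auto
  fix i show "mat_act N I (\<omega> \<zero>\<^bsub>A\<^esub>) t i = (\<lambda>i\<in>I. \<zero>\<^bsub>N\<^esub>) i"
    using t by (cases "i \<in> I")
      (simp_all add: mat_act_def zero_entry N.smult_zero_left N.M.finsum_zero cong: N.M.finsum_cong)
qed

text \<open>
  By \<open>1 a = a\<close>, acting by any \<open>\<omega> a\<close> lands in the fixed tuples, whether or not the tuple was fixed.
\<close>

lemma mat_act_fixed:
  assumes "left_module B N" "a \<in> carrier A" "t \<in> I \<rightarrow>\<^sub>E carrier N"
  shows "mat_act N I (\<omega> a) t \<in> fixed_tuples N"
  using mat_act_mult[OF assms(1) A.one_closed assms(2,3)] mat_act_closed[OF assms] assms(2) by simp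

lemma left_module_tuple_module:
  assumes "left_module B N"
  shows "left_module A (tuple_module N)"
proof -
  interpret N: left_module B N by fact
  let ?T = "tuple_module N"
  have T: "carrier ?T = fixed_tuples N" "\<zero>\<^bsub>?T\<^esub> = (\<lambda>i\<in>I. \<zero>\<^bsub>N\<^esub>)"
    "s \<oplus>\<^bsub>?T\<^esub> t = (\<lambda>i\<in>I. s i \<oplus>\<^bsub>N\<^esub> t i)" "a \<odot>\<^bsub>?T\<^esub> t = mat_act N I (\<omega> a) t" for s t a
    by (simp_all add: tuple_module_def)
  have c: "t \<in> fixed_tuples N \<Longrightarrow> t \<in> I \<rightarrow>\<^sub>E carrier N" for t by blast
  have z: "(\<lambda>i\<in>I. \<zero>\<^bsub>N\<^esub>) \<in> fixed_tuples N"
    using mat_act_fixed[OF assms A.zero_closed, of "\<lambda>i\<in>I. \<zero>\<^bsub>N\<^esub>"] mat_act_zero[OF assms, of "\<lambda>i\<in>I. \<zero>\<^bsub>N\<^esub>"]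
    by auto
  have "abelian_group ?T"
  proof (rule abelian_groupI)
    fix x y assume "x \<in> carrier ?T" "y \<in> carrier ?T"
    then show "x \<oplus>\<^bsub>?T\<^esub> y \<in> carrier ?T"
      unfolding T using mat_act_add_right[OF assms A.one_closed, of x y] by auto
  next
    show "\<zero>\<^bsub>?T\<^esub> \<in> carrier ?T" unfolding T by (rule z)
  next
    fix x assume "x \<in> carrier ?T"
    then have x: "x \<in> I \<rightarrow>\<^sub>E carrier N" "mat_act N I (\<omega> \<one>\<^bsub>A\<^esub>) x = x" by (auto simp: T)
    show "\<zero>\<^bsub>?T\<^esub> \<oplus>\<^bsub>?T\<^esub> x = x"
    proof
      fix i show "(\<zero>\<^bsub>?T\<^esub> \<oplus>\<^bsub>?T\<^esub> x) i = x i"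
        using PiE_mem[OF x(1), of i] PiE_arb[OF x(1), of i] by (cases "i \<in> I") (simp_all add: T)
    qed
    \<comment> \<open>The negative of a fixed tuple is its image under the action of \<open>- 1\<close>, which is fixed.\<close>
    have "mat_act N I (\<omega> (\<ominus>\<^bsub>A\<^esub> \<one>\<^bsub>A\<^esub>)) x \<oplus>\<^bsub>?T\<^esub> x = \<zero>\<^bsub>?T\<^esub>"
      using mat_act_add_left[OF assms, of "\<ominus>\<^bsub>A\<^esub> \<one>\<^bsub>A\<^esub>" "\<one>\<^bsub>A\<^esub>" x] x mat_act_zero[OF assms x(1)]
      by (simp add: T A.l_neg)
    moreover have "mat_act N I (\<omega> (\<ominus>\<^bsub>A\<^esub> \<one>\<^bsub>A\<^esub>)) x \<in> carrier ?T"
      unfolding T using x by (intro mat_act_fixed assms) auto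
    ultimately show "\<exists>y\<in>carrier ?T. y \<oplus>\<^bsub>?T\<^esub> x = \<zero>\<^bsub>?T\<^esub>" by blast
  next
    fix x y z assume "x \<in> carrier ?T" "y \<in> carrier ?T" "z \<in> carrier ?T"
    then have "i \<in> I \<Longrightarrow> x i \<in> carrier N" "i \<in> I \<Longrightarrow> y i \<in> carrier N" "i \<in> I \<Longrightarrow> z i \<in> carrier N" for i
      by (auto simp: T)
    then show "(x \<oplus>\<^bsub>?T\<^esub> y) \<oplus>\<^bsub>?T\<^esub> z = x \<oplus>\<^bsub>?T\<^esub> (y \<oplus>\<^bsub>?T\<^esub> z)"
      by (auto simp: T N.M.add.m_assoc intro!: restrict_ext)
  next
    fix x y assume "x \<in> carrier ?T" "y \<in> carrier ?T"
    then have "i \<in> I \<Longrightarrow> x i \<in> carrier N" "i \<in> I \<Longrightarrow> y i \<in> carrier N" for i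
      by (auto simp: T)
    then show "x \<oplus>\<^bsub>?T\<^esub> y = y \<oplus>\<^bsub>?T\<^esub> x"
      by (auto simp: T N.M.add.m_comm intro!: restrict_ext)
  qed
  then show ?thesis
  proof (intro left_module.intro A.ring_axioms left_module_axioms.intro)
    fix a x assume "a \<in> carrier A" "x \<in> carrier ?T"
    then show "a \<odot>\<^bsub>?T\<^esub> x \<in> carrier ?T"
      unfolding T using mat_act_fixed[OF assms] c by blast
  next
    fix a b x assume "a \<in> carrier A" "b \<in> carrier A" "x \<in> carrier ?T"
    then show "(a \<oplus>\<^bsub>A\<^esub> b) \<odot>\<^bsub>?T\<^esub> x = a \<odot>\<^bsub>?T\<^esub> x \<oplus>\<^bsub>?T\<^esub> b \<odot>\<^bsub>?T\<^esub> x"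
      and "(a \<otimes>\<^bsub>A\<^esub> b) \<odot>\<^bsub>?T\<^esub> x = a \<odot>\<^bsub>?T\<^esub> (b \<odot>\<^bsub>?T\<^esub> x)"
      unfolding T by (rule mat_act_add_left[OF assms _ _ c] mat_act_mult[OF assms _ _ c]; assumption)+
  next
    fix a x y assume "a \<in> carrier A" "x \<in> carrier ?T" "y \<in> carrier ?T"
    then show "a \<odot>\<^bsub>?T\<^esub> (x \<oplus>\<^bsub>?T\<^esub> y) = a \<odot>\<^bsub>?T\<^esub> x \<oplus>\<^bsub>?T\<^esub> a \<odot>\<^bsub>?T\<^esub> y"
      unfolding T by (intro mat_act_add_right[OF assms _ c c])
  next
    fix x assume "x \<in> carrier ?T"
    then show "\<one>\<^bsub>A\<^esub> \<odot>\<^bsub>?T\<^esub> x = x" unfolding T by blast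
  qed
qed

end

definition transport_module :: "('p \<Rightarrow> 'u) \<Rightarrow> ('a, 'p) module \<Rightarrow> ('a, 'u) module" where
  "transport_module g M = (let h = inv_into (carrier M) g in
     \<lparr>carrier = g ` carrier M, monoid.mult = undefined, one = undefined, zero = g \<zero>\<^bsub>M\<^esub>,
      add = (\<lambda>x y. g (h x \<oplus>\<^bsub>M\<^esub> h y)), smult = (\<lambda>a x. g (a \<odot>\<^bsub>M\<^esub> h x))\<rparr>)"

lemma left_module_transport:
  assumes "left_module R M" and g: "inj_on g (carrier M)"
  shows "left_module R (transport_module g M)"
proof -
  interpret M: left_module R M by fact
  let ?T = "transport_module g M"
  have T: "carrier ?T = g ` carrier M" "\<zero>\<^bsub>?T\<^esub> = g \<zero>\<^bsub>M\<^esub>"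
    "x \<in> carrier M \<Longrightarrow> y \<in> carrier M \<Longrightarrow> g x \<oplus>\<^bsub>?T\<^esub> g y = g (x \<oplus>\<^bsub>M\<^esub> y)"
    "x \<in> carrier M \<Longrightarrow> a \<odot>\<^bsub>?T\<^esub> g x = g (a \<odot>\<^bsub>M\<^esub> x)" for x y a
    using g by (simp_all add: transport_module_def Let_def)
  have "abelian_group ?T"
  proof (rule abelian_groupI)
    fix x assume "x \<in> carrier ?T"
    then obtain y where y: "y \<in> carrier M" "x = g y" by (auto simp: T)
    show "\<exists>y\<in>carrier ?T. y \<oplus>\<^bsub>?T\<^esub> x = \<zero>\<^bsub>?T\<^esub>"
      using y by (intro bexI[of _ "g (\<ominus>\<^bsub>M\<^esub> y)"]) (auto simp: T M.M.l_neg)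
  qed (auto simp: T M.M.add.m_ac)
  moreover have "left_module_axioms R ?T"
    unfolding left_module_axioms_def
    by (auto simp: T M.smult_closed M.smult_l_distr M.smult_r_distr M.smult_assoc M.smult_one)
  ultimately show ?thesis by (simp add: left_module_def M.R.ring_axioms)
qed

section \<open>Encoding tuples inside the universe\<close>

lemma infinite_tuples_encoding:
  assumes "infinite S" "finite I"
  shows "\<exists>g. inj_on g (I \<rightarrow>\<^sub>E S) \<and> g ` (I \<rightarrow>\<^sub>E S) \<subseteq> S"
  using assms(2)
proof (induction I rule: finite_induct)
  case empty
  obtain s where "s \<in> S" using assms(1) by (metis finite.emptyI ex_in_conv)
  then show ?case by (intro exI[of _ "\<lambda>_. s"]) auto
next
  case (insert i I)
  then obtain g where g: "inj_on g (I \<rightarrow>\<^sub>E S)" "g ` (I \<rightarrow>\<^sub>E S) \<subseteq> S" by blast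
  obtain p where p: "bij_betw p (S \<times> S) S"
    using card_of_Times_same_infinite[OF assms(1)] card_of_ordIso by blast
  let ?h = "\<lambda>t. p (t i, g (restrict t I))"
  have r: "restrict t I \<in> I \<rightarrow>\<^sub>E S" "t i \<in> S" if "t \<in> insert i I \<rightarrow>\<^sub>E S" for t
    using that by auto
  have "inj_on ?h (insert i I \<rightarrow>\<^sub>E S)"
  proof (rule inj_onI)
    fix s t assume st: "s \<in> insert i I \<rightarrow>\<^sub>E S" "t \<in> insert i I \<rightarrow>\<^sub>E S" "?h s = ?h t"
    have "(s i, g (restrict s I)) \<in> S \<times> S" "(t i, g (restrict t I)) \<in> S \<times> S"
      using r[OF st(1)] r[OF st(2)] g(2) by blast+
    with st(3) have eq: "s i = t i" "g (restrict s I) = g (restrict t I)"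
      using p by (auto simp: bij_betw_def dest!: inj_onD)
    have "restrict s I = restrict t I"
      using inj_onD[OF g(1) eq(2) r(1)[OF st(1)] r(1)[OF st(2)]] .
    then have "j \<in> insert i I \<Longrightarrow> s j = t j" for j
      using eq(1) by (metis insertE restrict_apply')
    then show "s = t" using st(1,2) by (intro PiE_ext) auto
  qed
  moreover have "?h t \<in> S" if "t \<in> insert i I \<rightarrow>\<^sub>E S" for t
  proof -
    have "(t i, g (restrict t I)) \<in> S \<times> S" using r[OF that] g(2) by blast
    then show ?thesis using p unfolding bij_betw_def by blast
  qed
  ultimately show ?case by (intro exI[of _ ?h]) blast
qed

text \<open>
  The multiples of a nonzero vector by different scalars are different.
\<close>

lemma infinite_module:
  assumes "field_algebra (B :: ('k::field, 'b) module)" "infinite (UNIV :: 'k set)"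
    and "left_module B N" "x \<in> carrier N" "x \<noteq> \<zero>\<^bsub>N\<^esub>"
  shows "infinite (carrier N)"
proof -
  interpret B: field_algebra B by fact
  interpret N: left_module B N by fact
  let ?s = "\<lambda>c. (c \<odot>\<^bsub>B\<^esub> \<one>\<^bsub>B\<^esub>) \<odot>\<^bsub>N\<^esub> x"
  have c1: "c \<odot>\<^bsub>B\<^esub> \<one>\<^bsub>B\<^esub> \<in> carrier B" for c by (simp add: B.scale_closed)
  have "inj ?s"
  proof (rule injI, rule ccontr)
    fix c d assume eq: "?s c = ?s d" and "c \<noteq> d"
    have "?s c = ?s (c - d) \<oplus>\<^bsub>N\<^esub> ?s d"
      using B.scale_add_left[of "\<one>\<^bsub>B\<^esub>" "c - d" d] c1 assms(4) by (simp add: N.smult_l_distr)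
    then have z: "?s (c - d) = \<zero>\<^bsub>N\<^esub>"
      using eq N.smult_closed[OF c1 assms(4)] N.M.add.l_cancel_one'[of "?s d" "?s (c - d)"]
      by (metis N.M.add.r_cancel_one)
    have "x = ?s (inverse (c - d) * (c - d))"
      using \<open>c \<noteq> d\<close> assms(4) by (simp add: B.scale_one N.smult_one)
    also have "\<dots> = (inverse (c - d) \<odot>\<^bsub>B\<^esub> \<one>\<^bsub>B\<^esub>) \<odot>\<^bsub>N\<^esub> ?s (c - d)"
      using N.smult_assoc[OF c1 c1 assms(4)] c1 B.scale_mult_left[of "\<one>\<^bsub>B\<^esub>"]
      by (metis B.l_one B.one_closed B.scale_assoc)
    also have "\<dots> = \<zero>\<^bsub>N\<^esub>" unfolding z by (rule N.smult_zero_right[OF c1])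
    finally show False using assms(5) by simp
  qed
  moreover have "range ?s \<subseteq> carrier N" using N.smult_closed[OF c1 assms(4)] by blast
  ultimately show ?thesis
    using assms(2) by (metis finite_imageD finite_subset)
qed

text \<open>
  If the module is not infinite then it is zero, and there is only one tuple to encode.
\<close>

lemma module_tuples_encoding:
  assumes "field_algebra (B :: ('k::field, 'b) module)" "infinite (UNIV :: 'k set)"
    and "left_module B (N :: ('b, 'u) module)" "finite I"
  shows "\<exists>g :: ('i \<Rightarrow> 'u) \<Rightarrow> 'u. inj_on g (I \<rightarrow>\<^sub>E carrier N)"
proof (cases "infinite (carrier N)")
  case True
  then show ?thesis using infinite_tuples_encoding[OF _ assms(4)] by blast
next
  case False
  then have zero: "x = \<zero>\<^bsub>N\<^esub>" if "x \<in> carrier N" for x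
    using infinite_module[OF assms(1-3) that] by blast
  have "s = t" if "s \<in> I \<rightarrow>\<^sub>E carrier N" "t \<in> I \<rightarrow>\<^sub>E carrier N" for s t
  proof -
    have "i \<in> I \<Longrightarrow> s i = t i" for i
      using zero[OF PiE_mem[OF that(1)]] zero[OF PiE_mem[OF that(2)]] by metis
    with that show ?thesis by (intro PiE_ext) auto
  qed
  then show ?thesis by (auto simp: inj_on_def)
qed

section \<open>Functors given by matrices\<close>

text \<open>
  A pair \<open>Fo\<close>, \<open>Fm\<close> that is, up to the coordinates \<open>crd\<close>, the functor of fixed tuples for \<open>\<omega>\<close>. Describing
  it by coordinates rather than by a construction hides the encoding of tuples, and allows a
  composite of two such functors to be recognised as a functor of the same kind.
\<close>

locale matrix_functor =
  fixes A :: "('k::field, 'a) module" and B :: "('k, 'b) module"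
    and I :: "'i set" and \<omega> :: "'a \<Rightarrow> 'i \<Rightarrow> 'i \<Rightarrow> 'b"
    and Fo :: "('b, 'a, 'u) obj_map" and Fm :: "('b, 'u) mor_map"
    and crd :: "('b, 'u) module \<Rightarrow> 'u \<Rightarrow> 'i \<Rightarrow> 'u"
  assumes obj: "left_module B N \<Longrightarrow> left_module A (Fo N)"
    and bij: "left_module B N \<Longrightarrow> bij_betw (crd N) (carrier (Fo N))
      {t \<in> I \<rightarrow>\<^sub>E carrier N. mat_act N I (\<omega> \<one>\<^bsub>A\<^esub>) t = t}"
    and crd_add: "left_module B N \<Longrightarrow> x \<in> carrier (Fo N) \<Longrightarrow> y \<in> carrier (Fo N) \<Longrightarrow>
      i \<in> I \<Longrightarrow> crd N (x \<oplus>\<^bsub>Fo N\<^esub> y) i = crd N x i \<oplus>\<^bsub>N\<^esub> crd N y i"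
    and crd_smult: "left_module B N \<Longrightarrow> a \<in> carrier A \<Longrightarrow> x \<in> carrier (Fo N) \<Longrightarrow>
      crd N (a \<odot>\<^bsub>Fo N\<^esub> x) = mat_act N I (\<omega> a) (crd N x)"
    and mor: "left_module B M \<Longrightarrow> left_module B N \<Longrightarrow> f \<in> mod_hom B M N \<Longrightarrow>
      Fm M N f \<in> carrier (Fo M) \<rightarrow>\<^sub>E carrier (Fo N)"
    and crd_mor: "left_module B M \<Longrightarrow> left_module B N \<Longrightarrow> f \<in> mod_hom B M N \<Longrightarrow>
      x \<in> carrier (Fo M) \<Longrightarrow> i \<in> I \<Longrightarrow> crd N (Fm M N f x) i = f (crd M x i)"
begin

lemma crd_PiE: "left_module B N \<Longrightarrow> x \<in> carrier (Fo N) \<Longrightarrow> crd N x \<in> I \<rightarrow>\<^sub>E carrier N"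
  using bij[of N] by (auto simp: bij_betw_def)

lemma crd_closed: "left_module B N \<Longrightarrow> x \<in> carrier (Fo N) \<Longrightarrow> i \<in> I \<Longrightarrow> crd N x i \<in> carrier N"
  using crd_PiE by fast

lemma crd_eqI:
  assumes "left_module B N" "x \<in> carrier (Fo N)" "y \<in> carrier (Fo N)"
    and "\<And>i. i \<in> I \<Longrightarrow> crd N x i = crd N y i"
  shows "x = y"
proof -
  have "crd N x = crd N y"
    using crd_PiE[OF assms(1,2)] crd_PiE[OF assms(1,3)] assms(4) by (rule PiE_ext)
  then show ?thesis using bij[OF assms(1)] assms(2,3) by (auto simp: bij_betw_def dest: inj_onD)
qed

lemma crd_fixed:
  assumes "left_module B N" "x \<in> carrier (Fo N)"
  shows "mat_act N I (\<omega> \<one>\<^bsub>A\<^esub>) (crd N x) = crd N x"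
  using bij[OF assms(1)] assms(2) by (auto simp: bij_betw_def)

lemma crd_surj:
  assumes "left_module B N" "t \<in> I \<rightarrow>\<^sub>E carrier N" "mat_act N I (\<omega> \<one>\<^bsub>A\<^esub>) t = t"
  obtains x where "x \<in> carrier (Fo N)" "crd N x = t"
proof -
  have "t \<in> crd N ` carrier (Fo N)"
    using bij[OF assms(1)] assms(2,3) unfolding bij_betw_def by blast
  with that show ?thesis by blast
qed

lemma mor_closed:
  "left_module B M \<Longrightarrow> left_module B N \<Longrightarrow> f \<in> mod_hom B M N \<Longrightarrow> x \<in> carrier (Fo M) \<Longrightarrow>
    Fm M N f x \<in> carrier (Fo N)"
  using mor by fast

lemma crd_zero:
  assumes "left_module B N" "i \<in> I"
  shows "crd N \<zero>\<^bsub>Fo N\<^esub> i = \<zero>\<^bsub>N\<^esub>"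
proof -
  interpret N: left_module B N by fact
  interpret FN: left_module A "Fo N" by (rule obj) fact
  have "crd N \<zero>\<^bsub>Fo N\<^esub> i = crd N \<zero>\<^bsub>Fo N\<^esub> i \<oplus>\<^bsub>N\<^esub> crd N \<zero>\<^bsub>Fo N\<^esub> i"
    using crd_add[OF assms(1) _ _ assms(2), of "\<zero>\<^bsub>Fo N\<^esub>" "\<zero>\<^bsub>Fo N\<^esub>"] by simp
  then show ?thesis
    using N.M.add.r_cancel_one[of "crd N \<zero>\<^bsub>Fo N\<^esub> i" "crd N \<zero>\<^bsub>Fo N\<^esub> i"] crd_closed[OF assms(1) _ assms(2)]
    by auto
qed

lemma crd_finsum:
  assumes "left_module B N" "i \<in> I" "finite J" "\<And>j. j \<in> J \<Longrightarrow> x j \<in> carrier (Fo N)"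
  shows "crd N (\<Oplus>\<^bsub>Fo N\<^esub>j\<in>J. x j) i = (\<Oplus>\<^bsub>N\<^esub>j\<in>J. crd N (x j) i)"
proof -
  interpret N: left_module B N by fact
  interpret FN: left_module A "Fo N" by (rule obj) fact
  show ?thesis
    using assms(3,4)
  proof (induction J rule: finite_induct)
    case (insert j J)
    then show ?case
      using assms(1,2)
      by (simp add: N.M.finsum_insert FN.M.finsum_insert Pi_def FN.M.finsum_closed crd_add crd_closed)
  qed (simp add: crd_zero assms)
qed

lemma mor_hom:
  assumes "left_module B M" "left_module B N" "f \<in> mod_hom B M N"
    and "matrix_hom A B I \<omega>"
  shows "Fm M N f \<in> mod_hom A (Fo M) (Fo N)"
proof -
  interpret M: left_module B M by fact
  interpret N: left_module B N by fact
  interpret FM: left_module A "Fo M" by (rule obj) fact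
  interpret FN: left_module A "Fo N" by (rule obj) fact
  interpret \<omega>: matrix_hom A B I \<omega> by fact
  note f = mod_homD[OF assms(3)]
  note cl = mor_closed[OF assms(1-3)] and cr = crd_mor[OF assms(1-3)]
  have "Fm M N f (x \<oplus>\<^bsub>Fo M\<^esub> y) = Fm M N f x \<oplus>\<^bsub>Fo N\<^esub> Fm M N f y"
    if "x \<in> carrier (Fo M)" "y \<in> carrier (Fo M)" for x y
  proof (rule crd_eqI[OF assms(2)])
    fix i assume i: "i \<in> I"
    have "crd N (Fm M N f (x \<oplus>\<^bsub>Fo M\<^esub> y)) i = f (crd M x i \<oplus>\<^bsub>M\<^esub> crd M y i)"
      unfolding cr[OF FM.M.a_closed[OF that] i] crd_add[OF assms(1) that i] ..
    also have "\<dots> = f (crd M x i) \<oplus>\<^bsub>N\<^esub> f (crd M y i)"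
      by (intro f(2) crd_closed[OF assms(1)] that i)
    also have "\<dots> = crd N (Fm M N f x \<oplus>\<^bsub>Fo N\<^esub> Fm M N f y) i"
      unfolding cr[OF that(1) i, symmetric] cr[OF that(2) i, symmetric]
      by (intro crd_add[symmetric] assms cl that i)
    finally show "crd N (Fm M N f (x \<oplus>\<^bsub>Fo M\<^esub> y)) i = crd N (Fm M N f x \<oplus>\<^bsub>Fo N\<^esub> Fm M N f y) i" .
  qed (intro cl FM.M.a_closed FN.M.a_closed that)+
  moreover have "Fm M N f (a \<odot>\<^bsub>Fo M\<^esub> x) = a \<odot>\<^bsub>Fo N\<^esub> Fm M N f x"
    if a: "a \<in> carrier A" and x: "x \<in> carrier (Fo M)" for a x
  proof (rule crd_eqI[OF assms(2)])
    fix i assume i: "i \<in> I"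
    have "crd N (Fm M N f (a \<odot>\<^bsub>Fo M\<^esub> x)) i = f (\<Oplus>\<^bsub>M\<^esub>j\<in>I. \<omega> a i j \<odot>\<^bsub>M\<^esub> crd M x j)"
      using i a x assms(1) by (simp add: cr crd_smult FM.smult_closed mat_act_def)
    also have "\<dots> = (\<Oplus>\<^bsub>N\<^esub>j\<in>I. f (\<omega> a i j \<odot>\<^bsub>M\<^esub> crd M x j))"
      using i a x crd_closed[OF assms(1)]
      by (intro mod_hom_finsum[OF assms(1-3)]) (auto intro!: \<omega>.finite_index M.smult_closed \<omega>.closed)
    also have "\<dots> = (\<Oplus>\<^bsub>N\<^esub>j\<in>I. \<omega> a i j \<odot>\<^bsub>N\<^esub> crd N (Fm M N f x) j)"
      using i a x crd_closed[OF assms(1)]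
      by (intro N.M.finsum_cong') (auto simp: cr f \<omega>.closed intro!: N.smult_closed)
    also have "\<dots> = crd N (a \<odot>\<^bsub>Fo N\<^esub> Fm M N f x) i"
      using i a x assms(2) by (simp add: cl crd_smult mat_act_def)
    finally show "crd N (Fm M N f (a \<odot>\<^bsub>Fo M\<^esub> x)) i = \<dots>" .
  qed (use a x in \<open>auto intro!: cl FM.smult_closed FN.smult_closed\<close>)
  ultimately show ?thesis using mor[OF assms(1-3)] by (intro mod_homI)
qed

text \<open>
  Each functor law is an equality of elements of \<open>Fo N\<close> and can be checked on coordinates, where
  morphisms act entrywise. For scalars one uses that \<open>\<omega> (c 1) = c (\<omega> 1)\<close> and that coordinates
  are fixed by \<open>\<omega> 1\<close>.
\<close>

theorem linear_functor:
  assumes "matrix_hom A B I \<omega>"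
  shows "linear_functor B A Fo Fm"
proof
  interpret \<omega>: matrix_hom A B I \<omega> by fact
  fix M :: "('b, 'u) module" assume "M \<in> Mod B"
  then have M: "left_module B M" by (simp add: Mod_def)
  then show "Fo M \<in> Mod A" by (simp add: Mod_def obj)
  note id = mod_id_hom[OF M]
  have "mod_id (Fo M) \<in> carrier (Fo M) \<rightarrow>\<^sub>E carrier (Fo M)" by (auto simp: mod_id_def)
  then show "Fm M M (mod_id M) = mod_id (Fo M)"
  proof (rule PiE_ext[OF mor[OF M M id]])
    fix x assume x: "x \<in> carrier (Fo M)"
    have "Fm M M (mod_id M) x = x"
    proof (rule crd_eqI[OF M mor_closed[OF M M id x] x])
      fix i assume i: "i \<in> I"
      show "crd M (Fm M M (mod_id M) x) i = crd M x i"
        unfolding crd_mor[OF M M id x i] using crd_closed[OF M x i] by (simp add: mod_id_def)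
    qed
    then show "Fm M M (mod_id M) x = mod_id (Fo M) x" using x by (simp add: mod_id_def)
  qed
next
  fix M N :: "('b, 'u) module" and f assume "M \<in> Mod B" "N \<in> Mod B" "f \<in> mod_hom B M N"
  then show "Fm M N f \<in> mod_hom A (Fo M) (Fo N)" by (auto simp: Mod_def intro!: mor_hom assms)
next
  fix L M N :: "('b, 'u) module" and f g
  assume "L \<in> Mod B" "M \<in> Mod B" "N \<in> Mod B" and f: "f \<in> mod_hom B L M" and g: "g \<in> mod_hom B M N"
  then have L: "left_module B L" and M: "left_module B M" and N: "left_module B N"
    by (auto simp: Mod_def)
  note gf = mod_comp_hom[OF L f g]
  show "Fm L N (mod_comp L g f) = mod_comp (Fo L) (Fm M N g) (Fm L M f)"
  proof (rule PiE_ext[OF mor[OF L N gf]])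
    show "mod_comp (Fo L) (Fm M N g) (Fm L M f) \<in> carrier (Fo L) \<rightarrow>\<^sub>E carrier (Fo N)"
      unfolding mod_comp_def compose_def
      by (intro restrict_PiE_iff[THEN iffD2] ballI mor_closed[OF M N g] mor_closed[OF L M f])
    fix x assume x: "x \<in> carrier (Fo L)"
    note fx = mor_closed[OF L M f x]
    have "Fm L N (mod_comp L g f) x = Fm M N g (Fm L M f x)"
    proof (rule crd_eqI[OF N mor_closed[OF L N gf x] mor_closed[OF M N g fx]])
      fix i assume i: "i \<in> I"
      show "crd N (Fm L N (mod_comp L g f) x) i = crd N (Fm M N g (Fm L M f x)) i"
        unfolding crd_mor[OF L N gf x i] crd_mor[OF M N g fx i] crd_mor[OF L M f x i]
        using crd_closed[OF L x i] by (simp add: mod_comp_def compose_def)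
    qed
    then show "Fm L N (mod_comp L g f) x = mod_comp (Fo L) (Fm M N g) (Fm L M f) x"
      using x by (simp add: mod_comp_def compose_def)
  qed
next
  fix M N :: "('b, 'u) module" and f g
  assume "M \<in> Mod B" "N \<in> Mod B" and f: "f \<in> mod_hom B M N" and g: "g \<in> mod_hom B M N"
  then have M: "left_module B M" and N: "left_module B N" by (auto simp: Mod_def)
  interpret M: left_module B M by (rule M)
  interpret N: left_module B N by (rule N)
  interpret FN: left_module A "Fo N" by (rule obj[OF N])
  have h: "hom_add M N f g \<in> mod_hom B M N"
    by (rule mod_homI) (simp_all add: hom_add_def M.smult_closed N.smult_r_distr N.M.add.m_ac
      mod_homD[OF f] mod_homD[OF g])
  show "Fm M N (hom_add M N f g) = hom_add (Fo M) (Fo N) (Fm M N f) (Fm M N g)"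
  proof (rule PiE_ext[OF mor[OF M N h]])
    show "hom_add (Fo M) (Fo N) (Fm M N f) (Fm M N g) \<in> carrier (Fo M) \<rightarrow>\<^sub>E carrier (Fo N)"
      unfolding hom_add_def
      by (intro restrict_PiE_iff[THEN iffD2] ballI FN.M.a_closed mor_closed[OF M N f] mor_closed[OF M N g])
    fix x assume x: "x \<in> carrier (Fo M)"
    note fx = mor_closed[OF M N f x] and gx = mor_closed[OF M N g x]
    have "Fm M N (hom_add M N f g) x = Fm M N f x \<oplus>\<^bsub>Fo N\<^esub> Fm M N g x"
    proof (rule crd_eqI[OF N mor_closed[OF M N h x] FN.M.a_closed[OF fx gx]])
      fix i assume i: "i \<in> I"
      show "crd N (Fm M N (hom_add M N f g) x) i = crd N (Fm M N f x \<oplus>\<^bsub>Fo N\<^esub> Fm M N g x) i"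
        unfolding crd_add[OF N fx gx i] crd_mor[OF M N h x i] crd_mor[OF M N f x i] crd_mor[OF M N g x i]
        using crd_closed[OF M x i] by (simp add: hom_add_def)
    qed
    then show "Fm M N (hom_add M N f g) x = hom_add (Fo M) (Fo N) (Fm M N f) (Fm M N g) x"
      using x by (simp add: hom_add_def)
  qed
next
  fix M N :: "('b, 'u) module" and f and c :: 'k
  assume "M \<in> Mod B" "N \<in> Mod B" and f: "f \<in> mod_hom B M N"
  then have M: "left_module B M" and N: "left_module B N" by (auto simp: Mod_def)
  interpret \<omega>: matrix_hom A B I \<omega> by fact
  interpret M: left_module B M by (rule M)
  interpret N: left_module B N by (rule N)
  interpret FN: left_module A "Fo N" by (rule obj[OF N])
  have cA: "c \<odot>\<^bsub>A\<^esub> \<one>\<^bsub>A\<^esub> \<in> carrier A" and cB: "c \<odot>\<^bsub>B\<^esub> \<one>\<^bsub>B\<^esub> \<in> carrier B"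
    by (simp_all add: \<omega>.A.scale_closed \<omega>.B.scale_closed)
  have central: "(c \<odot>\<^bsub>B\<^esub> \<one>\<^bsub>B\<^esub>) \<odot>\<^bsub>N\<^esub> (b \<odot>\<^bsub>N\<^esub> y) = (c \<odot>\<^bsub>B\<^esub> b) \<odot>\<^bsub>N\<^esub> y"
    "b \<odot>\<^bsub>N\<^esub> ((c \<odot>\<^bsub>B\<^esub> \<one>\<^bsub>B\<^esub>) \<odot>\<^bsub>N\<^esub> y) = (c \<odot>\<^bsub>B\<^esub> b) \<odot>\<^bsub>N\<^esub> y"
    if "b \<in> carrier B" "y \<in> carrier N" for b y
    using that cB N.smult_assoc[of "c \<odot>\<^bsub>B\<^esub> \<one>\<^bsub>B\<^esub>" b y] N.smult_assoc[of b "c \<odot>\<^bsub>B\<^esub> \<one>\<^bsub>B\<^esub>" y]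
    by (simp_all add: \<omega>.B.scale_mult_left \<omega>.B.scale_mult_right)
  have h: "hom_scale B M N c f \<in> mod_hom B M N"
    by (rule mod_homI) (use cB in \<open>simp_all add: hom_scale_def M.smult_closed N.smult_r_distr
      N.smult_closed central mod_homD[OF f]\<close>)
  show "Fm M N (hom_scale B M N c f) = hom_scale A (Fo M) (Fo N) c (Fm M N f)"
  proof (rule PiE_ext[OF mor[OF M N h]])
    show "hom_scale A (Fo M) (Fo N) c (Fm M N f) \<in> carrier (Fo M) \<rightarrow>\<^sub>E carrier (Fo N)"
      unfolding hom_scale_def
      by (intro restrict_PiE_iff[THEN iffD2] ballI FN.smult_closed cA mor_closed[OF M N f])
    fix x assume x: "x \<in> carrier (Fo M)"
    show "Fm M N (hom_scale B M N c f) x = hom_scale A (Fo M) (Fo N) c (Fm M N f) x"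
    proof (rule crd_eqI[OF N])
      fix i assume i: "i \<in> I"
      let ?y = "crd N (Fm M N f x)"
      have y: "j \<in> I \<Longrightarrow> ?y j \<in> carrier N" for j using crd_closed[OF N mor_closed[OF M N f x]] .
      have "crd N ((c \<odot>\<^bsub>A\<^esub> \<one>\<^bsub>A\<^esub>) \<odot>\<^bsub>Fo N\<^esub> Fm M N f x) i = (\<Oplus>\<^bsub>N\<^esub>j\<in>I. \<omega> (c \<odot>\<^bsub>A\<^esub> \<one>\<^bsub>A\<^esub>) i j \<odot>\<^bsub>N\<^esub> ?y j)"
        using i cA crd_smult[OF N cA mor_closed[OF M N f x]] by (simp add: mat_act_def)
      also have "\<dots> = (\<Oplus>\<^bsub>N\<^esub>j\<in>I. (c \<odot>\<^bsub>B\<^esub> \<one>\<^bsub>B\<^esub>) \<odot>\<^bsub>N\<^esub> (\<omega> \<one>\<^bsub>A\<^esub> i j \<odot>\<^bsub>N\<^esub> ?y j))"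
        using i y by (intro N.M.finsum_cong')
          (auto simp: \<omega>.scale central \<omega>.closed intro!: N.smult_closed \<omega>.B.scale_closed \<omega>.closed)
      also have "\<dots> = (c \<odot>\<^bsub>B\<^esub> \<one>\<^bsub>B\<^esub>) \<odot>\<^bsub>N\<^esub> (\<Oplus>\<^bsub>N\<^esub>j\<in>I. \<omega> \<one>\<^bsub>A\<^esub> i j \<odot>\<^bsub>N\<^esub> ?y j)"
        using i y cB
        by (intro N.smult_finsum_right[symmetric]) (auto intro!: \<omega>.finite_index N.smult_closed \<omega>.closed)
      also have "(\<Oplus>\<^bsub>N\<^esub>j\<in>I. \<omega> \<one>\<^bsub>A\<^esub> i j \<odot>\<^bsub>N\<^esub> ?y j) = ?y i"
        using i crd_fixed[OF N mor_closed[OF M N f x]] by (auto simp: mat_act_def dest: fun_cong[of _ _ i])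
      finally show "crd N (Fm M N (hom_scale B M N c f) x) i = crd N (hom_scale A (Fo M) (Fo N) c (Fm M N f) x) i"
        unfolding crd_mor[OF M N h x i] crd_mor[OF M N f x i]
        using x crd_closed[OF M x i] by (simp add: hom_scale_def)
    qed (use x cA mor_closed[OF M N f x] mor_closed[OF M N h x] in
        \<open>simp_all add: hom_scale_def FN.smult_closed\<close>)
  qed
qed

end

context matrix_hom
begin

lemma mat_act_hom:
  assumes "left_module B M" "left_module B N" "f \<in> mod_hom B M N"
    and "a \<in> carrier A" "t \<in> I \<rightarrow>\<^sub>E carrier M"
  shows "mat_act N I (\<omega> a) (\<lambda>i\<in>I. f (t i)) = (\<lambda>i\<in>I. f (mat_act M I (\<omega> a) t i))"
proof
  interpret M: left_module B M by fact
  interpret N: left_module B N by fact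
  note f = mod_homD[OF assms(3)] and t = PiE_mem[OF assms(5)]
  fix i show "mat_act N I (\<omega> a) (\<lambda>i\<in>I. f (t i)) i = (\<lambda>i\<in>I. f (mat_act M I (\<omega> a) t i)) i"
  proof (cases "i \<in> I")
    case i: True
    have "f (\<Oplus>\<^bsub>M\<^esub>j\<in>I. \<omega> a i j \<odot>\<^bsub>M\<^esub> t j) = (\<Oplus>\<^bsub>N\<^esub>j\<in>I. f (\<omega> a i j \<odot>\<^bsub>M\<^esub> t j))"
      by (intro mod_hom_finsum[OF assms(1-3)] finite_index M.smult_closed closed assms(4) i t)
    also have "\<dots> = (\<Oplus>\<^bsub>N\<^esub>j\<in>I. \<omega> a i j \<odot>\<^bsub>N\<^esub> (\<lambda>i\<in>I. f (t i)) j)"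
      using i by (intro N.M.finsum_cong' refl)
        (simp_all add: f(3)[OF closed[OF assms(4)] t] Pi_def N.smult_closed closed assms(4) f(1) t)
    finally show ?thesis using i by (simp add: mat_act_def)
  qed (simp add: mat_act_def)
qed

text \<open>
  The module of fixed tuples is transported along an encoding of the tuples in the universe \<open>'u\<close>.
\<close>

theorem matrix_functor_exists:
  assumes "infinite (UNIV :: 'k set)"
  shows "\<exists>(Fo :: ('b, 'a, 'u) obj_map) Fm crd. matrix_functor A B I \<omega> Fo Fm crd"
proof -
  define enc :: "('b, 'u) module \<Rightarrow> ('i \<Rightarrow> 'u) \<Rightarrow> 'u" where
    "enc N = (SOME g. inj_on g (I \<rightarrow>\<^sub>E carrier N))" for N
  define T :: "('b, 'u) module \<Rightarrow> ('a, 'i \<Rightarrow> 'u) module" where "T = tuple_module"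
  define Fo :: "('b, 'a, 'u) obj_map" where "Fo N = transport_module (enc N) (T N)" for N
  define crd where "crd N = inv_into (carrier (T N)) (enc N)" for N
  define Fm :: "('b, 'u) mor_map" where
    "Fm M N f = (\<lambda>x\<in>carrier (Fo M). enc N (\<lambda>i\<in>I. f (crd M x i)))" for M N f
  have T: "carrier (T N) = fixed_tuples N"
    "s \<oplus>\<^bsub>T N\<^esub> t = (\<lambda>i\<in>I. s i \<oplus>\<^bsub>N\<^esub> t i)" "a \<odot>\<^bsub>T N\<^esub> t = mat_act N I (\<omega> a) t" for s t a N
    by (simp_all add: tuple_module_def T_def)
  have inj: "inj_on (enc N) (carrier (T N))" if N: "left_module B N" for N
  proof (rule inj_on_subset)
    show "inj_on (enc N) (I \<rightarrow>\<^sub>E carrier N)"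
      unfolding enc_def
      by (rule someI_ex[of "\<lambda>g. inj_on g (I \<rightarrow>\<^sub>E carrier N)"]) (rule module_tuples_encoding[OF B.field_algebra_axioms assms N finite_index])
    show "carrier (T N) \<subseteq> I \<rightarrow>\<^sub>E carrier N" unfolding T by blast
  qed
  have lT: "left_module A (T N)" if "left_module B N" for N
    unfolding T_def by (rule left_module_tuple_module) fact
  have cFo: "carrier (Fo N) = enc N ` carrier (T N)" for N
    by (simp add: Fo_def transport_module_def Let_def)
  have dec: "crd N (enc N t) = t" if "left_module B N" "t \<in> carrier (T N)" for N t
    using inj that by (simp add: crd_def)
  have crd_T: "crd N x \<in> carrier (T N)" if "x \<in> carrier (Fo N)" for N x
    using that unfolding cFo crd_def by (rule inv_into_into)
  have fT: "(\<lambda>i\<in>I. f (crd M x i)) \<in> carrier (T N)"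
    if M: "left_module B M" and N: "left_module B N" and f: "f \<in> mod_hom B M N" and x: "x \<in> carrier (Fo M)"
    for M N f x
  proof -
    have c: "crd M x \<in> I \<rightarrow>\<^sub>E carrier M" "mat_act M I (\<omega> \<one>\<^bsub>A\<^esub>) (crd M x) = crd M x"
      using crd_T[OF x] unfolding T by blast+
    have "(\<lambda>i\<in>I. f (crd M x i)) \<in> I \<rightarrow>\<^sub>E carrier N"
      by (intro restrict_PiE_iff[THEN iffD2] ballI mod_homD(1)[OF f] PiE_mem[OF c(1)])
    moreover have "mat_act N I (\<omega> \<one>\<^bsub>A\<^esub>) (\<lambda>i\<in>I. f (crd M x i)) = (\<lambda>i\<in>I. f (crd M x i))"
      unfolding mat_act_hom[OF M N f A.one_closed c(1)] c(2) ..
    ultimately show ?thesis unfolding T by blast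
  qed
  have "matrix_functor A B I \<omega> Fo Fm crd"
  proof (rule matrix_functor.intro)
    fix N :: "('b, 'u) module" assume N: "left_module B N"
    show "left_module A (Fo N)"
      unfolding Fo_def by (rule left_module_transport[OF lT[OF N] inj[OF N]])
    show "bij_betw (crd N) (carrier (Fo N)) (fixed_tuples N)"
      using bij_betw_inv_into[OF inj_on_imp_bij_betw[OF inj[OF N]]]
      by (simp only: cFo crd_def T(1))
    interpret TN: left_module A "T N" by (rule lT[OF N])
    fix x assume x: "x \<in> carrier (Fo N)"
    show "crd N (a \<odot>\<^bsub>Fo N\<^esub> x) = mat_act N I (\<omega> a) (crd N x)" if a: "a \<in> carrier A" for a
    proof -
      have "a \<odot>\<^bsub>Fo N\<^esub> x = enc N (a \<odot>\<^bsub>T N\<^esub> crd N x)"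
        by (simp add: Fo_def crd_def transport_module_def Let_def)
      then show ?thesis using dec[OF N TN.smult_closed[OF a crd_T[OF x]]] by (simp only: T)
    qed
    fix y i assume y: "y \<in> carrier (Fo N)" and i: "i \<in> I"
    have "x \<oplus>\<^bsub>Fo N\<^esub> y = enc N (crd N x \<oplus>\<^bsub>T N\<^esub> crd N y)"
      by (simp add: Fo_def crd_def transport_module_def Let_def)
    then have "crd N (x \<oplus>\<^bsub>Fo N\<^esub> y) = crd N x \<oplus>\<^bsub>T N\<^esub> crd N y"
      using dec[OF N TN.M.a_closed[OF crd_T[OF x] crd_T[OF y]]] by (simp only:)
    then show "crd N (x \<oplus>\<^bsub>Fo N\<^esub> y) i = crd N x i \<oplus>\<^bsub>N\<^esub> crd N y i"
      using i by (simp add: T)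
  next
    fix M N :: "('b, 'u) module" and f
    assume MN: "left_module B M" "left_module B N" "f \<in> mod_hom B M N"
    show "Fm M N f \<in> carrier (Fo M) \<rightarrow>\<^sub>E carrier (Fo N)"
      unfolding Fm_def cFo[of N]
      by (intro restrict_PiE_iff[THEN iffD2] ballI imageI fT[OF MN])
    fix x i assume "x \<in> carrier (Fo M)" "i \<in> I"
    then show "crd N (Fm M N f x) i = f (crd M x i)"
      using dec[OF MN(2) fT[OF MN]] by (simp add: Fm_def)
  qed
  then show ?thesis by blast
qed

end

text \<open>
  A tuple of tuples is a tuple indexed by \<open>I \<times> J\<close>, and the iterated action is that of the block
  matrix with entries \<open>\<chi> (\<omega> a i j) k l\<close>. The one delicate point is surjectivity of the coordinates:
  a fixed \<open>I \<times> J\<close>-tuple must have all its rows fixed by \<open>\<chi> 1\<close>.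
\<close>

theorem matrix_functor_comp:
  fixes A :: "('k::field, 'a) module" and B :: "('k, 'b) module" and C :: "('k, 'c) module"
    and Fo :: "('b, 'a, 'u) obj_map" and Go :: "('c, 'b, 'u) obj_map"
  assumes "matrix_hom A B I \<omega>" "matrix_hom B C J \<chi>"
    and "matrix_functor A B I \<omega> Fo Fm crd" "matrix_functor B C J \<chi> Go Gm crd'"
  shows "matrix_functor A C (I \<times> J) (\<lambda>a p q. \<chi> (\<omega> a (fst p) (fst q)) (snd p) (snd q))
    (\<lambda>N. Fo (Go N)) (\<lambda>M N f. Fm (Go M) (Go N) (Gm M N f))
    (\<lambda>N x. \<lambda>p\<in>I \<times> J. crd' N (crd (Go N) x (fst p)) (snd p))"
proof -
  interpret \<omega>: matrix_hom A B I \<omega> by fact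
  interpret \<chi>: matrix_hom B C J \<chi> by fact
  interpret F: matrix_functor A B I \<omega> Fo Fm crd by fact
  interpret G: matrix_functor B C J \<chi> Go Gm crd' by fact
  let ?\<omega> = "\<lambda>a p q. \<chi> (\<omega> a (fst p) (fst q)) (snd p) (snd q)"
  let ?c = "\<lambda>N x. \<lambda>p\<in>I \<times> J. crd' N (crd (Go N) x (fst p)) (snd p)"
  have smult: "?c N (a \<odot>\<^bsub>Fo (Go N)\<^esub> x) = mat_act N (I \<times> J) (?\<omega> a) (?c N x)"
    if N: "left_module C N" and a: "a \<in> carrier A" and x: "x \<in> carrier (Fo (Go N))" for N a x
  proof
    interpret N: left_module C N by fact
    interpret GN: left_module B "Go N" by (rule G.obj) fact
    note GN = G.obj[OF N] and cl = F.crd_closed[OF G.obj[OF N] x]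
    fix p show "?c N (a \<odot>\<^bsub>Fo (Go N)\<^esub> x) p = mat_act N (I \<times> J) (?\<omega> a) (?c N x) p"
    proof (cases "p \<in> I \<times> J")
      case True
      then obtain i k where p: "p = (i, k)" and i: "i \<in> I" and k: "k \<in> J" by auto
      have "?c N (a \<odot>\<^bsub>Fo (Go N)\<^esub> x) p = crd' N (\<Oplus>\<^bsub>Go N\<^esub>j\<in>I. \<omega> a i j \<odot>\<^bsub>Go N\<^esub> crd (Go N) x j) k"
        using i k by (simp add: p F.crd_smult[OF GN a x] mat_act_def)
      also have "\<dots> = (\<Oplus>\<^bsub>N\<^esub>j\<in>I. crd' N (\<omega> a i j \<odot>\<^bsub>Go N\<^esub> crd (Go N) x j) k)"
        by (intro G.crd_finsum N k \<omega>.finite_index GN.smult_closed \<omega>.closed a i cl)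
      also have "\<dots> = (\<Oplus>\<^bsub>N\<^esub>j\<in>I. \<Oplus>\<^bsub>N\<^esub>l\<in>J. \<chi> (\<omega> a i j) k l \<odot>\<^bsub>N\<^esub> crd' N (crd (Go N) x j) l)"
      proof (intro N.M.finsum_cong' refl funcsetI)
        fix j assume j: "j \<in> I"
        show "crd' N (\<omega> a i j \<odot>\<^bsub>Go N\<^esub> crd (Go N) x j) k =
            (\<Oplus>\<^bsub>N\<^esub>l\<in>J. \<chi> (\<omega> a i j) k l \<odot>\<^bsub>N\<^esub> crd' N (crd (Go N) x j) l)"
          unfolding G.crd_smult[OF N \<omega>.closed[OF a i j] cl[OF j]] using k by (simp add: mat_act_def)
      qed (intro N.M.finsum_closed funcsetI N.smult_closed \<chi>.closed \<omega>.closed G.crd_closed N a i k cl)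
      also have "\<dots> = (\<Oplus>\<^bsub>N\<^esub>q\<in>I \<times> J. \<chi> (\<omega> a i (fst q)) k (snd q) \<odot>\<^bsub>N\<^esub> crd' N (crd (Go N) x (fst q)) (snd q))"
        by (intro N.M.finsum_Times[symmetric] \<omega>.finite_index \<chi>.finite_index
          N.smult_closed \<chi>.closed \<omega>.closed G.crd_closed N a i k cl)
      also have "\<dots> = (\<Oplus>\<^bsub>N\<^esub>q\<in>I \<times> J. ?\<omega> a p q \<odot>\<^bsub>N\<^esub> ?c N x q)"
      proof (intro N.M.finsum_cong' refl funcsetI)
        fix q assume "q \<in> I \<times> J"
        then show "?\<omega> a p q \<odot>\<^bsub>N\<^esub> ?c N x q \<in> carrier N"
          unfolding p
          by (elim SigmaE) (simp, intro N.smult_closed \<chi>.closed \<omega>.closed G.crd_closed N a i k cl)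
      qed (simp add: p)
      also have "\<dots> = mat_act N (I \<times> J) (?\<omega> a) (?c N x) p" using True by (simp add: mat_act_def)
      finally show ?thesis .
    qed (simp add: mat_act_def)
  qed
  show ?thesis
  proof (rule matrix_functor.intro)
    fix N :: "('c, 'u) module" assume N: "left_module C N"
    note GN = G.obj[OF N]
    interpret N: left_module C N by fact
    interpret GN: left_module B "Go N" by (rule GN)
    show "left_module A (Fo (Go N))" by (rule F.obj[OF GN])
    interpret FGN: left_module A "Fo (Go N)" by (rule F.obj[OF GN])
    let ?X = "{t \<in> I \<times> J \<rightarrow>\<^sub>E carrier N. mat_act N (I \<times> J) (?\<omega> \<one>\<^bsub>A\<^esub>) t = t}"
    show "bij_betw (?c N) (carrier (Fo (Go N))) ?X"
    proof (rule bij_betw_imageI)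
      show "inj_on (?c N) (carrier (Fo (Go N)))"
      proof (rule inj_onI)
        fix x y assume x: "x \<in> carrier (Fo (Go N))" and y: "y \<in> carrier (Fo (Go N))"
          and eq: "?c N x = ?c N y"
        show "x = y"
        proof (rule F.crd_eqI[OF GN x y])
          fix i assume i: "i \<in> I"
          show "crd (Go N) x i = crd (Go N) y i"
          proof (rule G.crd_eqI[OF N F.crd_closed[OF GN x i] F.crd_closed[OF GN y i]])
            fix k assume "k \<in> J"
            then show "crd' N (crd (Go N) x i) k = crd' N (crd (Go N) y i) k"
              using i fun_cong[OF eq, of "(i, k)"] by simp
          qed
        qed
      qed
      show "?c N ` carrier (Fo (Go N)) = ?X"
      proof (intro subset_antisym subsetI)
        fix t assume "t \<in> ?c N ` carrier (Fo (Go N))"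
        then obtain x where x: "x \<in> carrier (Fo (Go N))" and t: "t = ?c N x" by blast
        have "t \<in> I \<times> J \<rightarrow>\<^sub>E carrier N"
          unfolding t by (intro restrict_PiE_iff[THEN iffD2] ballI G.crd_closed[OF N] F.crd_closed[OF GN x])
            (auto simp: mem_Times_iff)
        moreover have "mat_act N (I \<times> J) (?\<omega> \<one>\<^bsub>A\<^esub>) t = t"
          unfolding t smult[OF N \<omega>.A.one_closed x, symmetric] FGN.smult_one[OF x] ..
        ultimately show "t \<in> ?X" by blast
      next
        fix t assume "t \<in> ?X"
        then have t: "t \<in> I \<times> J \<rightarrow>\<^sub>E carrier N" and fixed: "mat_act N (I \<times> J) (?\<omega> \<one>\<^bsub>A\<^esub>) t = t"
          by blast+
        define s where "s i = (\<lambda>k\<in>J. t (i, k))" for i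
        have s: "s i \<in> J \<rightarrow>\<^sub>E carrier N" if "i \<in> I" for i
          unfolding s_def using PiE_mem[OF t] that by (intro restrict_PiE_iff[THEN iffD2] ballI) simp
        \<comment> \<open>Fixedness writes row \<open>i\<close> as a sum over \<open>j\<close> of tuples acted on by \<open>\<chi>\<close>; each summand is fixed,
            hence the coordinate tuple of some \<open>z i j\<close>, and row \<open>i\<close> is that of the sum of the \<open>z i j\<close>.\<close>
        have "\<exists>z\<in>carrier (Go N). crd' N z = mat_act N J (\<chi> (\<omega> \<one>\<^bsub>A\<^esub> i j)) (s j)"
          if "i \<in> I" "j \<in> I" for i j
          using \<chi>.mat_act_fixed[OF N \<omega>.closed[OF \<omega>.A.one_closed that] s[OF that(2)]]
            G.crd_surj[OF N, of "mat_act N J (\<chi> (\<omega> \<one>\<^bsub>A\<^esub> i j)) (s j)"] by blast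
        then obtain z where z: "\<And>i j. i \<in> I \<Longrightarrow> j \<in> I \<Longrightarrow> z i j \<in> carrier (Go N)"
          "\<And>i j. i \<in> I \<Longrightarrow> j \<in> I \<Longrightarrow> crd' N (z i j) = mat_act N J (\<chi> (\<omega> \<one>\<^bsub>A\<^esub> i j)) (s j)"
          by metis
        define y where "y = (\<lambda>i\<in>I. \<Oplus>\<^bsub>Go N\<^esub>j\<in>I. z i j)"
        have yc: "y i \<in> carrier (Go N)" if "i \<in> I" for i
          unfolding y_def using that by (simp, intro GN.M.finsum_closed funcsetI z(1))
        have yt: "crd' N (y i) k = t (i, k)" if i: "i \<in> I" and k: "k \<in> J" for i k
        proof -
          have "crd' N (y i) k = (\<Oplus>\<^bsub>N\<^esub>j\<in>I. crd' N (z i j) k)"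
            unfolding y_def using i by (simp, intro G.crd_finsum N k \<omega>.finite_index z(1))
          also have "\<dots> = (\<Oplus>\<^bsub>N\<^esub>j\<in>I. \<Oplus>\<^bsub>N\<^esub>l\<in>J. \<chi> (\<omega> \<one>\<^bsub>A\<^esub> i j) k l \<odot>\<^bsub>N\<^esub> t (j, l))"
          proof (intro N.M.finsum_cong' refl funcsetI)
            fix j assume j: "j \<in> I"
            show "crd' N (z i j) k = (\<Oplus>\<^bsub>N\<^esub>l\<in>J. \<chi> (\<omega> \<one>\<^bsub>A\<^esub> i j) k l \<odot>\<^bsub>N\<^esub> t (j, l))"
              unfolding z(2)[OF i j] mat_act_def s_def using j k
              by (simp, intro N.M.finsum_cong' refl funcsetI N.smult_closed \<chi>.closed \<omega>.closed
                \<omega>.A.one_closed i j PiE_mem[OF t]) simp_all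
          qed (intro N.M.finsum_closed funcsetI N.smult_closed \<chi>.closed \<omega>.closed \<omega>.A.one_closed
              i k SigmaI PiE_mem[OF t])
          also have "\<dots> = (\<Oplus>\<^bsub>N\<^esub>q\<in>I \<times> J. \<chi> (\<omega> \<one>\<^bsub>A\<^esub> i (fst q)) k (snd q) \<odot>\<^bsub>N\<^esub> t (fst q, snd q))"
            by (intro N.M.finsum_Times[symmetric] \<omega>.finite_index \<chi>.finite_index N.smult_closed
              \<chi>.closed \<omega>.closed \<omega>.A.one_closed i k SigmaI PiE_mem[OF t])
          also have "\<dots> = mat_act N (I \<times> J) (?\<omega> \<one>\<^bsub>A\<^esub>) t (i, k)" using i k by (simp add: mat_act_def)
          finally show ?thesis unfolding fixed .
        qed
        have yP: "y \<in> I \<rightarrow>\<^sub>E carrier (Go N)"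
          by (rule PiE_I) (simp_all add: yc, simp add: y_def)
        have "mat_act (Go N) I (\<omega> \<one>\<^bsub>A\<^esub>) y = y"
        proof (rule PiE_ext[OF \<omega>.mat_act_closed[OF GN \<omega>.A.one_closed yP] yP])
          fix i assume i: "i \<in> I"
          have "z i j = \<omega> \<one>\<^bsub>A\<^esub> i j \<odot>\<^bsub>Go N\<^esub> y j" if j: "j \<in> I" for j
          proof (rule G.crd_eqI[OF N z(1)[OF i j] GN.smult_closed[OF \<omega>.closed[OF \<omega>.A.one_closed i j] yc[OF j]]])
            fix k assume k: "k \<in> J"
            have "crd' N (y j) = s j"
              by (rule PiE_ext[OF G.crd_PiE[OF N yc[OF j]] s[OF j]]) (simp add: yt[OF j] s_def)
            then show "crd' N (z i j) k = crd' N (\<omega> \<one>\<^bsub>A\<^esub> i j \<odot>\<^bsub>Go N\<^esub> y j) k"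
              unfolding z(2)[OF i j] G.crd_smult[OF N \<omega>.closed[OF \<omega>.A.one_closed i j] yc[OF j]] by simp
          qed
          then have "(\<Oplus>\<^bsub>Go N\<^esub>j\<in>I. \<omega> \<one>\<^bsub>A\<^esub> i j \<odot>\<^bsub>Go N\<^esub> y j) = (\<Oplus>\<^bsub>Go N\<^esub>j\<in>I. z i j)"
            by (intro GN.M.finsum_cong' refl funcsetI z(1) i) simp_all
          then show "mat_act (Go N) I (\<omega> \<one>\<^bsub>A\<^esub>) y i = y i" using i by (simp add: mat_act_def y_def)
        qed
        then obtain x where x: "x \<in> carrier (Fo (Go N))" "crd (Go N) x = y"
          using F.crd_surj[OF GN yP] by blast
        have "?c N x = t"
        proof
          fix p show "?c N x p = t p"
            using PiE_arb[OF t, of p] by (cases "p \<in> I \<times> J") (auto simp: x(2) yt)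
        qed
        then show "t \<in> ?c N ` carrier (Fo (Go N))" using x(1) by blast
      qed
    qed
    fix x assume x: "x \<in> carrier (Fo (Go N))"
    show "?c N (a \<odot>\<^bsub>Fo (Go N)\<^esub> x) = mat_act N (I \<times> J) (?\<omega> a) (?c N x)" if "a \<in> carrier A" for a
      by (rule smult[OF N that x])
    fix y p assume y: "y \<in> carrier (Fo (Go N))" and "p \<in> I \<times> J"
    then obtain i k where p: "p = (i, k)" and i: "i \<in> I" and k: "k \<in> J" by blast
    show "?c N (x \<oplus>\<^bsub>Fo (Go N)\<^esub> y) p = ?c N x p \<oplus>\<^bsub>N\<^esub> ?c N y p"
      using i k by (simp add: p F.crd_add[OF GN x y i]
        G.crd_add[OF N F.crd_closed[OF GN x i] F.crd_closed[OF GN y i] k])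
  next
    fix M N :: "('c, 'u) module" and f
    assume M: "left_module C M" and N: "left_module C N" and f: "f \<in> mod_hom C M N"
    note Gf = G.mor_hom[OF M N f assms(2)]
    show "Fm (Go M) (Go N) (Gm M N f) \<in> carrier (Fo (Go M)) \<rightarrow>\<^sub>E carrier (Fo (Go N))"
      by (rule F.mor[OF G.obj[OF M] G.obj[OF N] Gf])
    fix x p assume x: "x \<in> carrier (Fo (Go M))" and "p \<in> I \<times> J"
    then obtain i k where p: "p = (i, k)" and i: "i \<in> I" and k: "k \<in> J" by blast
    show "?c N (Fm (Go M) (Go N) (Gm M N f) x) p = f (?c M x p)"
      using i k by (simp add: p F.crd_mor[OF G.obj[OF M] G.obj[OF N] Gf x i]
        G.crd_mor[OF M N f F.crd_closed[OF G.obj[OF M] x i] k])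
  qed
qed

text \<open>
  If \<open>\<omega> a i j = v i a u j\<close>, then \<open>\<omega> a\<close> acts on a tuple \<open>t\<close> by forming \<open>m = \<Sum>\<^sub>j u j t\<^sub>j\<close> and returning
  the tuple \<open>v i (a m)\<close>. Hence \<open>t \<mapsto> \<Sum>\<^sub>j u j t\<^sub>j\<close> and \<open>m \<mapsto> (v i m)\<^sub>i\<close> are mutually inverse between fixed
  tuples and module elements: one composite is multiplication by \<open>\<Sum>\<^sub>i u i v i = 1\<close>, the other is the
  action of \<open>\<omega> 1\<close>.
\<close>

theorem matrix_functor_iso_id:
  fixes u v :: "'i \<Rightarrow> 'a"
  assumes "field_algebra A" "matrix_functor A A I \<omega> To Tm crd" "finite I"
    and u: "\<And>i. i \<in> I \<Longrightarrow> u i \<in> carrier A" and v: "\<And>i. i \<in> I \<Longrightarrow> v i \<in> carrier A"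
    and uv: "(\<Oplus>\<^bsub>A\<^esub>i\<in>I. u i \<otimes>\<^bsub>A\<^esub> v i) = \<one>\<^bsub>A\<^esub>"
    and \<omega>: "\<And>a i j. a \<in> carrier A \<Longrightarrow> i \<in> I \<Longrightarrow> j \<in> I \<Longrightarrow> \<omega> a i j = v i \<otimes>\<^bsub>A\<^esub> a \<otimes>\<^bsub>A\<^esub> u j"
  shows "natural_iso_to_id A To Tm (\<lambda>M. \<lambda>x\<in>carrier (To M). \<Oplus>\<^bsub>M\<^esub>i\<in>I. u i \<odot>\<^bsub>M\<^esub> crd M x i)"
proof -
  interpret A: field_algebra A by fact
  interpret T: matrix_functor A A I \<omega> To Tm crd by fact
  define \<eta> where "\<eta> M = (\<lambda>x\<in>carrier (To M). \<Oplus>\<^bsub>M\<^esub>i\<in>I. u i \<odot>\<^bsub>M\<^esub> crd M x i)" for M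
  have act: "mat_act M I (\<omega> a) t = (\<lambda>i\<in>I. v i \<odot>\<^bsub>M\<^esub> (a \<odot>\<^bsub>M\<^esub> (\<Oplus>\<^bsub>M\<^esub>j\<in>I. u j \<odot>\<^bsub>M\<^esub> t j)))"
    if M: "left_module A M" and a: "a \<in> carrier A" and t: "t \<in> I \<rightarrow>\<^sub>E carrier M" for M a t
    unfolding mat_act_def
  proof (rule restrict_ext)
    interpret M: left_module A M by fact
    fix i assume i: "i \<in> I"
    note va = A.m_closed[OF v[OF i] a]
    have ut: "u j \<odot>\<^bsub>M\<^esub> t j \<in> carrier M" if "j \<in> I" for j
      by (intro M.smult_closed u that PiE_mem[OF t])
    have "(\<Oplus>\<^bsub>M\<^esub>j\<in>I. \<omega> a i j \<odot>\<^bsub>M\<^esub> t j) = (\<Oplus>\<^bsub>M\<^esub>j\<in>I. (v i \<otimes>\<^bsub>A\<^esub> a) \<odot>\<^bsub>M\<^esub> (u j \<odot>\<^bsub>M\<^esub> t j))"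
      by (intro M.M.finsum_cong' refl funcsetI)
        (rule M.smult_closed[OF va ut], assumption, simp add: \<omega>[OF a i] M.smult_assoc[OF va u PiE_mem[OF t]])
    also have "\<dots> = (v i \<otimes>\<^bsub>A\<^esub> a) \<odot>\<^bsub>M\<^esub> (\<Oplus>\<^bsub>M\<^esub>j\<in>I. u j \<odot>\<^bsub>M\<^esub> t j)"
      by (rule M.smult_finsum_right[OF assms(3) va ut, symmetric])
    also have "\<dots> = v i \<odot>\<^bsub>M\<^esub> (a \<odot>\<^bsub>M\<^esub> (\<Oplus>\<^bsub>M\<^esub>j\<in>I. u j \<odot>\<^bsub>M\<^esub> t j))"
      by (intro M.smult_assoc v i a M.M.finsum_closed funcsetI ut)
    finally show "(\<Oplus>\<^bsub>M\<^esub>j\<in>I. \<omega> a i j \<odot>\<^bsub>M\<^esub> t j) = \<dots>" .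
  qed
  have uvx: "(\<Oplus>\<^bsub>M\<^esub>i\<in>I. u i \<odot>\<^bsub>M\<^esub> (v i \<odot>\<^bsub>M\<^esub> x)) = x" if M: "left_module A M" and x: "x \<in> carrier M" for M x
  proof -
    interpret M: left_module A M by fact
    have "(\<Oplus>\<^bsub>M\<^esub>i\<in>I. u i \<odot>\<^bsub>M\<^esub> (v i \<odot>\<^bsub>M\<^esub> x)) = (\<Oplus>\<^bsub>M\<^esub>i\<in>I. (u i \<otimes>\<^bsub>A\<^esub> v i) \<odot>\<^bsub>M\<^esub> x)"
      by (intro M.M.finsum_cong' refl funcsetI)
        (intro M.smult_closed A.m_closed u v x, assumption+, simp add: M.smult_assoc[OF u v x])
    also have "\<dots> = \<one>\<^bsub>A\<^esub> \<odot>\<^bsub>M\<^esub> x"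
      unfolding uv[symmetric]
      by (intro M.smult_finsum_left[symmetric] assms(3) x A.m_closed u v)
    finally show ?thesis unfolding M.smult_one[OF x] .
  qed
  have \<eta>: "\<eta> M \<in> mod_hom A (To M) M" "\<eta> M \<in> mod_iso A (To M) M" if M: "left_module A M" for M
  proof -
    interpret M: left_module A M by fact
    interpret TM: left_module A "To M" by (rule T.obj[OF M])
    have uc: "u i \<odot>\<^bsub>M\<^esub> crd M x i \<in> carrier M" if "i \<in> I" "x \<in> carrier (To M)" for i x
      by (intro M.smult_closed u T.crd_closed[OF M] that)
    have \<eta>c: "\<eta> M x \<in> carrier M" if "x \<in> carrier (To M)" for x
      unfolding \<eta>_def using that by (simp, intro M.M.finsum_closed funcsetI uc that)
    have \<eta>x: "\<eta> M x = (\<Oplus>\<^bsub>M\<^esub>i\<in>I. u i \<odot>\<^bsub>M\<^esub> crd M x i)" if "x \<in> carrier (To M)" for x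
      using that by (simp add: \<eta>_def)
    have crd_smult: "crd M (a \<odot>\<^bsub>To M\<^esub> x) = (\<lambda>i\<in>I. v i \<odot>\<^bsub>M\<^esub> (a \<odot>\<^bsub>M\<^esub> \<eta> M x))"
      if a: "a \<in> carrier A" and x: "x \<in> carrier (To M)" for a x
      unfolding T.crd_smult[OF M a x] act[OF M a T.crd_PiE[OF M x]] \<eta>x[OF x] ..
    show hom: "\<eta> M \<in> mod_hom A (To M) M"
    proof (rule mod_homI)
      show "\<eta> M \<in> carrier (To M) \<rightarrow>\<^sub>E carrier M" by (rule PiE_I[OF \<eta>c]) (simp_all add: \<eta>_def)
      fix x assume x: "x \<in> carrier (To M)"
      show "\<eta> M (x \<oplus>\<^bsub>To M\<^esub> y) = \<eta> M x \<oplus>\<^bsub>M\<^esub> \<eta> M y" if y: "y \<in> carrier (To M)" for y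
      proof -
        have "(\<Oplus>\<^bsub>M\<^esub>i\<in>I. u i \<odot>\<^bsub>M\<^esub> crd M (x \<oplus>\<^bsub>To M\<^esub> y) i) =
            (\<Oplus>\<^bsub>M\<^esub>i\<in>I. u i \<odot>\<^bsub>M\<^esub> crd M x i \<oplus>\<^bsub>M\<^esub> u i \<odot>\<^bsub>M\<^esub> crd M y i)"
          by (intro M.M.finsum_cong' refl funcsetI)
            (intro M.M.a_closed uc x y, assumption+,
              simp add: T.crd_add[OF M x y] M.smult_r_distr[OF u T.crd_closed[OF M x] T.crd_closed[OF M y]])
        also have "\<dots> = \<eta> M x \<oplus>\<^bsub>M\<^esub> \<eta> M y"
          unfolding \<eta>x[OF x] \<eta>x[OF y] by (intro M.M.finsum_addf funcsetI uc x y)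
        finally show ?thesis unfolding \<eta>x[OF TM.M.a_closed[OF x y]] .
      qed
      show "\<eta> M (a \<odot>\<^bsub>To M\<^esub> x) = a \<odot>\<^bsub>M\<^esub> \<eta> M x" if a: "a \<in> carrier A" for a
      proof -
        have "\<eta> M (a \<odot>\<^bsub>To M\<^esub> x) = (\<Oplus>\<^bsub>M\<^esub>i\<in>I. u i \<odot>\<^bsub>M\<^esub> (v i \<odot>\<^bsub>M\<^esub> (a \<odot>\<^bsub>M\<^esub> \<eta> M x)))"
          unfolding \<eta>x[OF TM.smult_closed[OF a x]] crd_smult[OF a x]
          by (intro M.M.finsum_cong' refl funcsetI) (intro M.smult_closed u v a \<eta>c x, assumption+, simp)
        then show ?thesis unfolding uvx[OF M M.smult_closed[OF a \<eta>c[OF x]]] .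
      qed
    qed
    have "\<exists>y\<in>carrier (To M). crd M y = (\<lambda>i\<in>I. v i \<odot>\<^bsub>M\<^esub> x)" if x: "x \<in> carrier M" for x
    proof -
      have t: "(\<lambda>i\<in>I. v i \<odot>\<^bsub>M\<^esub> x) \<in> I \<rightarrow>\<^sub>E carrier M"
        by (intro restrict_PiE_iff[THEN iffD2] ballI M.smult_closed v x)
      have "(\<Oplus>\<^bsub>M\<^esub>j\<in>I. u j \<odot>\<^bsub>M\<^esub> (\<lambda>i\<in>I. v i \<odot>\<^bsub>M\<^esub> x) j) = (\<Oplus>\<^bsub>M\<^esub>j\<in>I. u j \<odot>\<^bsub>M\<^esub> (v j \<odot>\<^bsub>M\<^esub> x))"
        by (intro M.M.finsum_cong' refl funcsetI) (intro M.smult_closed u v x, assumption+, simp)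
      then have "mat_act M I (\<omega> \<one>\<^bsub>A\<^esub>) (\<lambda>i\<in>I. v i \<odot>\<^bsub>M\<^esub> x) = (\<lambda>i\<in>I. v i \<odot>\<^bsub>M\<^esub> x)"
        unfolding act[OF M A.one_closed t] uvx[OF M x] by (simp only: uvx[OF M x] M.smult_one[OF x])
      then show ?thesis using T.crd_surj[OF M t] by blast
    qed
    then obtain h where h: "\<And>x. x \<in> carrier M \<Longrightarrow> h x \<in> carrier (To M)"
      "\<And>x. x \<in> carrier M \<Longrightarrow> crd M (h x) = (\<lambda>i\<in>I. v i \<odot>\<^bsub>M\<^esub> x)" by metis
    have \<eta>h: "\<eta> M (h x) = x" if x: "x \<in> carrier M" for x
    proof -
      have "\<eta> M (h x) = (\<Oplus>\<^bsub>M\<^esub>i\<in>I. u i \<odot>\<^bsub>M\<^esub> (v i \<odot>\<^bsub>M\<^esub> x))"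
        unfolding \<eta>x[OF h(1)[OF x]] h(2)[OF x]
        by (intro M.M.finsum_cong' refl funcsetI) (intro M.smult_closed u v x, assumption+, simp)
      then show ?thesis unfolding uvx[OF M x] .
    qed
    have inj: "x = y" if "x \<in> carrier (To M)" "y \<in> carrier (To M)" "\<eta> M x = \<eta> M y" for x y
      using crd_smult[OF A.one_closed that(1)] crd_smult[OF A.one_closed that(2)] that(3)
      unfolding TM.smult_one[OF that(1)] TM.smult_one[OF that(2)]
      by (intro T.crd_eqI[OF M that(1,2)]) simp
    let ?h = "\<lambda>x\<in>carrier M. h x"
    have "?h \<in> mod_hom A M (To M)"
    proof (rule mod_homI)
      show "?h \<in> carrier M \<rightarrow>\<^sub>E carrier (To M)" by (intro restrict_PiE_iff[THEN iffD2] ballI h(1))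
      fix x assume x: "x \<in> carrier M"
      show "?h (x \<oplus>\<^bsub>M\<^esub> y) = ?h x \<oplus>\<^bsub>To M\<^esub> ?h y" if y: "y \<in> carrier M" for y
      proof -
        have "h (x \<oplus>\<^bsub>M\<^esub> y) = h x \<oplus>\<^bsub>To M\<^esub> h y"
        proof (rule inj[OF h(1)[OF M.M.a_closed[OF x y]] TM.M.a_closed[OF h(1)[OF x] h(1)[OF y]]])
          show "\<eta> M (h (x \<oplus>\<^bsub>M\<^esub> y)) = \<eta> M (h x \<oplus>\<^bsub>To M\<^esub> h y)"
            unfolding mod_homD(2)[OF hom h(1)[OF x] h(1)[OF y]] \<eta>h[OF x] \<eta>h[OF y]
              \<eta>h[OF M.M.a_closed[OF x y]] ..
        qed
        then show ?thesis using x y M.M.a_closed[OF x y] by simp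
      qed
      show "?h (a \<odot>\<^bsub>M\<^esub> x) = a \<odot>\<^bsub>To M\<^esub> ?h x" if a: "a \<in> carrier A" for a
      proof -
        have "h (a \<odot>\<^bsub>M\<^esub> x) = a \<odot>\<^bsub>To M\<^esub> h x"
        proof (rule inj[OF h(1)[OF M.smult_closed[OF a x]] TM.smult_closed[OF a h(1)[OF x]]])
          show "\<eta> M (h (a \<odot>\<^bsub>M\<^esub> x)) = \<eta> M (a \<odot>\<^bsub>To M\<^esub> h x)"
            unfolding mod_homD(3)[OF hom a h(1)[OF x]] \<eta>h[OF x] \<eta>h[OF M.smult_closed[OF a x]] ..
        qed
        then show ?thesis using x M.smult_closed[OF a x] by simp
      qed
    qed
    moreover have "mod_comp (To M) ?h (\<eta> M) = mod_id (To M)"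
      unfolding mod_comp_def compose_def mod_id_def
    proof (rule restrict_ext)
      fix x assume x: "x \<in> carrier (To M)"
      show "?h (\<eta> M x) = x"
        using inj[OF h(1)[OF \<eta>c[OF x]] x \<eta>h[OF \<eta>c[OF x]]] \<eta>c[OF x] by simp
    qed
    moreover have "mod_comp M (\<eta> M) ?h = mod_id M"
      unfolding mod_comp_def compose_def mod_id_def by (rule restrict_ext) (simp add: \<eta>h)
    ultimately show "\<eta> M \<in> mod_iso A (To M) M" using hom unfolding mod_iso_def by blast
  qed
  have nat: "mod_comp (To M) (\<eta> N) (Tm M N f) = mod_comp (To M) f (\<eta> M)"
    if M: "left_module A M" and N: "left_module A N" and f: "f \<in> mod_hom A M N" for M N f
    unfolding mod_comp_def compose_def
  proof (rule restrict_ext)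
    interpret M: left_module A M by fact
    interpret N: left_module A N by fact
    fix x assume x: "x \<in> carrier (To M)"
    have "\<eta> N (Tm M N f x) = (\<Oplus>\<^bsub>N\<^esub>i\<in>I. u i \<odot>\<^bsub>N\<^esub> crd N (Tm M N f x) i)"
      using T.mor_closed[OF M N f x] by (simp add: \<eta>_def)
    also have "\<dots> = (\<Oplus>\<^bsub>N\<^esub>i\<in>I. f (u i \<odot>\<^bsub>M\<^esub> crd M x i))"
      by (intro N.M.finsum_cong' refl funcsetI)
        (intro mod_homD(1)[OF f] M.smult_closed u T.crd_closed[OF M x], assumption+,
          simp add: T.crd_mor[OF M N f x] mod_homD(3)[OF f u T.crd_closed[OF M x]])
    also have "\<dots> = f (\<Oplus>\<^bsub>M\<^esub>i\<in>I. u i \<odot>\<^bsub>M\<^esub> crd M x i)"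
      by (intro mod_hom_finsum[OF M N f assms(3), symmetric] M.smult_closed u T.crd_closed[OF M x])
    also have "\<dots> = f (\<eta> M x)" using x by (simp add: \<eta>_def)
    finally show "\<eta> N (Tm M N f x) = f (\<eta> M x)" .
  qed
  show ?thesis
    unfolding natural_iso_to_id_def Mod_def \<eta>_def[symmetric] using \<eta>(2) nat by blast
qed

text \<open>
  Two matrix maps in opposite directions give a Morita equivalence as soon as both composites are
  inner, which is the form in which a Morita context appears here.
\<close>

theorem morita_equivalent_matrix_homs:
  fixes A :: "('k::field, 'a) module" and B :: "('k, 'b) module"
    and \<omega> :: "'a \<Rightarrow> 'i \<Rightarrow> 'i \<Rightarrow> 'b" and \<chi> :: "'b \<Rightarrow> 'j \<Rightarrow> 'j \<Rightarrow> 'a"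
  assumes "infinite (UNIV :: 'k set)" "matrix_hom A B I \<omega>" "matrix_hom B A J \<chi>"
    and "\<And>p. p \<in> I \<times> J \<Longrightarrow> u p \<in> carrier A" "\<And>p. p \<in> I \<times> J \<Longrightarrow> v p \<in> carrier A"
    and "(\<Oplus>\<^bsub>A\<^esub>p\<in>I \<times> J. u p \<otimes>\<^bsub>A\<^esub> v p) = \<one>\<^bsub>A\<^esub>"
    and "\<And>a p q. a \<in> carrier A \<Longrightarrow> p \<in> I \<times> J \<Longrightarrow> q \<in> I \<times> J \<Longrightarrow>
      \<chi> (\<omega> a (fst p) (fst q)) (snd p) (snd q) = v p \<otimes>\<^bsub>A\<^esub> a \<otimes>\<^bsub>A\<^esub> u q"
    and "\<And>p. p \<in> J \<times> I \<Longrightarrow> u' p \<in> carrier B" "\<And>p. p \<in> J \<times> I \<Longrightarrow> v' p \<in> carrier B"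
    and "(\<Oplus>\<^bsub>B\<^esub>p\<in>J \<times> I. u' p \<otimes>\<^bsub>B\<^esub> v' p) = \<one>\<^bsub>B\<^esub>"
    and "\<And>b p q. b \<in> carrier B \<Longrightarrow> p \<in> J \<times> I \<Longrightarrow> q \<in> J \<times> I \<Longrightarrow>
      \<omega> (\<chi> b (fst p) (fst q)) (snd p) (snd q) = v' p \<otimes>\<^bsub>B\<^esub> b \<otimes>\<^bsub>B\<^esub> u' q"
  shows "morita_equivalent TYPE('u) A B"
proof -
  interpret \<omega>: matrix_hom A B I \<omega> by fact
  interpret \<chi>: matrix_hom B A J \<chi> by fact
  have fin: "finite (I \<times> J)" "finite (J \<times> I)" using \<omega>.finite_index \<chi>.finite_index by simp_all
  obtain Go :: "('b, 'a, 'u) obj_map" and Gm d where G: "matrix_functor A B I \<omega> Go Gm d"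
    using \<omega>.matrix_functor_exists[OF assms(1)] by blast
  obtain Fo :: "('a, 'b, 'u) obj_map" and Fm c where F: "matrix_functor B A J \<chi> Fo Fm c"
    using \<chi>.matrix_functor_exists[OF assms(1)] by blast
  note iso_A = matrix_functor_iso_id[OF \<omega>.A.field_algebra_axioms
    matrix_functor_comp[OF assms(2,3) G F] fin(1) assms(4-7)]
  note iso_B = matrix_functor_iso_id[OF \<omega>.B.field_algebra_axioms
    matrix_functor_comp[OF assms(3,2) F G] fin(2) assms(8-11)]
  show ?thesis
    unfolding morita_equivalent_def
    using \<omega>.A.field_algebra_axioms \<omega>.B.field_algebra_axioms iso_A iso_B
      matrix_functor.linear_functor[OF F assms(3)] matrix_functor.linear_functor[OF G assms(2)]
    by blast
qed

section \<open>Elements of the affine Schur algebra as equivariant matrices\<close>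

text \<open>
  The coefficient of \<open>f\<close> at the orbit of \<open>(p, q)\<close>. Thus \<open>\<xi>\<^sub>i\<^sub>,\<^sub>j\<close> becomes the indicator matrix of the
  orbit of \<open>(i, j)\<close>.
\<close>

definition entry :: "nat \<Rightarrow> nat \<Rightarrow> ('k::field) schur_elem \<Rightarrow> tuple \<Rightarrow> tuple \<Rightarrow> 'k" where
  "entry n r f p q = Poly_Mapping.lookup f (orbit_rel n r `` {(p, q)})"

definition row :: "nat \<Rightarrow> nat \<Rightarrow> ('k::field) schur_elem \<Rightarrow> tuple \<Rightarrow> tuple set" where
  "row n r f p = {s \<in> tuples r. entry n r f p s \<noteq> 0}"

definition equivariant_matrix :: "nat \<Rightarrow> nat \<Rightarrow> (tuple \<Rightarrow> tuple \<Rightarrow> 'k::field) \<Rightarrow> bool" where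
  "equivariant_matrix n r F \<longleftrightarrow>
     (\<forall>p\<in>tuples r. \<forall>q\<in>tuples r. \<forall>w\<in>affine_weyl r. F (weyl_act n r p w) (weyl_act n r q w) = F p q) \<and>
     (\<forall>p\<in>tuples r. finite {q \<in> tuples r. F p q \<noteq> 0})"

definition of_entries :: "nat \<Rightarrow> nat \<Rightarrow> (tuple \<Rightarrow> tuple \<Rightarrow> 'k::field) \<Rightarrow> 'k schur_elem" where
  "of_entries n r F =
     Abs_poly_mapping (\<lambda>C. if C \<in> pair_orbits n r then F (fst (rep C)) (snd (rep C)) else 0)"

lemma orbit_eq_iff:
  assumes "p \<in> tuples r" "q \<in> tuples r" "p' \<in> tuples r" "q' \<in> tuples r"
  shows "orbit_rel n r `` {(p, q)} = orbit_rel n r `` {(p', q')} \<longleftrightarrow>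
    (\<exists>w\<in>affine_weyl r. p' = weyl_act n r p w \<and> q' = weyl_act n r q w)"
proof -
  have "orbit_rel n r `` {(p, q)} = orbit_rel n r `` {(p', q')} \<longleftrightarrow> ((p, q), (p', q')) \<in> orbit_rel n r"
    using assms by (intro eq_equiv_class_iff[OF orbit_rel_equiv]) auto
  then show ?thesis using assms by (simp add: orbit_rel_def)
qed

lemma orbit_mem: "p \<in> tuples r \<Longrightarrow> q \<in> tuples r \<Longrightarrow> orbit_rel n r `` {(p, q)} \<in> pair_orbits n r"
  unfolding pair_orbits_def by (intro quotientI) simp

lemma rep_orbit:
  assumes "C \<in> pair_orbits n r"
  shows "fst (rep C) \<in> tuples r" "snd (rep C) \<in> tuples r"
    and "orbit_rel n r `` {(fst (rep C), snd (rep C))} = C"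
proof -
  obtain x where x: "C = orbit_rel n r `` {x}" "x \<in> tuples r \<times> tuples r"
    using assms unfolding pair_orbits_def by (rule quotientE)
  have "x \<in> C" unfolding x(1) using orbit_rel_equiv x(2) by (rule equiv_class_self)
  then have C: "rep C \<in> C" unfolding rep_def by (rule someI)
  then have r: "(x, rep C) \<in> orbit_rel n r" using x(1) by simp
  then have "rep C \<in> tuples r \<times> tuples r"
    using equiv_type[OF orbit_rel_equiv] by blast
  then show "fst (rep C) \<in> tuples r" "snd (rep C) \<in> tuples r" by (simp_all add: mem_Times_iff)
  show "orbit_rel n r `` {(fst (rep C), snd (rep C))} = C"
    unfolding x(1) using equiv_class_eq[OF orbit_rel_equiv r] by (simp add: x(1))
qed

lemma carrier_affine_schur:
  "f \<in> carrier (affine_schur n r) \<longleftrightarrow> (\<forall>C. C \<notin> pair_orbits n r \<longrightarrow> Poly_Mapping.lookup f C = 0)"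
  by (auto simp: affine_schur_def in_keys_iff)

lemma schur_elem_eqI:
  assumes "f \<in> carrier (affine_schur n r)" "g \<in> carrier (affine_schur n r)"
    and "\<And>p q. p \<in> tuples r \<Longrightarrow> q \<in> tuples r \<Longrightarrow> entry n r f p q = entry n r g p q"
  shows "f = g"
proof (rule poly_mapping_eqI)
  fix C show "Poly_Mapping.lookup f C = Poly_Mapping.lookup g C"
  proof (cases "C \<in> pair_orbits n r")
    case True
    then show ?thesis
      using assms(3)[OF rep_orbit(1,2)[OF True]] rep_orbit(3)[OF True] by (simp add: entry_def)
  next
    case False
    then show ?thesis using assms(1,2) by (simp add: carrier_affine_schur)
  qed
qed

lemma entry_act:
  assumes "p \<in> tuples r" "q \<in> tuples r" "w \<in> affine_weyl r"
  shows "entry n r f (weyl_act n r p w) (weyl_act n r q w) = entry n r f p q"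
proof -
  have "orbit_rel n r `` {(p, q)} = orbit_rel n r `` {(weyl_act n r p w, weyl_act n r q w)}"
    using assms by (subst orbit_eq_iff) (auto simp: weyl_act_tuples)
  then show ?thesis by (simp add: entry_def)
qed

text \<open>
  Only finitely many orbits are involved, and an orbit contains only finitely many pairs with
  first component \<open>p\<close>, because at most finitely many group elements move one tuple to another.
\<close>

lemma finite_row:
  assumes "n \<ge> 1" "p \<in> tuples r"
  shows "finite (row n r f p)"
proof -
  have "row n r f p \<subseteq> (\<Union>C\<in>Poly_Mapping.keys f \<inter> pair_orbits n r.
      (\<lambda>w. weyl_act n r (snd (rep C)) w) ` {w \<in> affine_weyl r. weyl_act n r (fst (rep C)) w = p})"
  proof
    fix s assume s: "s \<in> row n r f p"
    define C where "C = orbit_rel n r `` {(p, s)}"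
    have C: "C \<in> pair_orbits n r" "C \<in> Poly_Mapping.keys f"
      using s orbit_mem[OF assms(2)] by (auto simp: row_def entry_def C_def in_keys_iff)
    have "orbit_rel n r `` {(fst (rep C), snd (rep C))} = orbit_rel n r `` {(p, s)}"
      using rep_orbit(3)[OF C(1)] by (simp add: C_def)
    then obtain w where "w \<in> affine_weyl r" "p = weyl_act n r (fst (rep C)) w" "s = weyl_act n r (snd (rep C)) w"
      using s assms(2) rep_orbit(1,2)[OF C(1)] by (subst (asm) orbit_eq_iff) (auto simp: row_def)
    then show "s \<in> (\<Union>C\<in>Poly_Mapping.keys f \<inter> pair_orbits n r.
      (\<lambda>w. weyl_act n r (snd (rep C)) w) ` {w \<in> affine_weyl r. weyl_act n r (fst (rep C)) w = p})"
      using C by blast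
  qed
  moreover have "finite \<dots>"
    by (intro finite_UN_I finite_imageI finite_weyl_transporter[OF assms(1)]) simp
  ultimately show ?thesis by (rule finite_subset)
qed

text \<open>
  The shift by the negated quotients reduces all entries modulo \<open>n\<close>, so there are only finitely
  many orbits of tuples.
\<close>

lemma fundamental_domain:
  assumes "n \<ge> 1" "p \<in> tuples r"
  obtains w where "w \<in> affine_weyl r" "weyl_act n r p w \<in> {1..r} \<rightarrow>\<^sub>E {0..<int n}"
proof
  let ?w = "(id, \<lambda>a\<in>{1..r}. - (p a div int n)) :: (nat \<Rightarrow> nat) \<times> tuple"
  show "?w \<in> affine_weyl r" by (auto simp: affine_weyl_def tuples_def permutes_id)
  have "p a + int n * - (p a div int n) = p a mod int n" for a
    by (simp add: minus_mult_div_eq_mod)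
  then show "weyl_act n r p ?w \<in> {1..r} \<rightarrow>\<^sub>E {0..<int n}"
    using assms(1) by (auto simp: weyl_act_def PiE_iff)
qed

lemma finite_fundamental_domain:
  fixes r :: nat
  shows "finite ({1..r} \<rightarrow>\<^sub>E {0..<int n})"
  by (intro finite_PiE) auto

text \<open>
  Every orbit of pairs has a member whose first component lies in the finite fundamental domain.
  As the rows of \<open>F\<close> have finite support, \<open>F\<close> is nonzero on finitely many orbits only.
\<close>

lemma of_entries:
  assumes n: "n \<ge> 1" and F: "equivariant_matrix n r F"
  shows "of_entries n r F \<in> carrier (affine_schur n r)"
    and "p \<in> tuples r \<Longrightarrow> q \<in> tuples r \<Longrightarrow> entry n r (of_entries n r F) p q = F p q"
proof -
  let ?h = "\<lambda>C. if C \<in> pair_orbits n r then F (fst (rep C)) (snd (rep C)) else 0"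
  let ?D = "{1..r} \<rightarrow>\<^sub>E {0..<int n}"
  have D: "?D \<subseteq> tuples r" by (auto simp: tuples_def)
  have inv: "F (weyl_act n r p w) (weyl_act n r q w) = F p q"
    if "p \<in> tuples r" "q \<in> tuples r" "w \<in> affine_weyl r" for p q w
    using F that by (simp add: equivariant_matrix_def)
  have "{C. ?h C \<noteq> 0} \<subseteq> (\<Union>p\<in>?D. (\<lambda>q. orbit_rel n r `` {(p, q)}) ` {q \<in> tuples r. F p q \<noteq> 0})"
  proof
    fix C assume "C \<in> {C. ?h C \<noteq> 0}"
    then have C: "C \<in> pair_orbits n r" and nz: "F (fst (rep C)) (snd (rep C)) \<noteq> 0" by (auto split: if_splits)
    note rC = rep_orbit[OF C]
    obtain w where w: "w \<in> affine_weyl r" "weyl_act n r (fst (rep C)) w \<in> ?D"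
      using fundamental_domain[OF n rC(1)] .
    have "C = orbit_rel n r `` {(weyl_act n r (fst (rep C)) w, weyl_act n r (snd (rep C)) w)}"
      by (subst rC(3)[symmetric], subst orbit_eq_iff) (use rC w in \<open>auto simp: weyl_act_tuples\<close>)
    then show "C \<in> (\<Union>p\<in>?D. (\<lambda>q. orbit_rel n r `` {(p, q)}) ` {q \<in> tuples r. F p q \<noteq> 0})"
      using w nz inv[OF rC(1,2) w(1)] by (intro UN_I[OF w(2)]) (auto simp: weyl_act_tuples)
  qed
  moreover have "finite \<dots>"
    using F D by (intro finite_UN_I finite_imageI finite_fundamental_domain) (auto simp: equivariant_matrix_def)
  ultimately have "finite {C. ?h C \<noteq> 0}" by (rule finite_subset)
  then have lookup: "Poly_Mapping.lookup (of_entries n r F) = ?h"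
    unfolding of_entries_def by (rule lookup_Abs_poly_mapping)
  then show "of_entries n r F \<in> carrier (affine_schur n r)" by (simp add: carrier_affine_schur)
  assume pq: "p \<in> tuples r" "q \<in> tuples r"
  note C = orbit_mem[OF pq, of n]
  obtain w where "w \<in> affine_weyl r"
    "fst (rep (orbit_rel n r `` {(p, q)})) = weyl_act n r p w"
    "snd (rep (orbit_rel n r `` {(p, q)})) = weyl_act n r q w"
    using rep_orbit(3)[OF C, symmetric] orbit_eq_iff[OF pq rep_orbit(1,2)[OF C]] by blast
  then show "entry n r (of_entries n r F) p q = F p q"
    using C by (simp add: entry_def lookup inv pq)
qed

subsection \<open>The operations in terms of entries\<close>

lemma entry_add: "entry n r (f \<oplus>\<^bsub>affine_schur n r\<^esub> g) p q = entry n r f p q + entry n r g p q"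
  by (simp add: affine_schur_def entry_def lookup_add)

lemma entry_zero: "entry n r \<zero>\<^bsub>affine_schur n r\<^esub> p q = 0"
  by (simp add: affine_schur_def entry_def)

lemma entry_smult: "entry n r (c \<odot>\<^bsub>affine_schur n r\<^esub> f) p q = c * entry n r f p q"
  by (simp add: affine_schur_def entry_def map.rep_eq when_def)

text \<open>
  The group acts by injective maps, so the orbit of \<open>(p, q)\<close> contains a diagonal pair only if \<open>p = q\<close>.
\<close>

lemma entry_one:
  assumes "n \<ge> 1" "p \<in> tuples r" "q \<in> tuples r"
  shows "entry n r \<one>\<^bsub>affine_schur n r\<^esub> p q = (if p = q then 1 else 0)"
proof -
  let ?D = "(\<lambda>i. orbit_rel n r `` {(i, i)}) ` tuples r"
  have "?D \<subseteq> (\<lambda>i. orbit_rel n r `` {(i, i)}) ` ({1..r} \<rightarrow>\<^sub>E {0..<int n})"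
  proof
    fix C assume "C \<in> ?D"
    then obtain i where i: "i \<in> tuples r" "C = orbit_rel n r `` {(i, i)}" by blast
    obtain w where w: "w \<in> affine_weyl r" "weyl_act n r i w \<in> {1..r} \<rightarrow>\<^sub>E {0..<int n}"
      using fundamental_domain[OF assms(1) i(1)] .
    have "C = orbit_rel n r `` {(weyl_act n r i w, weyl_act n r i w)}"
      unfolding i(2) by (subst orbit_eq_iff) (use i w in \<open>auto simp: weyl_act_tuples\<close>)
    then show "C \<in> (\<lambda>i. orbit_rel n r `` {(i, i)}) ` ({1..r} \<rightarrow>\<^sub>E {0..<int n})" using w(2) by blast
  qed
  then have fin: "finite ?D" by (rule finite_subset) (intro finite_imageI finite_fundamental_domain)
  have "entry n r \<one>\<^bsub>affine_schur n r\<^esub> p q = (\<Sum>C\<in>?D. if C = orbit_rel n r `` {(p, q)} then 1 else 0)"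
    by (auto simp: affine_schur_def entry_def lookup_sum lookup_single when_def intro!: sum.cong)
  also have "\<dots> = (if orbit_rel n r `` {(p, q)} \<in> ?D then 1 else 0)"
    using fin by (simp add: sum.delta)
  also have "orbit_rel n r `` {(p, q)} \<in> ?D \<longleftrightarrow> p = q"
  proof
    assume "orbit_rel n r `` {(p, q)} \<in> ?D"
    then obtain i where i: "orbit_rel n r `` {(p, q)} = orbit_rel n r `` {(i, i)}" "i \<in> tuples r"
      by (rule imageE)
    show "p = q" using i(1)[symmetric] unfolding orbit_eq_iff[OF i(2) i(2) assms(2,3)] by blast
  qed (use assms(2) in blast)
  finally show ?thesis .
qed

text \<open>
  The number \<open>Z\<close> counts the tuples \<open>s\<close> for which \<open>(p, s)\<close> and \<open>(s, q)\<close> lie in two given orbits. Summing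
  over all pairs of orbits and exchanging the sums gives the matrix product. Any finite \<open>S\<close> that
  contains the support of row \<open>p\<close> may be used as range of summation, which makes it possible to
  compare products with different supports.
\<close>

lemma entry_schur_mult:
  fixes f g :: "('k::field) schur_elem"
  assumes n: "n \<ge> 1" and f: "f \<in> carrier (affine_schur n r)" and g: "g \<in> carrier (affine_schur n r)"
    and pq: "p \<in> tuples r" "q \<in> tuples r"
    and S: "finite S" "S \<subseteq> tuples r" "row n r f p \<subseteq> S"
  shows "entry n r (f \<otimes>\<^bsub>affine_schur n r\<^esub> g) p q = (\<Sum>s\<in>S. entry n r f p s * entry n r g s q)"
proof -
  let ?cl = "\<lambda>x y. orbit_rel n r `` {(x, y)}"
  let ?R = "orbit_rel n r"
  let ?C = "?cl p q"
  note C = orbit_mem[OF pq, of n]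
  have sub: "Poly_Mapping.keys f \<subseteq> pair_orbits n r" "Poly_Mapping.keys g \<subseteq> pair_orbits n r"
    using f g by (auto simp: affine_schur_def)
  have rel_refl: "(x, x) \<in> ?R" if "x \<in> tuples r \<times> tuples r" for x
    using orbit_rel_equiv that by (meson equivE refl_onD)
  have sy: "(x, y) \<in> ?R \<longleftrightarrow> (y, x) \<in> ?R" for x y
    using orbit_rel_equiv by (meson equivE symE)
  have rep_iff: "(rep A, (x, y)) \<in> ?R \<longleftrightarrow> ?cl x y = A"
    if "A \<in> pair_orbits n r" "x \<in> tuples r" "y \<in> tuples r" for A x y
    using that rep_orbit[OF that(1)] eq_equiv_class_iff[OF orbit_rel_equiv, of "rep A" r "(x, y)" n]
    by (auto simp: mem_Times_iff)
  have Zsum: "(of_nat (Z n r (rep A) (rep B) (rep ?C)) :: 'k) =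
      (\<Sum>s\<in>S. (if A = ?cl p s then 1 else 0) * (if B = ?cl s q then 1 else 0))"
    if A: "A \<in> Poly_Mapping.keys f" and B: "B \<in> Poly_Mapping.keys g" for A B
  proof -
    have AB: "A \<in> pair_orbits n r" "B \<in> pair_orbits n r" using A B sub by blast+
    have "Z n r (rep A) (rep B) (rep ?C) = Z n r (rep A) (rep B) (p, q)"
      using rep_iff[OF C pq] rep_orbit[OF AB(1)] rep_orbit[OF AB(2)]
      by (intro Z_cong rel_refl) (auto simp: mem_Times_iff)
    also have "\<dots> = card {s \<in> tuples r. (rep A, (p, s)) \<in> ?R \<and> ((s, q), rep B) \<in> ?R}"
      by (simp add: Z_def case_prod_beta)
    also have "{s \<in> tuples r. (rep A, (p, s)) \<in> ?R \<and> ((s, q), rep B) \<in> ?R} =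
        {s \<in> S. A = ?cl p s \<and> B = ?cl s q}"
    proof (intro Set.set_eqI iffI)
      fix s assume "s \<in> {s \<in> tuples r. (rep A, (p, s)) \<in> ?R \<and> ((s, q), rep B) \<in> ?R}"
      then have s: "s \<in> tuples r" "?cl p s = A" "?cl s q = B"
        using rep_iff[OF AB(1) pq(1), of s] rep_iff[OF AB(2) _ pq(2), of s] sy[of "(s, q)" "rep B"] by blast+
      then have "s \<in> row n r f p" using A by (auto simp: row_def entry_def in_keys_iff)
      then show "s \<in> {s \<in> S. A = ?cl p s \<and> B = ?cl s q}" using s S(3) by blast
    next
      fix s assume s: "s \<in> {s \<in> S. A = ?cl p s \<and> B = ?cl s q}"
      then have "s \<in> tuples r" using S(2) by blast
      then show "s \<in> {s \<in> tuples r. (rep A, (p, s)) \<in> ?R \<and> ((s, q), rep B) \<in> ?R}"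
        using s rep_iff[OF AB(1) pq(1), of s] rep_iff[OF AB(2) _ pq(2), of s] sy[of "(s, q)" "rep B"] by blast
    qed
    also have "(of_nat (card {s \<in> S. A = ?cl p s \<and> B = ?cl s q}) :: 'k) =
        (\<Sum>s\<in>{s \<in> S. A = ?cl p s \<and> B = ?cl s q}. 1)" by simp
    also have "\<dots> = (\<Sum>s\<in>S. (if A = ?cl p s then 1 else 0) * (if B = ?cl s q then 1 else 0))"
      using S(1) by (intro sum.mono_neutral_cong_left) auto
    finally show ?thesis .
  qed
  have "entry n r (f \<otimes>\<^bsub>affine_schur n r\<^esub> g) p q =
      (\<Sum>A\<in>Poly_Mapping.keys f. \<Sum>B\<in>Poly_Mapping.keys g.
        Poly_Mapping.lookup f A * Poly_Mapping.lookup g B * of_nat (Z n r (rep A) (rep B) (rep ?C)))"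
    unfolding affine_schur_def entry_def schur_mult_def monoid.simps lookup_sum
  proof (intro sum.cong refl)
    fix A B assume A: "A \<in> Poly_Mapping.keys f" and B: "B \<in> Poly_Mapping.keys g"
    have "rep A \<in> tuples r \<times> tuples r"
      using rep_orbit(1,2)[of A n r] A sub by (auto simp: mem_Times_iff)
    then have "finite {C \<in> pair_orbits n r. Z n r (rep A) (rep B) (rep C) \<noteq> 0}"
      by (rule Z_finite[OF n])
    then show "(\<Sum>C | C \<in> pair_orbits n r \<and> Z n r (rep A) (rep B) (rep C) \<noteq> 0.
        Poly_Mapping.lookup (Poly_Mapping.single C (Poly_Mapping.lookup f A * Poly_Mapping.lookup g B *
          of_nat (Z n r (rep A) (rep B) (rep C)))) ?C) =
        Poly_Mapping.lookup f A * Poly_Mapping.lookup g B * of_nat (Z n r (rep A) (rep B) (rep ?C))"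
      using C by (simp add: lookup_single when_def sum.delta)
  qed
  also have "\<dots> = (\<Sum>A\<in>Poly_Mapping.keys f. \<Sum>B\<in>Poly_Mapping.keys g. \<Sum>s\<in>S.
      (if A = ?cl p s then Poly_Mapping.lookup f A else 0) * (if B = ?cl s q then Poly_Mapping.lookup g B else 0))"
    by (intro sum.cong refl) (auto simp: Zsum sum_distrib_left intro!: sum.cong)
  also have "\<dots> = (\<Sum>A\<in>Poly_Mapping.keys f. \<Sum>s\<in>S. \<Sum>B\<in>Poly_Mapping.keys g.
      (if A = ?cl p s then Poly_Mapping.lookup f A else 0) * (if B = ?cl s q then Poly_Mapping.lookup g B else 0))"
    by (intro sum.cong refl sum.swap)
  also have "\<dots> = (\<Sum>s\<in>S. \<Sum>A\<in>Poly_Mapping.keys f. \<Sum>B\<in>Poly_Mapping.keys g.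
      (if A = ?cl p s then Poly_Mapping.lookup f A else 0) * (if B = ?cl s q then Poly_Mapping.lookup g B else 0))"
    by (rule sum.swap)
  also have "\<dots> = (\<Sum>s\<in>S. entry n r f p s * entry n r g s q)"
    by (intro sum.cong refl)
      (simp add: sum_product[symmetric] sum.delta entry_def in_keys_iff)
  finally show ?thesis .
qed

lemma schur_mult_closed:
  assumes "f \<in> carrier (affine_schur n r)" "g \<in> carrier (affine_schur n r)"
  shows "f \<otimes>\<^bsub>affine_schur n r\<^esub> g \<in> carrier (affine_schur n r)"
  unfolding carrier_affine_schur
proof (intro allI impI)
  fix C assume C: "C \<notin> pair_orbits n r"
  show "Poly_Mapping.lookup (f \<otimes>\<^bsub>affine_schur n r\<^esub> g) C = 0"
    unfolding affine_schur_def schur_mult_def monoid.simps lookup_sum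
    by (intro sum.neutral ballI) (use C in \<open>auto simp: lookup_single when_def\<close>)
qed

lemma schur_one_closed: "\<one>\<^bsub>affine_schur n r\<^esub> \<in> carrier (affine_schur n r)"
  unfolding carrier_affine_schur
proof (intro allI impI)
  fix C assume C: "C \<notin> pair_orbits n r"
  show "Poly_Mapping.lookup \<one>\<^bsub>affine_schur n r\<^esub> C = 0"
    unfolding affine_schur_def monoid.simps lookup_sum
    by (intro sum.neutral ballI) (use C orbit_mem in \<open>auto simp: lookup_single when_def\<close>)
qed

lemma schur_add_closed:
  assumes "f \<in> carrier (affine_schur n r)" "g \<in> carrier (affine_schur n r)"
  shows "f \<oplus>\<^bsub>affine_schur n r\<^esub> g \<in> carrier (affine_schur n r)"
  using assms unfolding carrier_affine_schur by (simp add: affine_schur_def lookup_add)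

lemma schur_smult_closed:
  assumes "f \<in> carrier (affine_schur n r)"
  shows "c \<odot>\<^bsub>affine_schur n r\<^esub> f \<in> carrier (affine_schur n r)"
  using assms unfolding carrier_affine_schur by (simp add: affine_schur_def map.rep_eq when_def)

lemma row_mult_subset:
  assumes "n \<ge> 1" "f \<in> carrier (affine_schur n r)" "g \<in> carrier (affine_schur n r)" "p \<in> tuples r"
  shows "row n r (f \<otimes>\<^bsub>affine_schur n r\<^esub> g) p \<subseteq> (\<Union>s\<in>row n r f p. row n r g s)"
proof
  fix t assume "t \<in> row n r (f \<otimes>\<^bsub>affine_schur n r\<^esub> g) p"
  then have t: "t \<in> tuples r" and "entry n r (f \<otimes>\<^bsub>affine_schur n r\<^esub> g) p t \<noteq> 0" by (auto simp: row_def)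
  then have "(\<Sum>s\<in>row n r f p. entry n r f p s * entry n r g s t) \<noteq> 0"
    using entry_schur_mult[OF assms(1-4) t finite_row[OF assms(1,4)] _ order_refl] by (auto simp: row_def)
  then obtain s where "s \<in> row n r f p" "entry n r f p s * entry n r g s t \<noteq> 0"
    by (rule sum.not_neutral_contains_not_neutral)
  then show "t \<in> (\<Union>s\<in>row n r f p. row n r g s)" using t by (auto simp: row_def)
qed

text \<open>
  All axioms are checked on entries, where they are the usual identities for matrices with rows of
  finite support.
\<close>

theorem field_algebra_affine_schur:
  assumes n: "n \<ge> 1"
  shows "field_algebra (affine_schur n r :: ('k::field, 'k schur_elem) module)"
proof -
  let ?S = "affine_schur n r :: ('k, 'k schur_elem) module"
  note closed = schur_mult_closed schur_add_closed schur_smult_closed schur_one_closed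
  have sub: "row n r f p \<subseteq> tuples r" for f :: "'k schur_elem" and p by (auto simp: row_def)
  have zero: "\<zero>\<^bsub>?S\<^esub> \<in> carrier ?S" by (simp add: affine_schur_def)
  have ab: "abelian_group ?S"
  proof (rule abelian_groupI)
    fix x assume x: "x \<in> carrier ?S"
    show "\<exists>y\<in>carrier ?S. y \<oplus>\<^bsub>?S\<^esub> x = \<zero>\<^bsub>?S\<^esub>"
      using x by (intro bexI[of _ "- x"]) (auto simp: affine_schur_def)
  qed (auto simp: zero schur_add_closed, auto simp: affine_schur_def ac_simps)
  have mon: "monoid ?S"
  proof (rule monoidI)
    fix x y z assume x: "x \<in> carrier ?S" and y: "y \<in> carrier ?S" and z: "z \<in> carrier ?S"
    show "x \<otimes>\<^bsub>?S\<^esub> y \<otimes>\<^bsub>?S\<^esub> z = x \<otimes>\<^bsub>?S\<^esub> (y \<otimes>\<^bsub>?S\<^esub> z)"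
    proof (rule schur_elem_eqI)
      fix p q assume p: "p \<in> tuples r" and q: "q \<in> tuples r"
      let ?U = "row n r x p" and ?V = "\<Union>s\<in>row n r x p. row n r y s"
      have U: "finite ?U" by (rule finite_row[OF n p])
      have V: "finite ?V" "?V \<subseteq> tuples r"
        using U finite_row[OF n] sub by (auto simp: row_def)
      have "entry n r (x \<otimes>\<^bsub>?S\<^esub> y \<otimes>\<^bsub>?S\<^esub> z) p q = (\<Sum>t\<in>?V. entry n r (x \<otimes>\<^bsub>?S\<^esub> y) p t * entry n r z t q)"
        by (intro entry_schur_mult n closed x y z p q V row_mult_subset)
      also have "\<dots> = (\<Sum>t\<in>?V. \<Sum>s\<in>?U. entry n r x p s * entry n r y s t * entry n r z t q)"
      proof (rule sum.cong[OF refl])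
        fix t assume "t \<in> ?V"
        then have t: "t \<in> tuples r" using V by blast
        show "entry n r (x \<otimes>\<^bsub>?S\<^esub> y) p t * entry n r z t q =
            (\<Sum>s\<in>?U. entry n r x p s * entry n r y s t * entry n r z t q)"
          unfolding entry_schur_mult[OF n x y p t U sub order_refl] by (simp add: sum_distrib_right)
      qed
      also have "\<dots> = (\<Sum>s\<in>?U. \<Sum>t\<in>?V. entry n r x p s * entry n r y s t * entry n r z t q)"
        by (rule sum.swap)
      also have "\<dots> = (\<Sum>s\<in>?U. entry n r x p s * entry n r (y \<otimes>\<^bsub>?S\<^esub> z) s q)"
      proof (rule sum.cong[OF refl])
        fix s assume s: "s \<in> ?U"
        then have "s \<in> tuples r" "row n r y s \<subseteq> ?V" using sub by blast+
        then show "(\<Sum>t\<in>?V. entry n r x p s * entry n r y s t * entry n r z t q) =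
            entry n r x p s * entry n r (y \<otimes>\<^bsub>?S\<^esub> z) s q"
          using entry_schur_mult[OF n y z _ q V, of s] by (simp add: sum_distrib_left mult.assoc)
      qed
      also have "\<dots> = entry n r (x \<otimes>\<^bsub>?S\<^esub> (y \<otimes>\<^bsub>?S\<^esub> z)) p q"
        by (intro entry_schur_mult[symmetric] n closed x y z p q U sub order_refl)
      finally show "entry n r (x \<otimes>\<^bsub>?S\<^esub> y \<otimes>\<^bsub>?S\<^esub> z) p q = entry n r (x \<otimes>\<^bsub>?S\<^esub> (y \<otimes>\<^bsub>?S\<^esub> z)) p q" .
    qed (intro closed x y z)+
  next
    fix x assume x: "x \<in> carrier ?S"
    show "\<one>\<^bsub>?S\<^esub> \<otimes>\<^bsub>?S\<^esub> x = x"
    proof (rule schur_elem_eqI)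
      fix p q assume p: "p \<in> tuples r" and q: "q \<in> tuples r"
      have "entry n r (\<one>\<^bsub>?S\<^esub> \<otimes>\<^bsub>?S\<^esub> x) p q = (\<Sum>s\<in>{p}. entry n r \<one>\<^bsub>?S\<^esub> p s * entry n r x s q)"
        using p by (intro entry_schur_mult n closed x q) (auto simp: row_def entry_one[OF n p] split: if_splits)
      then show "entry n r (\<one>\<^bsub>?S\<^esub> \<otimes>\<^bsub>?S\<^esub> x) p q = entry n r x p q" by (simp add: entry_one[OF n p p])
    qed (intro closed x)+
    show "x \<otimes>\<^bsub>?S\<^esub> \<one>\<^bsub>?S\<^esub> = x"
    proof (rule schur_elem_eqI)
      fix p q assume p: "p \<in> tuples r" and q: "q \<in> tuples r"
      have "entry n r (x \<otimes>\<^bsub>?S\<^esub> \<one>\<^bsub>?S\<^esub>) p q = (\<Sum>s\<in>insert q (row n r x p). entry n r x p s * entry n r \<one>\<^bsub>?S\<^esub> s q)"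
        using finite_row[OF n p] sub q by (intro entry_schur_mult n closed x p) auto
      also have "\<dots> = (\<Sum>s\<in>insert q (row n r x p). if s = q then entry n r x p q else 0)"
        using q sub by (intro sum.cong refl) (auto simp: entry_one[OF n _ q] row_def)
      finally show "entry n r (x \<otimes>\<^bsub>?S\<^esub> \<one>\<^bsub>?S\<^esub>) p q = entry n r x p q"
        using finite_row[OF n p, of x] by (simp add: sum.delta)
    qed (intro closed x)+
  qed (intro closed; assumption)+
  have l: "(x \<oplus>\<^bsub>?S\<^esub> y) \<otimes>\<^bsub>?S\<^esub> z = x \<otimes>\<^bsub>?S\<^esub> z \<oplus>\<^bsub>?S\<^esub> y \<otimes>\<^bsub>?S\<^esub> z"
    and r: "z \<otimes>\<^bsub>?S\<^esub> (x \<oplus>\<^bsub>?S\<^esub> y) = z \<otimes>\<^bsub>?S\<^esub> x \<oplus>\<^bsub>?S\<^esub> z \<otimes>\<^bsub>?S\<^esub> y"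
    if x: "x \<in> carrier ?S" and y: "y \<in> carrier ?S" and z: "z \<in> carrier ?S" for x y z
  proof -
    show "(x \<oplus>\<^bsub>?S\<^esub> y) \<otimes>\<^bsub>?S\<^esub> z = x \<otimes>\<^bsub>?S\<^esub> z \<oplus>\<^bsub>?S\<^esub> y \<otimes>\<^bsub>?S\<^esub> z"
    proof (rule schur_elem_eqI)
      fix p q assume p: "p \<in> tuples r" and q: "q \<in> tuples r"
      let ?U = "row n r x p \<union> row n r y p"
      have U: "finite ?U" "?U \<subseteq> tuples r" using finite_row[OF n p] sub by auto
      have "row n r (x \<oplus>\<^bsub>?S\<^esub> y) p \<subseteq> ?U" by (auto simp: row_def entry_add)
      then show "entry n r ((x \<oplus>\<^bsub>?S\<^esub> y) \<otimes>\<^bsub>?S\<^esub> z) p q = entry n r (x \<otimes>\<^bsub>?S\<^esub> z \<oplus>\<^bsub>?S\<^esub> y \<otimes>\<^bsub>?S\<^esub> z) p q"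
        using entry_schur_mult[OF n x z p q U] entry_schur_mult[OF n y z p q U]
          entry_schur_mult[OF n schur_add_closed[OF x y] z p q U]
        by (simp add: entry_add sum.distrib distrib_right)
    qed (intro closed x y z)+
    show "z \<otimes>\<^bsub>?S\<^esub> (x \<oplus>\<^bsub>?S\<^esub> y) = z \<otimes>\<^bsub>?S\<^esub> x \<oplus>\<^bsub>?S\<^esub> z \<otimes>\<^bsub>?S\<^esub> y"
    proof (rule schur_elem_eqI)
      fix p q assume p: "p \<in> tuples r" and q: "q \<in> tuples r"
      note e = entry_schur_mult[OF n z _ p q finite_row[OF n p] sub order_refl]
      show "entry n r (z \<otimes>\<^bsub>?S\<^esub> (x \<oplus>\<^bsub>?S\<^esub> y)) p q = entry n r (z \<otimes>\<^bsub>?S\<^esub> x \<oplus>\<^bsub>?S\<^esub> z \<otimes>\<^bsub>?S\<^esub> y) p q"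
        by (simp add: e x y schur_add_closed entry_add sum.distrib distrib_left)
    qed (intro closed x y z)+
  qed
  have "ring ?S" by (intro ring.intro ab mon ring_axioms.intro l r)
  moreover have "field_algebra_axioms ?S"
  proof
    fix c d :: 'k and x assume x: "x \<in> carrier ?S"
    show "c \<odot>\<^bsub>?S\<^esub> x \<in> carrier ?S" by (intro closed x)
    show "(c + d) \<odot>\<^bsub>?S\<^esub> x = c \<odot>\<^bsub>?S\<^esub> x \<oplus>\<^bsub>?S\<^esub> d \<odot>\<^bsub>?S\<^esub> x"
      by (rule schur_elem_eqI[of _ n r]) (simp_all add: closed x entry_add entry_smult distrib_right)
    show "(c * d) \<odot>\<^bsub>?S\<^esub> x = c \<odot>\<^bsub>?S\<^esub> (d \<odot>\<^bsub>?S\<^esub> x)"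
      by (rule schur_elem_eqI[of _ n r]) (simp_all add: closed x entry_smult mult.assoc)
    show "1 \<odot>\<^bsub>?S\<^esub> x = x"
      by (rule schur_elem_eqI[of _ n r]) (simp_all add: closed x entry_smult)
    fix y assume y: "y \<in> carrier ?S"
    show "c \<odot>\<^bsub>?S\<^esub> (x \<oplus>\<^bsub>?S\<^esub> y) = c \<odot>\<^bsub>?S\<^esub> x \<oplus>\<^bsub>?S\<^esub> c \<odot>\<^bsub>?S\<^esub> y"
      by (rule schur_elem_eqI[of _ n r]) (simp_all add: closed x y entry_add entry_smult distrib_left)
    show "(c \<odot>\<^bsub>?S\<^esub> x) \<otimes>\<^bsub>?S\<^esub> y = c \<odot>\<^bsub>?S\<^esub> (x \<otimes>\<^bsub>?S\<^esub> y)"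
    proof (rule schur_elem_eqI)
      fix p q assume p: "p \<in> tuples r" and q: "q \<in> tuples r"
      have "row n r (c \<odot>\<^bsub>?S\<^esub> x) p \<subseteq> row n r x p" by (auto simp: row_def entry_smult)
      then show "entry n r ((c \<odot>\<^bsub>?S\<^esub> x) \<otimes>\<^bsub>?S\<^esub> y) p q = entry n r (c \<odot>\<^bsub>?S\<^esub> (x \<otimes>\<^bsub>?S\<^esub> y)) p q"
        using entry_schur_mult[OF n x y p q finite_row[OF n p] sub order_refl]
          entry_schur_mult[OF n schur_smult_closed[OF x] y p q finite_row[OF n p, of x] sub]
        by (simp add: entry_smult sum_distrib_left mult.assoc)
    qed (intro closed x y)+
    show "x \<otimes>\<^bsub>?S\<^esub> (c \<odot>\<^bsub>?S\<^esub> y) = c \<odot>\<^bsub>?S\<^esub> (x \<otimes>\<^bsub>?S\<^esub> y)"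
    proof (rule schur_elem_eqI)
      fix p q assume p: "p \<in> tuples r" and q: "q \<in> tuples r"
      note e = entry_schur_mult[OF n x _ p q finite_row[OF n p] sub order_refl]
      show "entry n r (x \<otimes>\<^bsub>?S\<^esub> (c \<odot>\<^bsub>?S\<^esub> y)) p q = entry n r (c \<odot>\<^bsub>?S\<^esub> (x \<otimes>\<^bsub>?S\<^esub> y)) p q"
        by (simp add: e y schur_smult_closed entry_smult sum_distrib_left mult.left_commute)
    qed (intro closed x y)+
  qed
  ultimately show ?thesis by (rule field_algebra.intro)
qed

section \<open>Matrices from equivariant embeddings\<close>

text \<open>
  An injective map \<open>x \<mapsto> (\<rho> x, c x)\<close> from the tuples with shifts by \<open>m\<close> to the product of the tuples
  with shifts by \<open>n\<close> and a finite set \<open>I\<close> with trivial action. The group is the same on both sides;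
  only its action depends on the modulus.
\<close>

locale equivariant_embedding =
  fixes m n r :: nat and \<rho> :: "tuple \<Rightarrow> tuple" and c :: "tuple \<Rightarrow> 'i" and I :: "'i set"
  assumes m_pos: "m \<ge> 1" and n_pos: "n \<ge> 1" and finite_I: "finite I"
    and \<rho>_tuples: "x \<in> tuples r \<Longrightarrow> \<rho> x \<in> tuples r"
    and c_index: "x \<in> tuples r \<Longrightarrow> c x \<in> I"
    and \<rho>_act: "x \<in> tuples r \<Longrightarrow> w \<in> affine_weyl r \<Longrightarrow> \<rho> (weyl_act m r x w) = weyl_act n r (\<rho> x) w"
    and c_act: "x \<in> tuples r \<Longrightarrow> w \<in> affine_weyl r \<Longrightarrow> c (weyl_act m r x w) = c x"
    and inj: "x \<in> tuples r \<Longrightarrow> y \<in> tuples r \<Longrightarrow> \<rho> x = \<rho> y \<Longrightarrow> c x = c y \<Longrightarrow> x = y"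
begin

definition fibre :: "'i \<Rightarrow> tuple set" where
  "fibre i = {x \<in> tuples r. c x = i}"

text \<open>
  The matrix of \<open>f\<close> moved along the embedding and extended by zero: on the fibre over \<open>i\<close> the map \<open>\<rho>\<close> is
  injective, so that \<open>y\<close> and \<open>y'\<close> in the images have unique preimages in the fibres over \<open>i\<close> and \<open>j\<close>.
\<close>

definition block_entries :: "('k::field) schur_elem \<Rightarrow> 'i \<Rightarrow> 'i \<Rightarrow> tuple \<Rightarrow> tuple \<Rightarrow> 'k" where
  "block_entries f i j y y' = (if y \<in> \<rho> ` fibre i \<and> y' \<in> \<rho> ` fibre j
     then entry m r f (inv_into (fibre i) \<rho> y) (inv_into (fibre j) \<rho> y') else 0)"

definition block :: "('k::field) schur_elem \<Rightarrow> 'i \<Rightarrow> 'i \<Rightarrow> 'k schur_elem" where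
  "block f i j = of_entries n r (block_entries f i j)"

lemma inj_fibre: "inj_on \<rho> (fibre i)"
  by (rule inj_onI) (auto simp: fibre_def intro: inj)

lemma block_entries_image:
  "x \<in> fibre i \<Longrightarrow> x' \<in> fibre j \<Longrightarrow> block_entries f i j (\<rho> x) (\<rho> x') = entry m r f x x'"
  by (simp add: block_entries_def inj_fibre)

lemma fibre_act: "x \<in> fibre i \<Longrightarrow> w \<in> affine_weyl r \<Longrightarrow> weyl_act m r x w \<in> fibre i"
  by (simp add: fibre_def c_act weyl_act_tuples)

lemma image_fibre_act:
  assumes "y \<in> tuples r" "w \<in> affine_weyl r"
  shows "weyl_act n r y w \<in> \<rho> ` fibre i \<longleftrightarrow> y \<in> \<rho> ` fibre i"
proof
  assume "y \<in> \<rho> ` fibre i"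
  then obtain x where x: "x \<in> fibre i" "y = \<rho> x" by blast
  then have "weyl_act n r y w = \<rho> (weyl_act m r x w)"
    using assms(2) by (simp add: \<rho>_act fibre_def)
  then show "weyl_act n r y w \<in> \<rho> ` fibre i" using fibre_act[OF x(1) assms(2)] by blast
next
  assume "weyl_act n r y w \<in> \<rho> ` fibre i"
  then obtain x where x: "x \<in> fibre i" "weyl_act n r y w = \<rho> x" by blast
  have "y = weyl_act n r (weyl_act n r y w) (weyl_inv r w)"
    by (simp add: weyl_inv(2)[OF assms(2) assms(1)])
  also have "\<dots> = \<rho> (weyl_act m r x (weyl_inv r w))"
    using x weyl_inv(1)[OF assms(2)] by (simp add: \<rho>_act fibre_def)
  finally show "y \<in> \<rho> ` fibre i" using fibre_act[OF x(1) weyl_inv(1)[OF assms(2)]] by blast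
qed

lemma equivariant_block_entries: "equivariant_matrix n r (block_entries f i j)"
  unfolding equivariant_matrix_def
proof (intro conjI ballI)
  fix y y' w assume y: "y \<in> tuples r" and y': "y' \<in> tuples r" and w: "w \<in> affine_weyl r"
  show "block_entries f i j (weyl_act n r y w) (weyl_act n r y' w) = block_entries f i j y y'"
  proof (cases "y \<in> \<rho> ` fibre i \<and> y' \<in> \<rho> ` fibre j")
    case True
    then obtain x x' where x: "x \<in> fibre i" "y = \<rho> x" and x': "x' \<in> fibre j" "y' = \<rho> x'" by blast
    have t: "x \<in> tuples r" "x' \<in> tuples r" using x(1) x'(1) by (simp_all add: fibre_def)
    show ?thesis
      unfolding x(2) x'(2) \<rho>_act[OF t(1) w, symmetric] \<rho>_act[OF t(2) w, symmetric]
      by (simp add: block_entries_image x(1) x'(1) fibre_act w entry_act t)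
  next
    case False
    then have "\<not> (weyl_act n r y w \<in> \<rho> ` fibre i \<and> weyl_act n r y' w \<in> \<rho> ` fibre j)"
      unfolding image_fibre_act[OF y w] image_fibre_act[OF y' w] .
    with False show ?thesis by (simp only: block_entries_def if_False)
  qed
next
  fix y assume "y \<in> tuples r"
  show "finite {y' \<in> tuples r. block_entries f i j y y' \<noteq> 0}"
  proof (cases "y \<in> \<rho> ` fibre i")
    case True
    then obtain x where x: "x \<in> fibre i" "y = \<rho> x" by blast
    have "{y' \<in> tuples r. block_entries f i j y y' \<noteq> 0} \<subseteq> \<rho> ` row m r f x"
    proof
      fix y' assume y': "y' \<in> {y' \<in> tuples r. block_entries f i j y y' \<noteq> 0}"
      then obtain x' where x': "x' \<in> fibre j" "y' = \<rho> x'" by (auto simp: block_entries_def split: if_splits)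
      then have "entry m r f x x' \<noteq> 0" using y' x block_entries_image[OF x(1) x'(1), of f] by simp
      then show "y' \<in> \<rho> ` row m r f x" using x' by (auto simp: row_def fibre_def)
    qed
    moreover have "finite (row m r f x)" by (rule finite_row[OF m_pos]) (use x(1) in \<open>simp add: fibre_def\<close>)
    ultimately show ?thesis using finite_surj by blast
  next
    case False
    then show ?thesis by (simp add: block_entries_def)
  qed
qed

lemma block_closed: "block f i j \<in> carrier (affine_schur n r)"
  unfolding block_def by (rule of_entries(1)[OF n_pos equivariant_block_entries])

lemma entry_block:
  "y \<in> tuples r \<Longrightarrow> y' \<in> tuples r \<Longrightarrow> entry n r (block f i j) y y' = block_entries f i j y y'"
  unfolding block_def by (rule of_entries(2)[OF n_pos equivariant_block_entries])

lemma entry_block_image: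
  assumes "x \<in> fibre i" "x' \<in> fibre j"
  shows "entry n r (block f i j) (\<rho> x) (\<rho> x') = entry m r f x x'"
  using assms by (subst entry_block) (auto simp: block_entries_image \<rho>_tuples fibre_def)

lemma entry_block_outside:
  assumes "y \<in> tuples r" "y' \<in> tuples r" "y \<notin> \<rho> ` fibre i \<or> y' \<notin> \<rho> ` fibre j"
  shows "entry n r (block f i j) y y' = 0"
  unfolding entry_block[OF assms(1,2)] block_entries_def by (rule if_not_P) (use assms(3) in blast)

lemma fibre_tuples: "x \<in> fibre i \<Longrightarrow> x \<in> tuples r"
  by (simp add: fibre_def)

end

lemma entry_finsum:
  fixes f :: "'i \<Rightarrow> 'k::field schur_elem"
  assumes n: "n \<ge> 1" and "finite I" "\<And>i. i \<in> I \<Longrightarrow> f i \<in> carrier (affine_schur n r)"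
  shows "entry n r (\<Oplus>\<^bsub>affine_schur n r\<^esub>i\<in>I. f i) p q = (\<Sum>i\<in>I. entry n r (f i) p q)"
proof -
  interpret S: field_algebra "affine_schur n r :: ('k, 'k schur_elem) module"
    by (rule field_algebra_affine_schur[OF n])
  show ?thesis
    using assms(2,3)
  proof (induction I rule: finite_induct)
    case (insert i I)
    then have "f i \<in> carrier (affine_schur n r)" "f \<in> I \<rightarrow> carrier (affine_schur n r)" by blast+
    then have "(\<Oplus>\<^bsub>affine_schur n r\<^esub>i\<in>insert i I. f i) =
        f i \<oplus>\<^bsub>affine_schur n r\<^esub> (\<Oplus>\<^bsub>affine_schur n r\<^esub>i\<in>I. f i)"
      using insert.hyps by (intro S.finsum_insert)
    then show ?case using insert by (simp add: entry_add)
  qed (simp add: entry_zero)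
qed

text \<open>
  For multiplicativity, the middle index of the product of blocks runs over pairs \<open>(\<rho> s, c s)\<close>, which
  by injectivity correspond to the middle index \<open>s\<close> of the original product.
\<close>

theorem (in equivariant_embedding) matrix_hom_block:
  "matrix_hom (affine_schur m r :: ('k::field, 'k schur_elem) module) (affine_schur n r) I block"
proof -
  let ?A = "affine_schur m r :: ('k, 'k schur_elem) module"
  let ?B = "affine_schur n r :: ('k, 'k schur_elem) module"
  interpret A: field_algebra ?A by (rule field_algebra_affine_schur[OF m_pos])
  interpret B: field_algebra ?B by (rule field_algebra_affine_schur[OF n_pos])
  have eqI: "block f i j = g"
    if g: "g \<in> carrier ?B"
      and in_image: "\<And>x x'. x \<in> fibre i \<Longrightarrow> x' \<in> fibre j \<Longrightarrow> entry n r g (\<rho> x) (\<rho> x') = entry m r f x x'"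
      and outside: "\<And>y y'. y \<in> tuples r \<Longrightarrow> y' \<in> tuples r \<Longrightarrow>
        y \<notin> \<rho> ` fibre i \<or> y' \<notin> \<rho> ` fibre j \<Longrightarrow> entry n r g y y' = 0" for f g i j
  proof (rule schur_elem_eqI[OF block_closed g])
    fix y y' assume y: "y \<in> tuples r" "y' \<in> tuples r"
    show "entry n r (block f i j) y y' = entry n r g y y'"
    proof (cases "y \<in> \<rho> ` fibre i \<and> y' \<in> \<rho> ` fibre j")
      case True
      then obtain x x' where "x \<in> fibre i" "y = \<rho> x" "x' \<in> fibre j" "y' = \<rho> x'" by blast
      then show ?thesis by (simp add: entry_block_image in_image)
    next
      case False
      then show ?thesis using y entry_block_outside[OF y] outside[OF y] by auto
    qed
  qed
  show ?thesis
  proof (intro matrix_hom.intro matrix_hom_axioms.intro A.field_algebra_axioms B.field_algebra_axioms)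
    show "finite I" by (rule finite_I)
    fix f g :: "'k schur_elem" and i j assume f: "f \<in> carrier ?A" and ij: "i \<in> I" "j \<in> I"
    show "block f i j \<in> carrier ?B" by (rule block_closed)
    show "block (k \<odot>\<^bsub>?A\<^esub> f) i j = k \<odot>\<^bsub>?B\<^esub> block f i j" for k
      by (rule eqI) (auto simp: schur_smult_closed block_closed entry_smult entry_block_image entry_block_outside)
    assume g: "g \<in> carrier ?A"
    show "block (f \<oplus>\<^bsub>?A\<^esub> g) i j = block f i j \<oplus>\<^bsub>?B\<^esub> block g i j"
      by (rule eqI) (auto simp: schur_add_closed block_closed entry_add entry_block_image entry_block_outside)
    have bb: "block f i k \<otimes>\<^bsub>?B\<^esub> block g k j \<in> carrier ?B" for k
      by (intro schur_mult_closed block_closed)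
    show "block (f \<otimes>\<^bsub>?A\<^esub> g) i j = (\<Oplus>\<^bsub>?B\<^esub>k\<in>I. block f i k \<otimes>\<^bsub>?B\<^esub> block g k j)"
    proof (rule eqI)
      show "(\<Oplus>\<^bsub>?B\<^esub>k\<in>I. block f i k \<otimes>\<^bsub>?B\<^esub> block g k j) \<in> carrier ?B"
        by (intro B.finsum_closed funcsetI bb)
    next
      fix x x' assume x: "x \<in> fibre i" and x': "x' \<in> fibre j"
      note t = fibre_tuples[OF x] fibre_tuples[OF x']
      let ?S = "row m r f x"
      have fin: "finite ?S" and sub: "?S \<subseteq> tuples r"
        using finite_row[OF m_pos t(1)] by (auto simp: row_def)
      have "entry n r (block f i k \<otimes>\<^bsub>?B\<^esub> block g k j) (\<rho> x) (\<rho> x') =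
          (\<Sum>s\<in>{s \<in> ?S. c s = k}. entry m r f x s * entry m r g s x')" for k
      proof -
        have Sk: "{s \<in> ?S. c s = k} \<subseteq> fibre k" using sub by (auto simp: fibre_def)
        have rs: "row n r (block f i k) (\<rho> x) \<subseteq> \<rho> ` {s \<in> ?S. c s = k}"
        proof
          fix y assume "y \<in> row n r (block f i k) (\<rho> x)"
          then have y: "y \<in> tuples r" "entry n r (block f i k) (\<rho> x) y \<noteq> 0" by (auto simp: row_def)
          then obtain s where s: "s \<in> fibre k" "y = \<rho> s"
            using entry_block_outside[OF \<rho>_tuples[OF t(1)] y(1)] by blast
          then show "y \<in> \<rho> ` {s \<in> ?S. c s = k}"
            using y(2) entry_block_image[OF x s(1), of f] by (auto simp: row_def fibre_def)
        qed
        have "entry n r (block f i k \<otimes>\<^bsub>?B\<^esub> block g k j) (\<rho> x) (\<rho> x') =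
            (\<Sum>y\<in>\<rho> ` {s \<in> ?S. c s = k}. entry n r (block f i k) (\<rho> x) y * entry n r (block g k j) y (\<rho> x'))"
          using fin sub rs
          by (intro entry_schur_mult n_pos block_closed \<rho>_tuples t) (auto intro: \<rho>_tuples)
        also have "\<dots> = (\<Sum>s\<in>{s \<in> ?S. c s = k}.
            entry n r (block f i k) (\<rho> x) (\<rho> s) * entry n r (block g k j) (\<rho> s) (\<rho> x'))"
          by (subst sum.reindex[OF inj_on_subset[OF inj_fibre Sk]]) simp
        also have "\<dots> = (\<Sum>s\<in>{s \<in> ?S. c s = k}. entry m r f x s * entry m r g s x')"
          using Sk by (intro sum.cong refl) (simp add: entry_block_image[OF x subsetD[OF Sk]]
            entry_block_image[OF subsetD[OF Sk] x'])
        finally show ?thesis .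
      qed
      then have "entry n r (\<Oplus>\<^bsub>?B\<^esub>k\<in>I. block f i k \<otimes>\<^bsub>?B\<^esub> block g k j) (\<rho> x) (\<rho> x') =
          (\<Sum>k\<in>I. \<Sum>s\<in>{s \<in> ?S. c s = k}. entry m r f x s * entry m r g s x')"
        by (simp add: entry_finsum[OF n_pos finite_I bb])
      also have "\<dots> = (\<Sum>s\<in>?S. entry m r f x s * entry m r g s x')"
        using sub c_index by (intro sum.group fin finite_I) blast
      also have "\<dots> = entry m r (f \<otimes>\<^bsub>?A\<^esub> g) x x'"
        by (rule entry_schur_mult[OF m_pos f g t fin sub order_refl, symmetric])
      finally show "entry n r (\<Oplus>\<^bsub>?B\<^esub>k\<in>I. block f i k \<otimes>\<^bsub>?B\<^esub> block g k j) (\<rho> x) (\<rho> x') =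
        entry m r (f \<otimes>\<^bsub>?A\<^esub> g) x x'" .
    next
      fix y y' assume y: "y \<in> tuples r" and y': "y' \<in> tuples r"
        and out: "y \<notin> \<rho> ` fibre i \<or> y' \<notin> \<rho> ` fibre j"
      have "entry n r (block f i k \<otimes>\<^bsub>?B\<^esub> block g k j) y y' = 0" for k
      proof -
        have sub: "row n r (block f i k) y \<subseteq> tuples r" by (auto simp: row_def)
        have "entry n r (block f i k) y s * entry n r (block g k j) s y' = 0" if "s \<in> tuples r" for s
        proof (cases "y \<in> \<rho> ` fibre i")
          case True
          then have "entry n r (block g k j) s y' = 0"
            using out by (intro entry_block_outside[OF that y']) blast
          then show ?thesis by simp
        next
          case False
          then have "entry n r (block f i k) y s = 0"
            by (intro entry_block_outside[OF y that]) blast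
          then show ?thesis by simp
        qed
        then show ?thesis
          using sub by (subst entry_schur_mult[OF n_pos block_closed block_closed y y' finite_row[OF n_pos y] sub order_refl])
            (auto intro!: sum.neutral)
      qed
      then show "entry n r (\<Oplus>\<^bsub>?B\<^esub>k\<in>I. block f i k \<otimes>\<^bsub>?B\<^esub> block g k j) y y' = 0"
        by (simp add: entry_finsum[OF n_pos finite_I bb])
    qed
  qed
qed

lemma equivariant_embedding_comp:
  assumes "equivariant_embedding m n r \<rho> c I" "equivariant_embedding n l r \<sigma> d J"
  shows "equivariant_embedding m l r (\<lambda>x. \<sigma> (\<rho> x)) (\<lambda>x. (c x, d (\<rho> x))) (I \<times> J)"
proof -
  interpret R: equivariant_embedding m n r \<rho> c I by fact
  interpret S: equivariant_embedding n l r \<sigma> d J by fact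
  show ?thesis
  proof
    show "m \<ge> 1" by (rule R.m_pos)
    show "l \<ge> 1" by (rule S.n_pos)
    fix x y assume x: "x \<in> tuples r" and y: "y \<in> tuples r"
      and eq: "\<sigma> (\<rho> x) = \<sigma> (\<rho> y)" "(c x, d (\<rho> x)) = (c y, d (\<rho> y))"
    have "\<rho> x = \<rho> y" using S.inj[OF R.\<rho>_tuples[OF x] R.\<rho>_tuples[OF y]] eq by simp
    then show "x = y" using R.inj[OF x y] eq by simp
  qed (simp_all add: R.finite_I S.finite_I R.\<rho>_tuples S.\<rho>_tuples R.c_index S.c_index
      R.\<rho>_act S.\<rho>_act R.c_act S.c_act)
qed

lemma block_comp:
  fixes f :: "'k::field schur_elem"
  assumes "equivariant_embedding m n r \<rho> c I" "equivariant_embedding n l r \<sigma> d J"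
  shows "equivariant_embedding.block n l r \<sigma> d (equivariant_embedding.block m n r \<rho> c f i j) k h =
    equivariant_embedding.block m l r (\<lambda>x. \<sigma> (\<rho> x)) (\<lambda>x. (c x, d (\<rho> x))) f (i, k) (j, h)"
proof -
  interpret R: equivariant_embedding m n r \<rho> c I by fact
  interpret S: equivariant_embedding n l r \<sigma> d J by fact
  interpret C: equivariant_embedding m l r "\<lambda>x. \<sigma> (\<rho> x)" "\<lambda>x. (c x, d (\<rho> x))" "I \<times> J"
    by (rule equivariant_embedding_comp[OF assms])
  have fibre: "x \<in> C.fibre (i, k) \<longleftrightarrow> x \<in> R.fibre i \<and> \<rho> x \<in> S.fibre k" for x i k
    by (auto simp: C.fibre_def R.fibre_def S.fibre_def R.\<rho>_tuples)
  show ?thesis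
  proof (rule schur_elem_eqI[OF S.block_closed C.block_closed])
    fix z z' assume z: "z \<in> tuples r" and z': "z' \<in> tuples r"
    show "entry l r (S.block (R.block f i j) k h) z z' = entry l r (C.block f (i, k) (j, h)) z z'"
    proof (cases "z \<in> \<sigma> ` S.fibre k \<and> z' \<in> \<sigma> ` S.fibre h")
      case True
      then obtain y y' where y: "y \<in> S.fibre k" "z = \<sigma> y" and y': "y' \<in> S.fibre h" "z' = \<sigma> y'" by blast
      note t = S.fibre_tuples[OF y(1)] S.fibre_tuples[OF y'(1)]
      have l: "entry l r (S.block (R.block f i j) k h) z z' = entry n r (R.block f i j) y y'"
        unfolding y(2) y'(2) by (rule S.entry_block_image[OF y(1) y'(1)])
      have im: "\<sigma> y \<in> (\<lambda>x. \<sigma> (\<rho> x)) ` C.fibre (i, k) \<Longrightarrow> y \<in> \<rho> ` R.fibre i" if "y \<in> S.fibre k" for y i k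
      proof -
        assume "\<sigma> y \<in> (\<lambda>x. \<sigma> (\<rho> x)) ` C.fibre (i, k)"
        then obtain x where x: "\<sigma> y = \<sigma> (\<rho> x)" "x \<in> C.fibre (i, k)" by (rule imageE)
        then have x': "x \<in> R.fibre i" "\<rho> x \<in> S.fibre k" using fibre by blast+
        have "y = \<rho> x" by (rule inj_onD[OF S.inj_fibre x(1) that x'(2)])
        then show "y \<in> \<rho> ` R.fibre i" using x'(1) by blast
      qed
      show ?thesis
      proof (cases "y \<in> \<rho> ` R.fibre i \<and> y' \<in> \<rho> ` R.fibre j")
        case True
        then obtain x x' where x: "x \<in> R.fibre i" "y = \<rho> x" and x': "x' \<in> R.fibre j" "y' = \<rho> x'" by blast
        have "x \<in> C.fibre (i, k)" "x' \<in> C.fibre (j, h)" using x x' y y' by (simp_all add: fibre)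
        then show ?thesis
          unfolding l unfolding x(2) x'(2) y(2) y'(2)
          using R.entry_block_image[OF x(1) x'(1), of f] C.entry_block_image[of x "(i, k)" x' "(j, h)" f] by simp
      next
        case False
        then have "z \<notin> (\<lambda>x. \<sigma> (\<rho> x)) ` C.fibre (i, k) \<or> z' \<notin> (\<lambda>x. \<sigma> (\<rho> x)) ` C.fibre (j, h)"
          unfolding y(2) y'(2) using im[OF y(1), of i] im[OF y'(1), of j] by blast
        then show ?thesis
          using l R.entry_block_outside[OF t, of i j f] False C.entry_block_outside[OF z z', of "(i, k)" "(j, h)" f] by simp
      qed
    next
      case False
      then have "z \<notin> (\<lambda>x. \<sigma> (\<rho> x)) ` C.fibre (i, k) \<or> z' \<notin> (\<lambda>x. \<sigma> (\<rho> x)) ` C.fibre (j, h)"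
        using fibre by blast
      then show ?thesis
        using S.entry_block_outside[OF z z', of k h] False C.entry_block_outside[OF z z', of "(i, k)" "(j, h)" f] by simp
    qed
  qed
qed

text \<open>
  For an embedding \<open>x \<mapsto> (\<kappa> x, c x)\<close> of the tuples into copies of themselves, \<open>u p\<close> is the matrix of the
  partial injection \<open>\<kappa>\<close> on the fibre over \<open>p\<close>, and \<open>v p\<close> is its transpose. Equivariance of the embedding
  makes both into elements of the algebra. The product \<open>u p v p\<close> is the projection to the fibre over
  \<open>p\<close>, and the fibres partition the tuples.
\<close>

theorem block_self_embedding:
  assumes "equivariant_embedding m m r \<kappa> c I"
  obtains u v :: "'i \<Rightarrow> 'k::field schur_elem" where
    "\<And>p. u p \<in> carrier (affine_schur m r)" "\<And>p. v p \<in> carrier (affine_schur m r)"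
    "(\<Oplus>\<^bsub>affine_schur m r\<^esub>p\<in>I. u p \<otimes>\<^bsub>affine_schur m r\<^esub> v p) = \<one>\<^bsub>affine_schur m r\<^esub>"
    "\<And>f p q. f \<in> carrier (affine_schur m r) \<Longrightarrow>
      equivariant_embedding.block m m r \<kappa> c f p q =
        v p \<otimes>\<^bsub>affine_schur m r\<^esub> f \<otimes>\<^bsub>affine_schur m r\<^esub> u q"
proof -
  interpret E: equivariant_embedding m m r \<kappa> c I by fact
  let ?S = "affine_schur m r :: ('k, 'k schur_elem) module"
  interpret S: field_algebra ?S by (rule field_algebra_affine_schur[OF E.m_pos])
  define U :: "'i \<Rightarrow> tuple \<Rightarrow> tuple \<Rightarrow> 'k" where "U p x z = (if c x = p \<and> z = \<kappa> x then 1 else 0)" for p x z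
  define V :: "'i \<Rightarrow> tuple \<Rightarrow> tuple \<Rightarrow> 'k" where "V p z x = U p x z" for p z x
  define u where "u p = of_entries m r (U p)" for p
  define v where "v p = of_entries m r (V p)" for p
  have inv: "U p (weyl_act m r x w) (weyl_act m r z w) = U p x z"
    if x: "x \<in> tuples r" and z: "z \<in> tuples r" and w: "w \<in> affine_weyl r" for p x z w
  proof -
    have "weyl_act m r z w = weyl_act m r (\<kappa> x) w \<longleftrightarrow> z = \<kappa> x"
      using weyl_inv(2)[OF w z, of m] weyl_inv(2)[OF w E.\<rho>_tuples[OF x], of m] by metis
    then show ?thesis by (simp add: U_def E.c_act[OF x w] E.\<rho>_act[OF x w])
  qed
  have eU: "equivariant_matrix m r (U p)" for p
    unfolding equivariant_matrix_def
  proof (intro conjI ballI inv)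
    fix x show "finite {z \<in> tuples r. U p x z \<noteq> 0}"
      by (rule finite_subset[of _ "{\<kappa> x}"]) (auto simp: U_def)
  qed
  have eV: "equivariant_matrix m r (V p)" for p
    unfolding equivariant_matrix_def V_def
  proof (intro conjI ballI inv)
    fix z
    have "{x \<in> tuples r. U p x z \<noteq> 0} \<subseteq> {x \<in> E.fibre p. \<kappa> x = z}" by (auto simp: U_def E.fibre_def)
    moreover have "finite {x \<in> E.fibre p. \<kappa> x = z}"
    proof (rule finite_imageD)
      show "finite (\<kappa> ` {x \<in> E.fibre p. \<kappa> x = z})" by (rule finite_subset[of _ "{z}"]) auto
      show "inj_on \<kappa> {x \<in> E.fibre p. \<kappa> x = z}" by (rule inj_on_subset[OF E.inj_fibre]) blast
    qed
    ultimately show "finite {x \<in> tuples r. U p x z \<noteq> 0}" by (rule finite_subset)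
  qed
  have uc: "u p \<in> carrier ?S" and vc: "v p \<in> carrier ?S" for p
    unfolding u_def v_def by (rule of_entries(1)[OF E.m_pos eU], rule of_entries(1)[OF E.m_pos eV])
  have eu: "entry m r (u p) x z = U p x z" and ev: "entry m r (v p) z x = U p x z"
    if "x \<in> tuples r" "z \<in> tuples r" for p x z
    using that of_entries(2)[OF E.m_pos eU] of_entries(2)[OF E.m_pos eV] by (simp_all add: u_def v_def V_def)
  have one: "(\<Oplus>\<^bsub>?S\<^esub>p\<in>I. u p \<otimes>\<^bsub>?S\<^esub> v p) = \<one>\<^bsub>?S\<^esub>"
  proof (rule schur_elem_eqI[OF _ schur_one_closed])
    show "(\<Oplus>\<^bsub>?S\<^esub>p\<in>I. u p \<otimes>\<^bsub>?S\<^esub> v p) \<in> carrier ?S"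
      by (intro S.finsum_closed funcsetI schur_mult_closed uc vc)
    fix x x' assume x: "x \<in> tuples r" and x': "x' \<in> tuples r"
    have "entry m r (u p \<otimes>\<^bsub>?S\<^esub> v p) x x' = (if c x = p then if x = x' then 1 else 0 else 0)" for p
    proof -
      have "row m r (u p) x \<subseteq> {\<kappa> x}" by (auto simp: row_def eu x U_def split: if_splits)
      then have "entry m r (u p \<otimes>\<^bsub>?S\<^esub> v p) x x' = (\<Sum>z\<in>{\<kappa> x}. entry m r (u p) x z * entry m r (v p) z x')"
        using E.\<rho>_tuples[OF x] by (intro entry_schur_mult E.m_pos uc vc x x') auto
      then show ?thesis
        using E.\<rho>_tuples[OF x] E.inj[OF x x'] by (auto simp: eu ev x x' U_def)
    qed
    then have "entry m r (\<Oplus>\<^bsub>?S\<^esub>p\<in>I. u p \<otimes>\<^bsub>?S\<^esub> v p) x x' = (\<Sum>p\<in>I. if c x = p then if x = x' then 1 else 0 else 0)"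
      by (simp add: entry_finsum[OF E.m_pos E.finite_I schur_mult_closed[OF uc vc]])
    also have "\<dots> = entry m r \<one>\<^bsub>?S\<^esub> x x'"
      using E.c_index[OF x] E.finite_I by (simp add: entry_one[OF E.m_pos x x'])
    finally show "entry m r (\<Oplus>\<^bsub>?S\<^esub>p\<in>I. u p \<otimes>\<^bsub>?S\<^esub> v p) x x' = entry m r \<one>\<^bsub>?S\<^esub> x x'" .
  qed
  have vfu: "E.block f p q = v p \<otimes>\<^bsub>?S\<^esub> f \<otimes>\<^bsub>?S\<^esub> u q" if f: "f \<in> carrier ?S" for f p q
  proof (rule schur_elem_eqI[OF E.block_closed])
    note vf = schur_mult_closed[OF vc f, of p]
    show "v p \<otimes>\<^bsub>?S\<^esub> f \<otimes>\<^bsub>?S\<^esub> u q \<in> carrier ?S" by (intro schur_mult_closed vf uc)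
    have vf_in: "entry m r (v p \<otimes>\<^bsub>?S\<^esub> f) (\<kappa> x) s = entry m r f x s"
      if x: "x \<in> E.fibre p" and s: "s \<in> tuples r" for x s
    proof -
      note xt = E.fibre_tuples[OF x]
      have "row m r (v p) (\<kappa> x) \<subseteq> {x}"
        using x E.inj[OF _ xt] by (auto simp: row_def ev E.\<rho>_tuples[OF xt] U_def E.fibre_def split: if_splits)
      then have "entry m r (v p \<otimes>\<^bsub>?S\<^esub> f) (\<kappa> x) s = (\<Sum>z\<in>{x}. entry m r (v p) (\<kappa> x) z * entry m r f z s)"
        using xt by (intro entry_schur_mult E.m_pos vc f E.\<rho>_tuples s) auto
      then show ?thesis using x by (simp add: ev xt E.\<rho>_tuples U_def E.fibre_def)
    qed
    have vf_out: "entry m r (v p \<otimes>\<^bsub>?S\<^esub> f) z s = 0"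
      if z: "z \<in> tuples r" "z \<notin> \<kappa> ` E.fibre p" and s: "s \<in> tuples r" for z s
    proof -
      have "row m r (v p) z \<subseteq> {}"
        using z by (auto simp: row_def ev U_def E.fibre_def split: if_splits)
      then have "entry m r (v p \<otimes>\<^bsub>?S\<^esub> f) z s = (\<Sum>t\<in>{}. entry m r (v p) z t * entry m r f t s)"
        by (intro entry_schur_mult E.m_pos vc f z s) auto
      then show ?thesis by simp
    qed
    fix z z' assume z: "z \<in> tuples r" and z': "z' \<in> tuples r"
    let ?R = "row m r (v p \<otimes>\<^bsub>?S\<^esub> f) z"
    have fin: "finite ?R" and sub: "?R \<subseteq> tuples r" using finite_row[OF E.m_pos z] by (auto simp: row_def)
    show "entry m r (E.block f p q) z z' = entry m r (v p \<otimes>\<^bsub>?S\<^esub> f \<otimes>\<^bsub>?S\<^esub> u q) z z'"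
    proof (cases "z' \<in> \<kappa> ` E.fibre q")
      case True
      then obtain x' where x': "x' \<in> E.fibre q" "z' = \<kappa> x'" by blast
      note xt' = E.fibre_tuples[OF x'(1)]
      have "entry m r (v p \<otimes>\<^bsub>?S\<^esub> f \<otimes>\<^bsub>?S\<^esub> u q) z z' =
          (\<Sum>s\<in>insert x' ?R. entry m r (v p \<otimes>\<^bsub>?S\<^esub> f) z s * entry m r (u q) s z')"
        using fin sub xt' by (intro entry_schur_mult E.m_pos vf uc z z') auto
      also have "\<dots> = (\<Sum>s\<in>insert x' ?R. if s = x' then entry m r (v p \<otimes>\<^bsub>?S\<^esub> f) z x' else 0)"
      proof (rule sum.cong[OF refl])
        fix s assume "s \<in> insert x' ?R"
        then have s: "s \<in> tuples r" using sub xt' by blast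
        have "entry m r (u q) s z' = (if s = x' then 1 else 0)"
          unfolding eu[OF s z'] using x' E.inj[OF s xt'] by (auto simp: U_def E.fibre_def)
        then show "entry m r (v p \<otimes>\<^bsub>?S\<^esub> f) z s * entry m r (u q) s z' =
            (if s = x' then entry m r (v p \<otimes>\<^bsub>?S\<^esub> f) z x' else 0)" by simp
      qed
      also have "\<dots> = entry m r (v p \<otimes>\<^bsub>?S\<^esub> f) z x'" using fin by simp
      also have "\<dots> = entry m r (E.block f p q) z z'"
      proof (cases "z \<in> \<kappa> ` E.fibre p")
        case True
        then obtain x where x: "x \<in> E.fibre p" "z = \<kappa> x" by blast
        show ?thesis unfolding x(2) x'(2) vf_in[OF x(1) xt'] E.entry_block_image[OF x(1) x'(1)] ..
      next
        case False
        then show ?thesis using vf_out[OF z False xt'] E.entry_block_outside[OF z z' disjI1[OF False], where f = f and j = q] by simp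
      qed
      finally show ?thesis ..
    next
      case False
      have "entry m r (v p \<otimes>\<^bsub>?S\<^esub> f \<otimes>\<^bsub>?S\<^esub> u q) z z' =
          (\<Sum>s\<in>?R. entry m r (v p \<otimes>\<^bsub>?S\<^esub> f) z s * entry m r (u q) s z')"
        by (rule entry_schur_mult[OF E.m_pos vf uc z z' fin sub order_refl])
      also have "\<dots> = 0"
      proof (intro sum.neutral ballI)
        fix s assume "s \<in> ?R"
        then have "s \<in> tuples r" using sub by blast
        then show "entry m r (v p \<otimes>\<^bsub>?S\<^esub> f) z s * entry m r (u q) s z' = 0"
          using False by (auto simp: eu z' U_def E.fibre_def)
      qed
      finally show ?thesis using E.entry_block_outside[OF z z' disjI2[OF False], where f = f and i = p] by simp
    qed
  qed
  show ?thesis by (rule that[OF uc vc one vfu])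
qed

theorem morita_equivalent_embeddings:
  fixes m n r :: nat
  assumes "infinite (UNIV :: 'k::field set)"
    and e: "equivariant_embedding m n r \<rho> c I" and e': "equivariant_embedding n m r \<sigma> d J"
  shows "morita_equivalent TYPE('u)
    (affine_schur m r :: ('k, 'k schur_elem) module) (affine_schur n r :: ('k, 'k schur_elem) module)"
proof -
  interpret R: equivariant_embedding m n r \<rho> c I by (rule e)
  interpret S: equivariant_embedding n m r \<sigma> d J by (rule e')
  let ?A = "affine_schur m r :: ('k, 'k schur_elem) module"
  let ?B = "affine_schur n r :: ('k, 'k schur_elem) module"
  obtain u v :: "_ \<Rightarrow> 'k schur_elem" where uv:
    "\<And>p. u p \<in> carrier ?A" "\<And>p. v p \<in> carrier ?A"
    "(\<Oplus>\<^bsub>?A\<^esub>p\<in>I \<times> J. u p \<otimes>\<^bsub>?A\<^esub> v p) = \<one>\<^bsub>?A\<^esub>"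
    "\<And>f p q. f \<in> carrier ?A \<Longrightarrow>
      equivariant_embedding.block m m r (\<lambda>x. \<sigma> (\<rho> x)) (\<lambda>x. (c x, d (\<rho> x))) f p q = v p \<otimes>\<^bsub>?A\<^esub> f \<otimes>\<^bsub>?A\<^esub> u q"
    by (rule block_self_embedding[OF equivariant_embedding_comp[OF e e']], rule that)
  obtain u' v' :: "_ \<Rightarrow> 'k schur_elem" where uv':
    "\<And>p. u' p \<in> carrier ?B" "\<And>p. v' p \<in> carrier ?B"
    "(\<Oplus>\<^bsub>?B\<^esub>p\<in>J \<times> I. u' p \<otimes>\<^bsub>?B\<^esub> v' p) = \<one>\<^bsub>?B\<^esub>"
    "\<And>f p q. f \<in> carrier ?B \<Longrightarrow>
      equivariant_embedding.block n n r (\<lambda>x. \<rho> (\<sigma> x)) (\<lambda>x. (d x, c (\<sigma> x))) f p q = v' p \<otimes>\<^bsub>?B\<^esub> f \<otimes>\<^bsub>?B\<^esub> u' q"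
    by (rule block_self_embedding[OF equivariant_embedding_comp[OF e' e]], rule that)
  show ?thesis
  proof (rule morita_equivalent_matrix_homs[OF assms(1) R.matrix_hom_block S.matrix_hom_block])
    show "S.block (R.block a (fst p) (fst q)) (snd p) (snd q) = v p \<otimes>\<^bsub>?A\<^esub> a \<otimes>\<^bsub>?A\<^esub> u q"
      if "a \<in> carrier ?A" for a p q
      using uv(4)[OF that, of p q] block_comp[OF e e', of a "fst p" "fst q" "snd p" "snd q"] by simp
    show "R.block (S.block b (fst p) (fst q)) (snd p) (snd q) = v' p \<otimes>\<^bsub>?B\<^esub> b \<otimes>\<^bsub>?B\<^esub> u' q"
      if "b \<in> carrier ?B" for b p q
      using uv'(4)[OF that, of p q] block_comp[OF e' e, of b "fst p" "fst q" "snd p" "snd q"] by simp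
  qed (rule uv(1-3) uv'(1-3))+
qed

section \<open>Comparing \<open>n\<close> and \<open>n + 1\<close> residues\<close>

text \<open>
  The increasing map from the integers onto the integers not congruent to \<open>n\<close> modulo \<open>n + 1\<close> that
  turns a shift by \<open>n\<close> into a shift by \<open>n + 1\<close>.
\<close>

definition stretch :: "nat \<Rightarrow> int \<Rightarrow> int" where
  "stretch n z = z mod int n + int (n + 1) * (z div int n)"

text \<open>
  On integers not congruent to \<open>c\<close> modulo \<open>n + 1\<close>, the residue \<open>n\<close> is renamed to the vacant residue
  \<open>c\<close>, and the remaining residues \<open>0, \<dots>, n - 1\<close> are used as residues modulo \<open>n\<close>.
\<close>

definition squeeze :: "nat \<Rightarrow> nat \<Rightarrow> int \<Rightarrow> int" where
  "squeeze n c z = (if z mod int (n + 1) = int n then int c else z mod int (n + 1)) +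
     int n * (z div int (n + 1))"

definition residues :: "nat \<Rightarrow> nat \<Rightarrow> tuple \<Rightarrow> int set" where
  "residues m r i = (\<lambda>a. i a mod int m) ` {1..r}"

definition free_residue :: "nat \<Rightarrow> nat \<Rightarrow> tuple \<Rightarrow> nat" where
  "free_residue n r i = (LEAST c. int c \<notin> residues (n + 1) r i)"

lemma stretch_embedding:
  assumes n: "n \<ge> 1"
  shows "equivariant_embedding n (n + 1) r (\<lambda>i. \<lambda>a\<in>{1..r}. stretch n (i a)) (\<lambda>_. 0 :: nat) {0}"
proof
  have shift: "stretch n (z + int n * e) = stretch n z + int (n + 1) * e" for z e
    using n by (simp add: stretch_def algebra_simps)
  have inv: "z = stretch n z mod int (n + 1) + int n * (stretch n z div int (n + 1))" for z
  proof -
    have "0 \<le> z mod int n" "z mod int n < int (n + 1)" using n by (simp_all add: less_le_trans[OF pos_mod_bound])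
    then have "stretch n z mod int (n + 1) = z mod int n" "stretch n z div int (n + 1) = z div int n"
      unfolding stretch_def by simp_all
    then show ?thesis by simp
  qed
  show "(\<lambda>a\<in>{1..r}. stretch n (weyl_act n r x w a)) = weyl_act (n + 1) r (\<lambda>a\<in>{1..r}. stretch n (x a)) w"
    if "w \<in> affine_weyl r" for x w
  proof
    have "a \<in> {1..r} \<Longrightarrow> fst w a \<in> {1..r}" for a
      using that permutes_in_image[of "fst w" "{1..r}" a] by (auto simp: affine_weyl_def)
    then show "(\<lambda>a\<in>{1..r}. stretch n (weyl_act n r x w a)) a =
        weyl_act (n + 1) r (\<lambda>a\<in>{1..r}. stretch n (x a)) w a" for a
      by (cases "a \<in> {1..r}") (simp_all add: weyl_act_def shift del: atLeastAtMost_iff)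
  qed
  show "x = y" if "x \<in> tuples r" "y \<in> tuples r"
    "(\<lambda>a\<in>{1..r}. stretch n (x a)) = (\<lambda>a\<in>{1..r}. stretch n (y a))" for x y
  proof (rule PiE_ext[of x "{1..r}" "\<lambda>_. UNIV" y])
    fix a assume "a \<in> {1..r}"
    then have "stretch n (x a) = stretch n (y a)" using fun_cong[OF that(3), of a] by simp
    then show "x a = y a" using inv[of "x a"] inv[of "y a"] by simp
  qed (use that in \<open>auto simp: tuples_def\<close>)
qed (use n in \<open>auto simp: tuples_def\<close>)

text \<open>
  An \<open>r\<close>-tuple has at most \<open>r\<close> residues, fewer than the \<open>n + 1\<close> candidates.
\<close>

lemma free_residue:
  assumes "r \<le> n"
  shows "int (free_residue n r i) \<notin> residues (n + 1) r i" "free_residue n r i \<le> n"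
proof -
  have "\<not> int ` {0..n} \<subseteq> residues (n + 1) r i"
  proof
    assume "int ` {0..n} \<subseteq> residues (n + 1) r i"
    then have "card (int ` {0..n}) \<le> card (residues (n + 1) r i)"
      by (rule card_mono[rotated]) (simp add: residues_def)
    also have "\<dots> \<le> card {1..r}" unfolding residues_def by (rule card_image_le) simp
    also have "card (int ` {0..n}) = n + 1" by (simp add: card_image)
    finally show False using assms by simp
  qed
  then obtain x where x: "x \<in> int ` {0..n}" "x \<notin> residues (n + 1) r i" by blast
  then obtain c where "x = int c" "c \<in> {0..n}" by blast
  with x(2) have c: "c \<le> n" "int c \<notin> residues (n + 1) r i" by auto
  from c(2) show "int (free_residue n r i) \<notin> residues (n + 1) r i"
    unfolding free_residue_def by (rule LeastI)
  show "free_residue n r i \<le> n"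
    unfolding free_residue_def using Least_le[of "\<lambda>c. int c \<notin> residues (n + 1) r i", OF c(2)] c(1) by simp
qed

lemma residues_act:
  assumes "w \<in> affine_weyl r"
  shows "residues m r (weyl_act m r i w) = residues m r i"
proof -
  have w: "fst w permutes {1..r}" using assms by (auto simp: affine_weyl_def)
  have "residues m r (weyl_act m r i w) = (\<lambda>a. i (fst w a) mod int m) ` {1..r}"
    unfolding residues_def by (intro image_cong refl) (simp add: weyl_act_def)
  also have "\<dots> = (\<lambda>a. i a mod int m) ` fst w ` {1..r}" by (simp add: image_image)
  also have "\<dots> = residues m r i" unfolding permutes_image[OF w] residues_def ..
  finally show ?thesis .
qed

lemma squeeze_inj:
  assumes n: "n \<ge> 1" and c: "c \<le> n"
    and z: "z mod int (n + 1) \<noteq> int c" and z': "z' mod int (n + 1) \<noteq> int c"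
    and eq: "squeeze n c z = squeeze n c z'"
  shows "z = z'"
proof -
  let ?t = "\<lambda>z. if z mod int (n + 1) = int n then int c else z mod int (n + 1)"
  have t: "squeeze n c z mod int n = ?t z" "squeeze n c z div int n = z div int (n + 1)"
    if "z mod int (n + 1) \<noteq> int c" for z
  proof -
    define k where "k = z mod int (n + 1)"
    have "0 \<le> k" "k < int (n + 1)" "k \<noteq> int c"
      unfolding k_def by (rule pos_mod_sign pos_mod_bound, simp)+ (rule that)
    then have k: "0 \<le> k" "k < int n + 1" "k \<noteq> int c" by simp_all
    have "?t z = (if k = int n then int c else k)" by (simp only: k_def)
    then have "0 \<le> ?t z" "?t z < int n" using k c by (auto split: if_splits)
    moreover have "(t + int n * d) mod int n = t" "(t + int n * d) div int n = d"
      if "0 \<le> t" "t < int n" for t d using that by simp_all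
    ultimately show "squeeze n c z mod int n = ?t z" "squeeze n c z div int n = z div int (n + 1)"
      unfolding squeeze_def by blast+
  qed
  have "z div int (n + 1) = z' div int (n + 1)" "?t z = ?t z'"
    using t[OF z] t[OF z'] eq by simp_all
  moreover from this have "z mod int (n + 1) = z' mod int (n + 1)"
    using z z' by (auto split: if_splits)
  ultimately show ?thesis by (metis div_mult_mod_eq)
qed

text \<open>
  The missed residue depends only on the set of residues of the tuple, which the group does not
  change; hence it may serve as the second component. Knowing it, the squeezing can be undone.
\<close>

lemma squeeze_embedding:
  assumes n: "n \<ge> 1" and r: "r \<le> n"
  shows "equivariant_embedding (n + 1) n r
    (\<lambda>i. \<lambda>a\<in>{1..r}. squeeze n (free_residue n r i) (i a)) (free_residue n r) {0..n}"
proof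
  have shift: "squeeze n c (z + int (n + 1) * e) = squeeze n c z + int n * e" for c z e
  proof -
    have "(z + int (n + 1) * e) mod int (n + 1) = z mod int (n + 1)"
      "(z + int (n + 1) * e) div int (n + 1) = z div int (n + 1) + e" by simp_all
    then show ?thesis unfolding squeeze_def by (simp only: distrib_left add.assoc)
  qed
  have free_act: "free_residue n r (weyl_act (n + 1) r x w) = free_residue n r x"
    if "w \<in> affine_weyl r" for x w
    unfolding free_residue_def residues_act[OF that] ..
  then show "free_residue n r (weyl_act (n + 1) r x w) = free_residue n r x"
    if "w \<in> affine_weyl r" for x w using that .
  show "(\<lambda>a\<in>{1..r}. squeeze n (free_residue n r (weyl_act (n + 1) r x w)) (weyl_act (n + 1) r x w a)) =
      weyl_act n r (\<lambda>a\<in>{1..r}. squeeze n (free_residue n r x) (x a)) w"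
    if "w \<in> affine_weyl r" for x w
    unfolding free_act[OF that]
  proof
    have "a \<in> {1..r} \<Longrightarrow> fst w a \<in> {1..r}" for a
      using that permutes_in_image[of "fst w" "{1..r}" a] by (auto simp: affine_weyl_def)
    then show "(\<lambda>a\<in>{1..r}. squeeze n (free_residue n r x) (weyl_act (n + 1) r x w a)) a =
        weyl_act n r (\<lambda>a\<in>{1..r}. squeeze n (free_residue n r x) (x a)) w a" for a
      unfolding weyl_act_def by (cases "a \<in> {1..r}") (simp_all only: shift restrict_apply' restrict_apply if_False if_True)
  qed
  show "x = y" if x: "x \<in> tuples r" and y: "y \<in> tuples r"
    and eq: "(\<lambda>a\<in>{1..r}. squeeze n (free_residue n r x) (x a)) = (\<lambda>a\<in>{1..r}. squeeze n (free_residue n r y) (y a))"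
    and free: "free_residue n r x = free_residue n r y" for x y
  proof (rule PiE_ext[of x "{1..r}" "\<lambda>_. UNIV" y])
    fix a assume a: "a \<in> {1..r}"
    then have eq_a: "squeeze n (free_residue n r x) (x a) = squeeze n (free_residue n r x) (y a)"
      using fun_cong[OF eq, of a] free by simp
    have not_free: "x a mod int (n + 1) \<noteq> int (free_residue n r x)" for x
    proof
      assume eq: "x a mod int (n + 1) = int (free_residue n r x)"
      have "int (free_residue n r x) \<in> residues (n + 1) r x"
        unfolding residues_def eq[symmetric] by (rule imageI[OF a])
      then show False using free_residue(1)[OF r, of x] by contradiction
    qed
    show "x a = y a"
      by (rule squeeze_inj[OF n free_residue(2)[OF r] not_free not_free[of y, folded free] eq_a])
  qed (use x y in \<open>auto simp: tuples_def\<close>)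
qed (use n free_residue(2)[OF r] in \<open>auto simp: tuples_def\<close>)

theorem theorem3p4:
  fixes n r :: nat
  assumes "infinite (UNIV :: 'k::field set)"
    and "n \<ge> 1" and "r \<ge> 1" and "n \<ge> r"
  shows "morita_equivalent TYPE('u)
    (affine_schur (n + 1) r :: ('k, 'k schur_elem) module)
    (affine_schur n r :: ('k, 'k schur_elem) module)"
  using assms(1) squeeze_embedding[OF assms(2,4)] stretch_embedding[OF assms(2)]
  by (rule morita_equivalent_embeddings)

end
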